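(* Let $\theta\in(0,1)$ be irrational, $\mu\in\mathbb{R}\setminus[0,4]$, and let $h:\mathbb{R}\to\mathbb{R}$ be even, smooth and exponentially decaying. Let $H_r(b)$ be the reduced incommensurate coupled chain operators on $\ell^2(\mathbb{Z})$ and, for positive integers $L$, let $\Lambda_L:=[-L,L]\cap\mathbb{Z}$ and $H_{r,L}(b):=1_{\Lambda_L}H_r(b)1_{\Lambda_L}$. Then for all $b\in[0,1-\theta)$ outside of a set of Lebesgue measure $0$, and all $g\in C_c(\mathbb{R})$, $$\lim_{L\to\infty}\frac{1}{|\Lambda_L|}\sum_{x\in\Lambda_L}\langle\delta_x,g(H_{r,L}(b))\delta_x\rangle = \frac{1}{1-\theta}\int_0^{1-\theta}\langle\delta_0,g(H_r(b'))\delta_0\rangle\,\mathrm{d}b'.$$ In particular, for such $b$ the empirical density of states measures converge weakly: $\lim_{L\to\infty}\int g\,\mathrm{d}k_{b,L}=\int g\,\mathrm{d}k$ for all $g\in C_c(\mathbb{R})$.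
   Context: The discrete Laplacian is $(\Delta\psi)_n := \psi_{n+1}-2\psi_n+\psi_{n-1}$ on $\ell^2(\mathbb{Z})$; the spectrum of $-\Delta$ is $[0,4]$, and $(-\Delta-\mu)^{-1}_{nn'}$ are the matrix elements of the inverse of $-\Delta-\mu$. Exponentially decaying means $|h(\eta)|\le Ce^{-c|\eta|}$ for some $C,c>0$. For $b\in\mathbb{R}$, the reduced incommensurate coupled chain operator is the self-adjoint operator on $\ell^2(\mathbb{Z})$ $$(H_r(b)\psi)_n := -(\Delta\psi)_n - \sum_{n'\in\mathbb{Z}} h(n-(1-\theta)n'-b)\sum_{n''\in\mathbb{Z}}(-\Delta-\mu)^{-1}_{n'n''}\sum_{n'''\in\mathbb{Z}} h((1-\theta)n''+b-n''')\psi_{n'''}.$$ $1_{\Lambda_L}$ is multiplication by the characteristic function of $\Lambda_L$; $\delta_x$ is the vector whose $x$th entry is $1$ and all others $0$; $C_c(\mathbb{R})$ is the space of continuous compactly supported functions; $|\Lambda_L|=2L+1$. The empirical density of states measure $\mathrm{d}k_{b,L}$ is the unique Radon measure on $\mathbb{R}$ with $\int g\,\mathrm{d}k_{b,L}=\frac{1}{|\Lambda_L|}\sum_{x\in\Lambda_L}\langle\delta_x,g(H_{r,L}(b))\delta_x\rangle$ for all $g\in C_c(\mathbb{R})$. The density of states measure $\mathrm{d}k$ is the unique Radon measure with $\int g\,\mathrm{d}k=\frac{1}{1-\theta}\int_0^{1-\theta}\langle\delta_0,g(H_r(b'))\delta_0\rangle\,\mathrm{d}b'$ for all $g\in C_c(\mathbb{R})$.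 *)

theory Defs
  imports "HOL-Analysis.Analysis" "HOL-Computational_Algebra.Polynomial"
begin

section \<open>The complex Hilbert space of square-summable two-sided sequences\<close>

typedef ell2 = "{\<psi> :: int \<Rightarrow> complex. (\<lambda>n. (cmod (\<psi> n))\<^sup>2) summable_on UNIV}"
  morphisms coord Abs_ell2
  by (rule exI[of _ "\<lambda>_. 0"]) simp

setup_lifting type_definition_ell2

lemma ell2_eqI: "(\<And>n. coord \<phi> n = coord \<psi> n) \<Longrightarrow> \<phi> = \<psi>"
  by (simp add: coord_inject[symmetric] ext)

lemma square_summable_coord: "(\<lambda>n. (cmod (coord \<psi> n))\<^sup>2) summable_on UNIV"
  using coord[of \<psi>] by simp

lemma square_summable_add:
  fixes f g :: "int \<Rightarrow> complex"
  assumes f: "(\<lambda>n. (cmod (f n))\<^sup>2) summable_on UNIV"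
    and g: "(\<lambda>n. (cmod (g n))\<^sup>2) summable_on UNIV"
  shows "(\<lambda>n. (cmod (f n + g n))\<^sup>2) summable_on UNIV"
proof (rule summable_on_comparison_test)
  show "(\<lambda>n. 2 * (cmod (f n))\<^sup>2 + 2 * (cmod (g n))\<^sup>2) summable_on UNIV"
    by (intro summable_on_add summable_on_cmult_right f g)
  show "(cmod (f n + g n))\<^sup>2 \<le> 2 * (cmod (f n))\<^sup>2 + 2 * (cmod (g n))\<^sup>2" for n
  proof -
    have "(cmod (f n + g n))\<^sup>2 \<le> (cmod (f n) + cmod (g n))\<^sup>2"
      by (simp add: norm_triangle_ineq power_mono)
    also have "\<dots> \<le> 2 * (cmod (f n))\<^sup>2 + 2 * (cmod (g n))\<^sup>2"
      using sum_squares_bound[of "cmod (f n)" "cmod (g n)"] by (simp add: power2_sum)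
    finally show ?thesis .
  qed
qed auto

lemma square_summable_scale:
  fixes f :: "int \<Rightarrow> complex"
  assumes "(\<lambda>n. (cmod (f n))\<^sup>2) summable_on UNIV"
  shows "(\<lambda>n. (cmod (c * f n))\<^sup>2) summable_on UNIV"
  using summable_on_cmult_right[OF assms, of "(cmod c)\<^sup>2"]
  by (simp add: norm_mult power_mult_distrib)

lemma square_summable_shift:
  fixes f :: "int \<Rightarrow> complex"
  assumes "(\<lambda>n. (cmod (f n))\<^sup>2) summable_on UNIV"
  shows "(\<lambda>n. (cmod (f (n + k)))\<^sup>2) summable_on UNIV"
proof -
  have "bij_betw (\<lambda>n::int. n + k) UNIV UNIV"
    by (rule bij_betw_byWitness[where f' = "\<lambda>n. n - k"]) auto
  from summable_on_reindex_bij_betw[OF this, of "\<lambda>n. (cmod (f n))\<^sup>2"] assms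
  show ?thesis by simp
qed

lift_definition scaleC :: "complex \<Rightarrow> ell2 \<Rightarrow> ell2" (infixr "*\<^sub>C" 75)
  is "\<lambda>c \<psi> n. c * \<psi> n"
  by (simp add: square_summable_scale)

lemma square_summable_unit:
  "(\<lambda>n::int. (cmod (if n = x then 1 else 0))\<^sup>2) summable_on UNIV"
proof -
  have "(\<lambda>n. (cmod (if n = x then 1 else 0))\<^sup>2) summable_on {x}"
    by simp
  also have "?this \<longleftrightarrow> ?thesis"
    by (rule summable_on_cong_neutral) auto
  finally show ?thesis .
qed

lift_definition \<delta> :: "int \<Rightarrow> ell2" is "\<lambda>x n. if n = x then 1 else 0"
  by (rule square_summable_unit)

definition cinner :: "ell2 \<Rightarrow> ell2 \<Rightarrow> complex" where
  "cinner \<phi> \<psi> = (\<Sum>\<^sub>\<infinity>n. cnj (coord \<phi> n) * coord \<psi> n)"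

lemma abs_summable_inner_coord:
  "(\<lambda>n. norm (inner (coord \<phi> n) (coord \<psi> n))) summable_on UNIV"
proof (rule summable_on_comparison_test)
  show "(\<lambda>n. (cmod (coord \<phi> n))\<^sup>2 + (cmod (coord \<psi> n))\<^sup>2) summable_on UNIV"
    by (intro summable_on_add square_summable_coord)
  show "norm (inner (coord \<phi> n) (coord \<psi> n)) \<le> (cmod (coord \<phi> n))\<^sup>2 + (cmod (coord \<psi> n))\<^sup>2" for n
  proof -
    have "norm (inner (coord \<phi> n) (coord \<psi> n)) \<le> cmod (coord \<phi> n) * cmod (coord \<psi> n)"
      using Cauchy_Schwarz_ineq2 by simp
    also have "\<dots> \<le> (cmod (coord \<phi> n))\<^sup>2 + (cmod (coord \<psi> n))\<^sup>2"
      using sum_squares_bound[of "cmod (coord \<phi> n)" "cmod (coord \<psi> n)"]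
        mult_nonneg_nonneg[OF norm_ge_zero[of "coord \<phi> n"] norm_ge_zero[of "coord \<psi> n"]]
      by linarith
    finally show ?thesis .
  qed
qed auto

lemma summable_inner_coord:
  "(\<lambda>n. inner (coord \<phi> n) (coord \<psi> n)) summable_on UNIV"
  using abs_summable_inner_coord by (rule abs_summable_summable)

text \<open>
  The class \<^class>\<open>real_inner\<close> provides the norm of the complex Hilbert space; its inner
  product is the real part of \<^const>\<open>cinner\<close>.
\<close>

instantiation ell2 :: real_inner
begin

lift_definition zero_ell2 :: ell2 is "\<lambda>_. 0"
  by simp

lift_definition plus_ell2 :: "ell2 \<Rightarrow> ell2 \<Rightarrow> ell2" is "\<lambda>\<phi> \<psi> n. \<phi> n + \<psi> n"
  by (simp add: square_summable_add)

lift_definition uminus_ell2 :: "ell2 \<Rightarrow> ell2" is "\<lambda>\<psi> n. - \<psi> n"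
  by simp

definition minus_ell2 :: "ell2 \<Rightarrow> ell2 \<Rightarrow> ell2" where
  "minus_ell2 \<phi> \<psi> = \<phi> + - \<psi>"

definition scaleR_ell2 :: "real \<Rightarrow> ell2 \<Rightarrow> ell2" where
  "scaleR_ell2 r \<psi> = complex_of_real r *\<^sub>C \<psi>"

definition inner_ell2 :: "ell2 \<Rightarrow> ell2 \<Rightarrow> real" where
  "inner_ell2 \<phi> \<psi> = (\<Sum>\<^sub>\<infinity>n. inner (coord \<phi> n) (coord \<psi> n))"

definition norm_ell2 :: "ell2 \<Rightarrow> real" where
  "norm_ell2 \<psi> = sqrt (\<Sum>\<^sub>\<infinity>n. (cmod (coord \<psi> n))\<^sup>2)"

definition dist_ell2 :: "ell2 \<Rightarrow> ell2 \<Rightarrow> real" where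
  "dist_ell2 \<phi> \<psi> = norm (\<phi> - \<psi>)"

definition sgn_ell2 :: "ell2 \<Rightarrow> ell2" where
  "sgn_ell2 \<psi> = inverse (norm \<psi>) *\<^sub>R \<psi>"

definition uniformity_ell2 :: "(ell2 \<times> ell2) filter" where
  "uniformity_ell2 = (INF e\<in>{0 <..}. principal {(\<phi>, \<psi>). dist \<phi> \<psi> < e})"

definition open_ell2 :: "ell2 set \<Rightarrow> bool" where
  "open_ell2 U \<longleftrightarrow> (\<forall>\<psi>\<in>U. eventually (\<lambda>(\<psi>', \<phi>). \<psi>' = \<psi> \<longrightarrow> \<phi> \<in> U) uniformity)"

instance
proof
  fix a b c :: ell2 and r s :: real
  show "a + b + c = a + (b + c)"
    by (rule ell2_eqI) (simp add: plus_ell2.rep_eq add.assoc)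
  show "a + b = b + a"
    by (rule ell2_eqI) (simp add: plus_ell2.rep_eq add.commute)
  show "0 + a = a"
    by (rule ell2_eqI) (simp add: plus_ell2.rep_eq zero_ell2.rep_eq)
  show "- a + a = 0"
    by (rule ell2_eqI) (simp add: plus_ell2.rep_eq uminus_ell2.rep_eq zero_ell2.rep_eq)
  show "a - b = a + - b"
    by (rule minus_ell2_def)
  show "r *\<^sub>R (a + b) = r *\<^sub>R a + r *\<^sub>R b"
    by (rule ell2_eqI) (simp add: scaleR_ell2_def scaleC.rep_eq plus_ell2.rep_eq algebra_simps)
  show "(r + s) *\<^sub>R a = r *\<^sub>R a + s *\<^sub>R a"
    by (rule ell2_eqI) (simp add: scaleR_ell2_def scaleC.rep_eq plus_ell2.rep_eq algebra_simps)
  show "r *\<^sub>R s *\<^sub>R a = (r * s) *\<^sub>R a"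
    by (rule ell2_eqI) (simp add: scaleR_ell2_def scaleC.rep_eq)
  show "1 *\<^sub>R a = a"
    by (rule ell2_eqI) (simp add: scaleR_ell2_def scaleC.rep_eq)
  show "dist a b = norm (a - b)"
    by (rule dist_ell2_def)
  show "sgn a = inverse (norm a) *\<^sub>R a"
    by (rule sgn_ell2_def)
  show "uniformity = (INF e\<in>{0 <..}. principal {(x :: ell2, y). dist x y < e})"
    by (rule uniformity_ell2_def)
  show "open U \<longleftrightarrow> (\<forall>x\<in>U. eventually (\<lambda>(x', y). x' = x \<longrightarrow> y \<in> U) uniformity)"
    for U :: "ell2 set"
    by (rule open_ell2_def)
  show "inner a b = inner b a"
    by (simp add: inner_ell2_def inner_commute)
  show "inner (a + b) c = inner a c + inner b c"
    unfolding inner_ell2_def plus_ell2.rep_eq inner_add_left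
    by (rule infsum_add) (rule summable_inner_coord)+
  show "inner (r *\<^sub>R a) b = r * inner a b"
    unfolding inner_ell2_def scaleR_ell2_def scaleC.rep_eq
    by (simp add: infsum_cmult_right[symmetric] summable_inner_coord
        scaleR_conv_of_real[symmetric])
  show "0 \<le> inner a a"
    unfolding inner_ell2_def by (rule infsum_nonneg) simp
  show "norm a = sqrt (inner a a)"
    by (simp add: norm_ell2_def inner_ell2_def power2_norm_eq_inner)
  show "inner a a = 0 \<longleftrightarrow> a = 0"
  proof
    assume *: "inner a a = 0"
    have "inner (coord a n) (coord a n) = 0" for n
      by (rule nonneg_infsum_le_0D[where A = UNIV])
        (use * summable_inner_coord[of a a] in \<open>auto simp: inner_ell2_def\<close>)
    then show "a = 0"
      by (intro ell2_eqI) (simp add: zero_ell2.rep_eq)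
  next
    assume "a = 0"
    then show "inner a a = 0"
      by (simp add: inner_ell2_def zero_ell2.rep_eq)
  qed
qed

end

section \<open>Operators and continuous functional calculus\<close>

definition bounded_clinear :: "(ell2 \<Rightarrow> ell2) \<Rightarrow> bool" where
  "bounded_clinear A \<longleftrightarrow> bounded_linear A \<and> (\<forall>c \<psi>. A (c *\<^sub>C \<psi>) = c *\<^sub>C A \<psi>)"

definition spectrum :: "(ell2 \<Rightarrow> ell2) \<Rightarrow> complex set" where
  "spectrum A = {z. \<not> (\<exists>R. bounded_clinear R \<and>
     (\<forall>\<psi>. R (A \<psi> - z *\<^sub>C \<psi>) = \<psi>) \<and> (\<forall>\<psi>. A (R \<psi>) - z *\<^sub>C R \<psi> = \<psi>))}"

definition poly_op :: "complex poly \<Rightarrow> (ell2 \<Rightarrow> ell2) \<Rightarrow> ell2 \<Rightarrow> ell2" where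
  "poly_op p A \<psi> = (\<Sum>i\<le>degree p. coeff p i *\<^sub>C (A ^^ i) \<psi>)"

text \<open>
  For a bounded self-adjoint \<open>A\<close> (whose spectrum is a compact set of reals) and continuous \<open>g\<close>,
  the operator \<open>g(A)\<close> is the limit in operator norm of \<open>p\<^sub>k(A)\<close> for any
  polynomials \<open>p\<^sub>k\<close> converging to \<open>g\<close> uniformly on the spectrum of \<open>A\<close>.
\<close>

definition cfc :: "(real \<Rightarrow> complex) \<Rightarrow> (ell2 \<Rightarrow> ell2) \<Rightarrow> ell2 \<Rightarrow> ell2" where
  "cfc g A = (THE B. bounded_clinear B \<and>
     (\<forall>p :: nat \<Rightarrow> complex poly.
        uniform_limit {x. complex_of_real x \<in> spectrum A}
          (\<lambda>k x. poly (p k) (complex_of_real x)) g sequentially \<longrightarrow>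
        (\<lambda>k. onorm (\<lambda>\<psi>. poly_op (p k) A \<psi> - B \<psi>)) \<longlonglongrightarrow> 0))"

section \<open>The reduced incommensurate coupled chain\<close>

lemma square_summable_laplacian:
  fixes \<psi> :: "int \<Rightarrow> complex"
  assumes \<psi>: "(\<lambda>n. (cmod (\<psi> n))\<^sup>2) summable_on UNIV"
  shows "(\<lambda>n. (cmod (\<psi> (n + 1) - 2 * \<psi> n + \<psi> (n - 1)))\<^sup>2) summable_on UNIV"
proof -
  have "(\<lambda>n. (cmod ((\<psi> (n + 1) + (- 2) * \<psi> n) + \<psi> (n + - 1)))\<^sup>2) summable_on UNIV"
    by (intro square_summable_add square_summable_shift square_summable_scale \<psi>)
  then show ?thesis
    by simp
qed

lift_definition laplacian :: "ell2 \<Rightarrow> ell2"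
  is "\<lambda>\<psi> n. \<psi> (n + 1) - 2 * \<psi> n + \<psi> (n - 1)"
  by (rule square_summable_laplacian)

definition laplacian_resolvent :: "real \<Rightarrow> ell2 \<Rightarrow> ell2" where
  "laplacian_resolvent \<mu> = inv (\<lambda>\<psi>. - laplacian \<psi> - \<mu> *\<^sub>R \<psi>)"

definition resolvent_entry :: "real \<Rightarrow> int \<Rightarrow> int \<Rightarrow> complex" where
  "resolvent_entry \<mu> n n' = cinner (\<delta> n) (laplacian_resolvent \<mu> (\<delta> n'))"

definition H\<^sub>r :: "real \<Rightarrow> real \<Rightarrow> (real \<Rightarrow> real) \<Rightarrow> real \<Rightarrow> ell2 \<Rightarrow> ell2" where
  "H\<^sub>r \<theta> \<mu> h b \<psi> = Abs_ell2 (\<lambda>n. - coord (laplacian \<psi>) n -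
     (\<Sum>\<^sub>\<infinity>n'. of_real (h (of_int n - (1 - \<theta>) * of_int n' - b)) *
       (\<Sum>\<^sub>\<infinity>n''. resolvent_entry \<mu> n' n'' *
         (\<Sum>\<^sub>\<infinity>n'''. of_real (h ((1 - \<theta>) * of_int n'' + b - of_int n''')) * coord \<psi> n'''))))"

definition \<Lambda> :: "nat \<Rightarrow> int set" where
  "\<Lambda> L = {- int L..int L}"

lift_definition restrict_ell2 :: "int set \<Rightarrow> ell2 \<Rightarrow> ell2"
  is "\<lambda>S \<psi> n. indicator S n * \<psi> n"
  by (auto elim!: summable_on_comparison_test simp: indicator_def)

text \<open>
  The truncated operator acts on all of \<^typ>\<open>ell2\<close>, vanishing on the orthogonal complement of
  the sequences supported in \<open>\<Lambda> L\<close>.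
\<close>

definition H\<^sub>r\<^sub>L ::
    "real \<Rightarrow> real \<Rightarrow> (real \<Rightarrow> real) \<Rightarrow> nat \<Rightarrow> real \<Rightarrow> ell2 \<Rightarrow> ell2" where
  "H\<^sub>r\<^sub>L \<theta> \<mu> h L b = restrict_ell2 (\<Lambda> L) \<circ> H\<^sub>r \<theta> \<mu> h b \<circ> restrict_ell2 (\<Lambda> L)"

section \<open>Hypotheses on the hopping function\<close>

definition smooth :: "(real \<Rightarrow> real) \<Rightarrow> bool" where
  "smooth h \<longleftrightarrow> (\<forall>k x. (deriv ^^ k) h field_differentiable at x)"

definition exponentially_decaying :: "(real \<Rightarrow> real) \<Rightarrow> bool" where
  "exponentially_decaying h \<longleftrightarrow> (\<exists>C>0. \<exists>c>0. \<forall>\<eta>. \<bar>h \<eta>\<bar> \<le> C * exp (- c * \<bar>\<eta>\<bar>))"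

section \<open>Density of states measures\<close>

definition C\<^sub>c :: "(real \<Rightarrow> complex) set" where
  "C\<^sub>c = {g. continuous_on UNIV g \<and> compact (closure {x. g x \<noteq> 0})}"

definition radon_measure :: "real measure \<Rightarrow> bool" where
  "radon_measure M \<longleftrightarrow> sets M = sets borel \<and>
     (\<forall>K. compact K \<longrightarrow> emeasure M K < \<infinity>) \<and>
     (\<forall>A\<in>sets borel. emeasure M A = (SUP K\<in>{K. K \<subseteq> A \<and> compact K}. emeasure M K))"

definition empirical_dos ::
    "real \<Rightarrow> real \<Rightarrow> (real \<Rightarrow> real) \<Rightarrow> real \<Rightarrow> nat \<Rightarrow> real measure" where
  "empirical_dos \<theta> \<mu> h b L = (THE M. radon_measure M \<and>
     (\<forall>g\<in>C\<^sub>c. integral\<^sup>L M g =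
        (\<Sum>x\<in>\<Lambda> L. cinner (\<delta> x) (cfc g (H\<^sub>r\<^sub>L \<theta> \<mu> h L b) (\<delta> x))) / of_nat (card (\<Lambda> L))))"

definition dos :: "real \<Rightarrow> real \<Rightarrow> (real \<Rightarrow> real) \<Rightarrow> real measure" where
  "dos \<theta> \<mu> h = (THE M. radon_measure M \<and>
     (\<forall>g\<in>C\<^sub>c. integral\<^sup>L M g =
        (LBINT b':{0..1 - \<theta>}. cinner (\<delta> 0) (cfc g (H\<^sub>r \<theta> \<mu> h b') (\<delta> 0))) /
          of_real (1 - \<theta>)))"

end

theory Submission
  imports Defs "HOL-Computational_Algebra.Fundamental_Theorem_Algebra" "HOL-Probability.Probability"
begin

text \<open>
  The reduced operator is \<open>- \<Delta> - B R B\<^sup>T\<close> with kernel operators \<open>B\<close>, \<open>R\<close> that pass Schur's test, so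
  it is bounded uniformly in \<open>b\<close> and norm continuous in \<open>b\<close>; it is \<open>1 - \<theta>\<close>-periodic in \<open>b\<close>, and
  translation by \<open>x\<close> turns \<open>b\<close> into \<open>b - x\<close>. Hence the diagonal entry at \<open>x\<close> of \<open>g(H\<^sub>r(b))\<close> is
  \<open>F(b - x)\<close> for a continuous periodic \<open>F\<close>, and as \<open>1 - \<theta>\<close> is irrational, these entries are
  equidistributed for every \<open>b\<close>. Truncation does not change the average: for a polynomial \<open>g\<close> it
  only matters near the boundary of \<open>\<Lambda>\<^sub>L\<close>, because \<open>b\<close> ranges over a compact set modulo \<open>1 - \<theta>\<close> and
  the vectors \<open>H\<^sub>r(b)\<^sup>j \<delta>\<^sub>0\<close> are therefore uniformly localized. General \<open>g\<close> are approximated by polynomials.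
  The two measures exist since a contractive unital functional on continuous functions is
  represented by a weak limit of discrete measures with Bernstein weights.
\<close>

subsection \<open>Completeness and operators\<close>

text \<open>Three objects of the statement are definite descriptions: \<open>cfc\<close>,
  \<open>empirical_dos\<close> and \<open>dos\<close>. Nothing can be said about them before
  existence and uniqueness are established, and a large share of the development serves this. For
  \<open>cfc\<close> the crux is that \<open>p(A)\<close> has norm at most the supremum of
  \<open>|p|\<close> on the spectrum; it is obtained without spectral measures, from coercivity
  estimates, a C*-identity and the factorization of polynomials over the complex numbers. All later
  work uses \<open>cfc\<close> only through an approximation estimate on \<open>[-M, M]\<close>,
  with one \<open>M\<close> valid for every \<open>b\<close> and every \<open>L\<close>, so that a
  single polynomial serves all these operators at once. Truncation breaks covariance, and the error
  it causes at sites near the boundary need not vanish; only its average over the box does.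
  Continuity of the diagonal entries in \<open>b\<close>, rather than mere measurability, lets the
  averages be controlled at each single \<open>b\<close> without an ergodic theorem.\<close>

lemma coord_add [simp]: "coord (\<phi> + \<psi>) n = coord \<phi> n + coord \<psi> n"
  by (simp add: plus_ell2.rep_eq)

lemma coord_uminus [simp]: "coord (- \<psi>) n = - coord \<psi> n"
  by (simp add: uminus_ell2.rep_eq)

lemma coord_diff [simp]: "coord (\<phi> - \<psi>) n = coord \<phi> n - coord \<psi> n"
  by (simp only: minus_ell2_def coord_add coord_uminus) simp

lemma coord_zero [simp]: "coord 0 n = 0"
  by (simp add: zero_ell2.rep_eq)

lemma coord_scaleC [simp]: "coord (c *\<^sub>C \<psi>) n = c * coord \<psi> n"
  by (simp add: scaleC.rep_eq)

lemma coord_scaleR [simp]: "coord (r *\<^sub>R \<psi>) n = of_real r * coord \<psi> n"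
  by (simp add: scaleR_ell2_def)

lemma coord_delta: "coord (\<delta> x) n = (if n = x then 1 else 0)"
  by (simp add: \<delta>.rep_eq)

lemma norm_ell2_squared: "(norm \<psi>)\<^sup>2 = (\<Sum>\<^sub>\<infinity>n. (cmod (coord \<psi> n))\<^sup>2)"
  by (simp add: norm_ell2_def infsum_nonneg)

lemma sum_coord_le_norm: "finite F \<Longrightarrow> (\<Sum>n\<in>F. (cmod (coord \<psi> n))\<^sup>2) \<le> (norm \<psi>)\<^sup>2"
  unfolding norm_ell2_squared
  by (rule finite_sum_le_infsum) (auto simp: square_summable_coord)

lemma norm_coord_le: "cmod (coord \<psi> n) \<le> norm \<psi>"
  using sum_coord_le_norm[of "{n}" \<psi>] by (simp add: power2_le_iff_abs_le)

lemma norm_ell2_le: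
  assumes "\<And>F. finite F \<Longrightarrow> (\<Sum>n\<in>F. (cmod (coord \<psi> n))\<^sup>2) \<le> K\<^sup>2" "0 \<le> K"
  shows "norm \<psi> \<le> K"
proof -
  have "(norm \<psi>)\<^sup>2 \<le> K\<^sup>2"
    unfolding norm_ell2_squared
    by (rule infsum_le_finite_sums) (use assms square_summable_coord in auto)
  then show ?thesis using assms(2) by (rule power2_le_imp_le)
qed

lemma square_summable_if_bounded:
  fixes f :: "int \<Rightarrow> complex"
  assumes "\<And>F. finite F \<Longrightarrow> (\<Sum>n\<in>F. (cmod (f n))\<^sup>2) \<le> K"
  shows "(\<lambda>n. (cmod (f n))\<^sup>2) summable_on UNIV"
  by (rule nonneg_bdd_above_summable_on) (auto intro!: bdd_aboveI[of _ K] assms)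

text \<open>The candidate limit is taken coordinatewise. Completeness is used for Banach's fixed
  point theorem in \<open>coercive_surj\<close> and for the limits that define
  \<open>g(A)\<close>.\<close>

instance ell2 :: banach
proof
  fix X :: "nat \<Rightarrow> ell2" assume X: "Cauchy X"
  have "Cauchy (\<lambda>i. coord (X i) n)" for n
  proof (rule metric_CauchyI)
    fix e :: real assume "0 < e"
    then obtain N where "\<And>i j. i \<ge> N \<Longrightarrow> j \<ge> N \<Longrightarrow> norm (X i - X j) < e"
      using X by (metis CauchyD)
    then have "\<And>i j. i \<ge> N \<Longrightarrow> j \<ge> N \<Longrightarrow> dist (coord (X i) n) (coord (X j) n) < e"
      using norm_coord_le[of "X _ - X _" n]
      by (metis coord_diff dist_norm le_less_trans)
    then show "\<exists>N. \<forall>i\<ge>N. \<forall>j\<ge>N. dist (coord (X i) n) (coord (X j) n) < e" by blast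
  qed
  then have "\<exists>l. (\<lambda>i. coord (X i) n) \<longlonglongrightarrow> l" for n
    by (simp add: Cauchy_convergent convergentD)
  then obtain f where f: "\<And>n. (\<lambda>i. coord (X i) n) \<longlonglongrightarrow> f n" by metis
  \<comment> \<open>Finite sums pass to the limit in \<open>j\<close>, and the bound does not depend
    on \<open>F\<close>. It serves twice: with \<open>N1\<close> for square summability of
    \<open>f\<close>, then for convergence in norm.\<close>
  have bound: "(\<Sum>n\<in>F. (cmod (coord (X i) n - f n))\<^sup>2) \<le> e\<^sup>2"
    if N: "\<And>i j. i \<ge> N \<Longrightarrow> j \<ge> N \<Longrightarrow> norm (X i - X j) < e" and "i \<ge> N" "finite F"
    for N e i F
  proof (rule tendsto_upperbound)
    show "(\<lambda>j. \<Sum>n\<in>F. (cmod (coord (X i) n - coord (X j) n))\<^sup>2)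
        \<longlonglongrightarrow> (\<Sum>n\<in>F. (cmod (coord (X i) n - f n))\<^sup>2)"
      by (intro tendsto_intros f)
    have "(\<Sum>n\<in>F. (cmod (coord (X i) n - coord (X j) n))\<^sup>2) \<le> e\<^sup>2" if "j \<ge> N" for j
    proof -
      have "(\<Sum>n\<in>F. (cmod (coord (X i - X j) n))\<^sup>2) \<le> (norm (X i - X j))\<^sup>2"
        using \<open>finite F\<close> by (rule sum_coord_le_norm)
      also have "\<dots> \<le> e\<^sup>2"
        using N[OF \<open>i \<ge> N\<close> that] by (intro power_mono) auto
      finally show ?thesis by simp
    qed
    then show "\<forall>\<^sub>F j in sequentially. (\<Sum>n\<in>F. (cmod (coord (X i) n - coord (X j) n))\<^sup>2) \<le> e\<^sup>2"
      by (auto simp: eventually_sequentially)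
  qed simp
  obtain N1 where N1: "\<And>i j. i \<ge> N1 \<Longrightarrow> j \<ge> N1 \<Longrightarrow> norm (X i - X j) < 1"
    using X by (metis CauchyD zero_less_one)
  have "(\<lambda>n. (cmod (coord (X N1) n - f n))\<^sup>2) summable_on UNIV"
    by (rule square_summable_if_bounded[where K = "1\<^sup>2"]) (rule bound[OF N1 order_refl])
  from square_summable_add[OF square_summable_coord[of "X N1"] square_summable_scale[OF this, of "-1"]]
  have f2: "(\<lambda>n. (cmod (f n))\<^sup>2) summable_on UNIV"
    by (rule summable_on_cong[THEN iffD1, rotated]) auto
  define \<psi> where "\<psi> = Abs_ell2 f"
  have coord_\<psi>: "coord \<psi> = f"
    using f2 by (simp add: \<psi>_def Abs_ell2_inverse)
  have "X \<longlonglongrightarrow> \<psi>"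
  proof (rule LIMSEQ_I)
    fix e :: real assume "0 < e"
    then have "0 < e / 2" by simp
    then obtain N where N: "\<And>i j. i \<ge> N \<Longrightarrow> j \<ge> N \<Longrightarrow> norm (X i - X j) < e / 2"
      using X by (metis CauchyD)
    have "norm (X i - \<psi>) \<le> e / 2" if "i \<ge> N" for i
      by (rule norm_ell2_le) (use bound[OF N that] \<open>0 < e\<close> in \<open>auto simp: coord_\<psi>\<close>)
    then show "\<exists>N. \<forall>i\<ge>N. norm (X i - \<psi>) < e"
      using \<open>0 < e\<close> by (intro exI[of _ N]) fastforce
  qed
  then show "convergent X" by (rule convergentI)
qed

lemma scaleC_add_right: "c *\<^sub>C (\<phi> + \<psi>) = c *\<^sub>C \<phi> + c *\<^sub>C \<psi>"
  by (rule ell2_eqI) (simp add: algebra_simps)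

lemma scaleC_diff_right: "c *\<^sub>C (\<phi> - \<psi>) = c *\<^sub>C \<phi> - c *\<^sub>C \<psi>"
  by (rule ell2_eqI) (simp add: algebra_simps)

lemma scaleC_add_left: "(c + d) *\<^sub>C \<psi> = c *\<^sub>C \<psi> + d *\<^sub>C \<psi>"
  by (rule ell2_eqI) (simp add: algebra_simps)

lemma scaleC_scaleC [simp]: "c *\<^sub>C d *\<^sub>C \<psi> = (c * d) *\<^sub>C \<psi>"
  by (rule ell2_eqI) simp

lemma scaleC_zero_left [simp]: "0 *\<^sub>C \<psi> = 0"
  by (rule ell2_eqI) simp

lemma scaleC_zero_right [simp]: "c *\<^sub>C 0 = 0"
  by (rule ell2_eqI) simp

lemma scaleC_one [simp]: "1 *\<^sub>C \<psi> = \<psi>"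
  by (rule ell2_eqI) simp

lemma scaleC_of_real: "of_real r *\<^sub>C \<psi> = r *\<^sub>R \<psi>"
  by (rule ell2_eqI) simp

lemma scaleC_minus_left: "(- c) *\<^sub>C \<psi> = - (c *\<^sub>C \<psi>)"
  by (rule ell2_eqI) simp

lemma norm_scaleC [simp]: "norm (c *\<^sub>C \<psi>) = cmod c * norm \<psi>"
  by (simp add: norm_ell2_def norm_mult power_mult_distrib infsum_cmult_right'
      real_sqrt_mult)

lemma inner_scaleC_left: "inner (c *\<^sub>C \<phi>) \<psi> = inner \<phi> (cnj c *\<^sub>C \<psi>)"
  unfolding inner_ell2_def
  by (rule infsum_cong) (simp add: inner_complex_def algebra_simps)

lemma norm_diff_scaleR_squared:
  fixes x y :: "'a :: real_inner"
  shows "(norm (x - t *\<^sub>R y))\<^sup>2 = (norm x)\<^sup>2 - 2 * t * inner x y + t\<^sup>2 * (norm y)\<^sup>2"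
  unfolding power2_norm_eq_inner
  by (simp add: inner_diff_left inner_diff_right inner_commute power2_eq_square algebra_simps)

lemma bounded_clinearI:
  assumes "\<And>\<phi> \<psi>. A (\<phi> + \<psi>) = A \<phi> + A \<psi>" "\<And>c \<psi>. A (c *\<^sub>C \<psi>) = c *\<^sub>C A \<psi>"
    and "\<And>\<psi>. norm (A \<psi>) \<le> norm \<psi> * K"
  shows "bounded_clinear A"
  unfolding bounded_clinear_def
proof (intro conjI bounded_linear_intro[where K = K])
  show "A (r *\<^sub>R \<psi>) = r *\<^sub>R A \<psi>" for r \<psi>
    using assms(2)[of "of_real r"] by (simp add: scaleC_of_real)
qed (use assms in auto)

lemma bounded_clinear_linear: "bounded_clinear A \<Longrightarrow> bounded_linear A"
  by (simp add: bounded_clinear_def)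

lemma bounded_clinear_scale: "bounded_clinear A \<Longrightarrow> A (c *\<^sub>C \<psi>) = c *\<^sub>C A \<psi>"
  by (simp add: bounded_clinear_def)

lemmas bounded_clinear_simps =
  linear_simps[OF bounded_clinear_linear] bounded_clinear_scale

lemma bounded_clinear_bound:
  assumes "bounded_clinear A"
  obtains K where "0 < K" "\<And>\<psi>. norm (A \<psi>) \<le> K * norm \<psi>"
  using bounded_linear.pos_bounded[OF bounded_clinear_linear[OF assms]]
  by (metis mult.commute)

lemma bounded_clinear_const_scale: "bounded_clinear (\<lambda>\<psi>. c *\<^sub>C \<psi>)"
  by (rule bounded_clinearI[where K = "cmod c"])
    (simp_all add: scaleC_add_right mult.commute)

lemma bounded_clinear_id: "bounded_clinear (\<lambda>\<psi>. \<psi>)"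
  using bounded_clinear_const_scale[of 1] by simp

lemma bounded_clinear_compose:
  assumes "bounded_clinear A" "bounded_clinear B"
  shows "bounded_clinear (\<lambda>\<psi>. A (B \<psi>))"
  using assms bounded_linear_compose[of A B] by (auto simp: bounded_clinear_def)

lemma bounded_clinear_add:
  assumes "bounded_clinear A" "bounded_clinear B"
  shows "bounded_clinear (\<lambda>\<psi>. A \<psi> + B \<psi>)"
  using assms bounded_linear_add[of A B] by (auto simp: bounded_clinear_def scaleC_add_right)

lemma bounded_clinear_diff:
  assumes "bounded_clinear A" "bounded_clinear B"
  shows "bounded_clinear (\<lambda>\<psi>. A \<psi> - B \<psi>)"
  using assms bounded_linear_sub[of A B] by (auto simp: bounded_clinear_def scaleC_diff_right)

lemma bounded_clinear_minus:
  assumes "bounded_clinear A"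
  shows "bounded_clinear (\<lambda>\<psi>. - A \<psi>)"
  using bounded_clinear_compose[OF bounded_clinear_const_scale[of "-1"] assms]
  by (simp add: scaleC_minus_left)

lemmas bounded_clinear_intros = bounded_clinear_const_scale bounded_clinear_id
  bounded_clinear_add bounded_clinear_diff bounded_clinear_minus

lemma bounded_clinear_scale_compose:
  assumes "bounded_clinear A"
  shows "bounded_clinear (\<lambda>\<psi>. c *\<^sub>C A \<psi>)"
  by (rule bounded_clinear_compose[OF bounded_clinear_const_scale assms])

text \<open>The property negated in \<open>spectrum\<close>, freed from the shift by
  \<open>z\<close>, so that it also applies to \<open>poly_op p A\<close>.\<close>

definition cinvertible :: "(ell2 \<Rightarrow> ell2) \<Rightarrow> bool" where
  "cinvertible A \<longleftrightarrow>
    (\<exists>R. bounded_clinear R \<and> (\<forall>\<psi>. R (A \<psi>) = \<psi>) \<and> (\<forall>\<psi>. A (R \<psi>) = \<psi>))"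

lemma spectrum_iff:
  assumes "bounded_clinear A"
  shows "z \<in> spectrum A \<longleftrightarrow> \<not> cinvertible (\<lambda>\<psi>. A \<psi> - z *\<^sub>C \<psi>)"
  by (simp add: spectrum_def cinvertible_def)

lemma cinvertible_compose:
  assumes "cinvertible A" "cinvertible B"
  shows "cinvertible (\<lambda>\<psi>. A (B \<psi>))"
proof -
  obtain R S where "bounded_clinear R" "\<And>\<psi>. R (A \<psi>) = \<psi>" "\<And>\<psi>. A (R \<psi>) = \<psi>"
    "bounded_clinear S" "\<And>\<psi>. S (B \<psi>) = \<psi>" "\<And>\<psi>. B (S \<psi>) = \<psi>"
    using assms by (auto simp: cinvertible_def)
  then show ?thesis
    unfolding cinvertible_def
    by (intro exI[of _ "\<lambda>\<psi>. S (R \<psi>)"]) (simp add: bounded_clinear_compose)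
qed

text \<open>Injectivity and the bound \<open>K\<close> for the inverse both come from the lower
  bound, so no open mapping argument is involved.\<close>

lemma cinvertibleI_bounded_below:
  assumes A: "bounded_clinear A" and surj: "surj A"
    and below: "\<And>\<psi>. norm \<psi> \<le> norm (A \<psi>) * K"
  shows "cinvertible A"
proof -
  have "inj A"
  proof (rule injI)
    fix \<phi> \<psi> assume "A \<phi> = A \<psi>"
    then show "\<phi> = \<psi>"
      using below[of "\<phi> - \<psi>"] A by (simp add: bounded_clinear_simps)
  qed
  note inv = inv_f_f[OF \<open>inj A\<close>] surj_f_inv_f[OF surj]
  have "bounded_clinear (inv A)"
  proof (rule bounded_clinearI)
    show "inv A (\<phi> + \<psi>) = inv A \<phi> + inv A \<psi>" for \<phi> \<psi>
      by (rule injD[OF \<open>inj A\<close>]) (simp add: bounded_clinear_simps A inv)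
    show "inv A (c *\<^sub>C \<psi>) = c *\<^sub>C inv A \<psi>" for c \<psi>
      by (rule injD[OF \<open>inj A\<close>]) (simp add: bounded_clinear_simps A inv)
    show "norm (inv A \<psi>) \<le> norm \<psi> * K" for \<psi>
      using below[of "inv A \<psi>"] by (simp add: inv)
  qed
  then show ?thesis
    unfolding cinvertible_def using inv by blast
qed

text \<open>Lax-Milgram: solutions of \<open>A \<psi> = \<phi>\<close> are the fixed points of
  \<open>\<psi> - t (A \<psi> - \<phi>)\<close>, a contraction in \<open>\<psi>\<close> for small
  \<open>t > 0\<close>. Both localizations of the spectrum below get surjectivity from here.\<close>

lemma coercive_surj:
  assumes A: "bounded_clinear A" and c: "0 < c"
    and coercive: "\<And>\<psi>. c * (norm \<psi>)\<^sup>2 \<le> inner (A \<psi>) \<psi>"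
  shows "surj A"
proof (unfold surj_def, rule allI)
  fix \<phi>
  obtain K0 where K0: "0 < K0" "\<And>\<psi>. norm (A \<psi>) \<le> K0 * norm \<psi>"
    using bounded_clinear_bound[OF A] by blast
  define K where "K = max K0 c"
  have K: "c \<le> K" "0 < K" using K0 c by (auto simp: K_def)
  have AK: "norm (A \<psi>) \<le> K * norm \<psi>" for \<psi>
    by (rule order_trans[OF K0(2)]) (auto simp: K_def intro: mult_right_mono)
  \<comment> \<open>This \<open>t\<close> minimizes \<open>1 - 2 t c + t\<^sup>2 K\<^sup>2\<close>,
    the bound for the squared contraction factor; the minimum is
    \<open>1 - c\<^sup>2 / K\<^sup>2\<close>, that is \<open>q\<^sup>2\<close>. It is nonnegative
    because \<open>K\<close> was taken at least \<open>c\<close>.\<close>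
  define t where "t = c / K\<^sup>2"
  have t: "0 < t" using c K by (simp add: t_def)
  define q where "q = sqrt (1 - c\<^sup>2 / K\<^sup>2)"
  have cK: "c\<^sup>2 / K\<^sup>2 \<le> 1" "0 < c\<^sup>2 / K\<^sup>2"
    using c K by (auto simp: power_mono)
  have contr: "norm (\<psi> - t *\<^sub>R A \<psi>) \<le> q * norm \<psi>" for \<psi>
  proof (rule power2_le_imp_le)
    have "(norm (\<psi> - t *\<^sub>R A \<psi>))\<^sup>2
        = (norm \<psi>)\<^sup>2 - 2 * t * inner (A \<psi>) \<psi> + t\<^sup>2 * (norm (A \<psi>))\<^sup>2"
      by (simp add: norm_diff_scaleR_squared inner_commute)
    also have "\<dots> \<le> (norm \<psi>)\<^sup>2 - 2 * t * (c * (norm \<psi>)\<^sup>2) + t\<^sup>2 * (K * norm \<psi>)\<^sup>2"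
      using t coercive[of \<psi>] AK[of \<psi>]
      by (intro add_mono diff_mono mult_left_mono power_mono) auto
    also have "\<dots> = (1 - c\<^sup>2 / K\<^sup>2) * (norm \<psi>)\<^sup>2"
      using K by (simp add: t_def field_simps power2_eq_square)
    also have "\<dots> = (q * norm \<psi>)\<^sup>2"
      using cK by (simp add: q_def power_mult_distrib)
    finally show "(norm (\<psi> - t *\<^sub>R A \<psi>))\<^sup>2 \<le> (q * norm \<psi>)\<^sup>2" .
  qed (use cK in \<open>simp add: q_def\<close>)
  have "\<exists>!\<psi>. \<psi> - t *\<^sub>R A \<psi> + t *\<^sub>R \<phi> = \<psi>"
  proof (rule banach_fix_type[where c = q])
    show "0 \<le> q" "q < 1" using cK by (auto simp: q_def)
    show "\<forall>x y. dist (x - t *\<^sub>R A x + t *\<^sub>R \<phi>) (y - t *\<^sub>R A y + t *\<^sub>R \<phi>) \<le> q * dist x y"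
      using contr[of "_ - _"] A by (simp add: dist_norm bounded_clinear_simps algebra_simps)
  qed
  then obtain \<psi> where "\<psi> - t *\<^sub>R A \<psi> + t *\<^sub>R \<phi> = \<psi>" by blast
  then have "t *\<^sub>R (\<phi> - A \<psi>) = 0" by (simp add: algebra_simps)
  then show "\<exists>\<psi>. \<phi> = A \<psi>" using t by auto
qed

subsection \<open>Polynomials of an operator\<close>

lemma poly_op_altdef:
  assumes "degree p \<le> n"
  shows "poly_op p A \<psi> = (\<Sum>i\<le>n. coeff p i *\<^sub>C (A ^^ i) \<psi>)"
  unfolding poly_op_def
  by (rule sum.mono_neutral_left) (use assms in \<open>auto simp: coeff_eq_0\<close>)

lemma poly_op_pCons:
  assumes A: "bounded_clinear A"
  shows "poly_op (pCons a p) A \<psi> = a *\<^sub>C \<psi> + A (poly_op p A \<psi>)"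
proof -
  have "poly_op (pCons a p) A \<psi> = (\<Sum>i\<le>Suc (degree p). coeff (pCons a p) i *\<^sub>C (A ^^ i) \<psi>)"
    by (rule poly_op_altdef) (rule degree_pCons_le)
  also have "\<dots> = a *\<^sub>C \<psi> + (\<Sum>i\<le>degree p. coeff p i *\<^sub>C A ((A ^^ i) \<psi>))"
    by (simp only: sum.atMost_Suc_shift) simp
  also have "(\<Sum>i\<le>degree p. coeff p i *\<^sub>C A ((A ^^ i) \<psi>)) = A (poly_op p A \<psi>)"
    by (simp add: poly_op_def linear_sum[OF bounded_linear.linear[OF bounded_clinear_linear[OF A]]]
        bounded_clinear_scale[OF A])
  finally show ?thesis .
qed

lemma poly_op_0 [simp]: "poly_op 0 A \<psi> = 0"
  by (simp add: poly_op_def)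

lemma bounded_clinear_poly_op:
  assumes "bounded_clinear A"
  shows "bounded_clinear (poly_op p A)"
proof (induction p)
  case 0
  have "poly_op 0 A = (\<lambda>\<psi>. 0 *\<^sub>C \<psi>)" by (rule ext) simp
  then show ?case using bounded_clinear_const_scale[of 0] by simp
next
  case (pCons a p)
  have "poly_op (pCons a p) A = (\<lambda>\<psi>. a *\<^sub>C \<psi> + A (poly_op p A \<psi>))"
    by (rule ext) (rule poly_op_pCons[OF assms])
  then show ?case
    by (simp add: bounded_clinear_intros bounded_clinear_compose assms pCons.IH)
qed

lemma poly_op_const: "poly_op [:c:] A \<psi> = c *\<^sub>C \<psi>"
  by (simp add: poly_op_def)

lemma poly_op_linear:
  assumes "bounded_clinear A"
  shows "poly_op [:-z, 1:] A \<psi> = A \<psi> - z *\<^sub>C \<psi>"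
  using assms by (simp add: poly_op_pCons bounded_clinear_simps scaleC_minus_left)

lemma poly_op_add: "poly_op (p + q) A \<psi> = poly_op p A \<psi> + poly_op q A \<psi>"
proof -
  let ?n = "max (degree p) (degree q)"
  have "poly_op (p + q) A \<psi> = (\<Sum>i\<le>?n. coeff (p + q) i *\<^sub>C (A ^^ i) \<psi>)"
    by (rule poly_op_altdef) (simp add: degree_add_le_max)
  also have "\<dots> = (\<Sum>i\<le>?n. coeff p i *\<^sub>C (A ^^ i) \<psi>) + (\<Sum>i\<le>?n. coeff q i *\<^sub>C (A ^^ i) \<psi>)"
    by (simp add: scaleC_add_left sum.distrib)
  also have "\<dots> = poly_op p A \<psi> + poly_op q A \<psi>"
    by (simp add: poly_op_altdef[of p ?n] poly_op_altdef[of q ?n])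
  finally show ?thesis .
qed

lemma poly_op_smult:
  assumes "bounded_clinear A"
  shows "poly_op (smult c p) A \<psi> = c *\<^sub>C poly_op p A \<psi>"
  by (induction p) (simp_all add: poly_op_pCons assms bounded_clinear_simps scaleC_add_right)

lemma poly_op_diff: "poly_op (p - q) A \<psi> = poly_op p A \<psi> - poly_op q A \<psi>"
  using poly_op_add[of "p - q" q] by simp

lemma poly_op_mult:
  assumes "bounded_clinear A"
  shows "poly_op (p * q) A \<psi> = poly_op p A (poly_op q A \<psi>)"
  by (induction p) (simp_all add: poly_op_pCons assms poly_op_add poly_op_smult)

lemma poly_op_commute:
  assumes "bounded_clinear A"
  shows "poly_op p A (A \<psi>) = A (poly_op p A \<psi>)"
  by (induction p) (simp_all add: poly_op_pCons assms bounded_clinear_simps)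

text \<open>Splitting \<open>p\<close> into linear factors, one of the factors \<open>A - z\<close> is not invertible.\<close>

lemma root_in_spectrum:
  assumes A: "bounded_clinear A" and "p \<noteq> 0" "\<not> cinvertible (poly_op p A)"
  shows "\<exists>z\<in>spectrum A. poly p z = 0"
  using assms(2,3)
proof (induction "degree p" arbitrary: p rule: less_induct)
  case less
  show ?case
  proof (cases "degree p = 0")
    case True
    then obtain c where p: "p = [:c:]" by (rule degree_eq_zeroE)
    have "cinvertible (poly_op p A)"
      unfolding cinvertible_def using \<open>p \<noteq> 0\<close>
      by (intro exI[of _ "\<lambda>\<psi>. inverse c *\<^sub>C \<psi>"])
        (simp add: p poly_op_const bounded_clinear_const_scale)
    with less.prems show ?thesis by simp
  next
    case False
    then have "\<not> constant (poly p)" by (simp add: constant_degree)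
    then obtain z where z: "poly p z = 0"
      using fundamental_theorem_of_algebra by blast
    then obtain q where q: "p = [:-z, 1:] * q"
      by (auto simp: poly_eq_0_iff_dvd elim: dvdE)
    have "q \<noteq> 0" using less.prems q by auto
    have "degree q < degree p"
      unfolding q using \<open>q \<noteq> 0\<close> by (subst degree_mult_eq) auto
    show ?thesis
    proof (cases "z \<in> spectrum A")
      case False
      then have "cinvertible (\<lambda>\<psi>. A \<psi> - z *\<^sub>C \<psi>)" by (simp add: spectrum_iff A)
      moreover have "poly_op p A = (\<lambda>\<psi>. poly_op q A \<psi>) \<circ> (\<lambda>\<psi>. A \<psi> - z *\<^sub>C \<psi>)"
        unfolding q mult.commute[of "[:-z, 1:]"]
        by (rule ext) (simp only: poly_op_mult[OF A] poly_op_linear[OF A] o_def)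
      ultimately have "\<not> cinvertible (poly_op q A)"
        using less.prems(2) cinvertible_compose[of "poly_op q A"] by (auto simp: o_def)
      then show ?thesis
        using less.hyps[OF \<open>degree q < degree p\<close> \<open>q \<noteq> 0\<close>] by (auto simp: q)
    qed (use z in blast)
  qed
qed

subsection \<open>Functional calculus of bounded self-adjoint operators\<close>

text \<open>The real part of the inner product suffices, by complex linearity.\<close>

definition self_adjoint :: "(ell2 \<Rightarrow> ell2) \<Rightarrow> bool" where
  "self_adjoint A \<longleftrightarrow> bounded_clinear A \<and> (\<forall>\<phi> \<psi>. inner (A \<phi>) \<psi> = inner \<phi> (A \<psi>))"

lemma self_adjoint_bounded: "self_adjoint A \<Longrightarrow> bounded_clinear A"
  by (simp add: self_adjoint_def)

text \<open>The adjoint of \<open>p(A)\<close> is again a polynomial of \<open>A\<close>, hence so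
  is the product of \<open>p(A)\<close> with its adjoint; \<open>norm_poly_op_le\<close> rests on
  this.\<close>

lemma inner_poly_op:
  assumes "self_adjoint A"
  shows "inner (poly_op p A \<phi>) \<psi> = inner \<phi> (poly_op (map_poly cnj p) A \<psi>)"
proof (induction p arbitrary: \<phi> \<psi>)
  case (pCons a p)
  have A: "bounded_clinear A" using assms by (rule self_adjoint_bounded)
  have "inner (poly_op (pCons a p) A \<phi>) \<psi>
      = inner \<phi> (cnj a *\<^sub>C \<psi>) + inner \<phi> (poly_op (map_poly cnj p) A (A \<psi>))"
    using assms pCons.IH[of \<phi> "A \<psi>"]
    by (simp add: poly_op_pCons[OF A] inner_add_left inner_scaleC_left self_adjoint_def)
  then show ?case
    by (simp add: map_poly_pCons poly_op_pCons[OF A] poly_op_commute[OF A] inner_add_right)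
qed simp

text \<open>Insert \<open>N' \<psi>\<close> into the bound for \<open>N\<close>: the square of
  \<open>norm (N' \<psi>)\<close> is \<open>inner (N (N' \<psi>)) \<psi>\<close>, and one factor
  cancels.\<close>

lemma adjoint_norm_le:
  fixes N N' :: "ell2 \<Rightarrow> ell2"
  assumes adj: "\<And>\<phi> \<psi>. inner (N \<phi>) \<psi> = inner \<phi> (N' \<psi>)"
    and N: "\<And>\<psi>. norm (N \<psi>) \<le> m * norm \<psi>"
  shows "norm (N' \<psi>) \<le> m * norm \<psi>"
proof (cases "norm (N' \<psi>) = 0")
  case False
  have "norm (N' \<psi>) * norm (N' \<psi>) = inner (N (N' \<psi>)) \<psi>"
    by (simp add: adj power2_norm_eq_inner[symmetric] power2_eq_square)
  also have "\<dots> \<le> norm (N (N' \<psi>)) * norm \<psi>" by (rule norm_cauchy_schwarz)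
  also have "\<dots> \<le> m * norm (N' \<psi>) * norm \<psi>" by (intro mult_right_mono N) simp
  finally show ?thesis using False by (simp add: algebra_simps)
next
  case True
  have "0 \<le> m * norm \<psi>"
    using N[of \<psi>] norm_ge_zero[of "N \<psi>"] by linarith
  with True show ?thesis by simp
qed

text \<open>Approximate maximizers of \<open>norm (N \<psi>)\<close> are approximate eigenvectors of \<open>N' N\<close>.\<close>

lemma not_cinvertible_onorm:
  assumes N: "bounded_clinear N" and adj: "\<And>\<phi> \<psi>. inner (N \<phi>) \<psi> = inner \<phi> (N' \<psi>)"
  shows "\<not> cinvertible (\<lambda>\<psi>. N' (N \<psi>) - of_real ((onorm N)\<^sup>2) *\<^sub>C \<psi>)"
proof
  define m where "m = onorm N"
  define T where "T = (\<lambda>\<psi>. N' (N \<psi>) - of_real (m\<^sup>2) *\<^sub>C \<psi>)"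
  have Nm: "norm (N \<psi>) \<le> m * norm \<psi>" for \<psi>
    using onorm[OF bounded_clinear_linear[OF N]] by (simp add: m_def)
  have "0 \<le> m" unfolding m_def by (rule onorm_pos_le[OF bounded_clinear_linear[OF N]])
  assume "cinvertible (\<lambda>\<psi>. N' (N \<psi>) - of_real ((onorm N)\<^sup>2) *\<^sub>C \<psi>)"
  then have "cinvertible T" by (simp add: T_def m_def)
  then obtain R where R: "bounded_clinear R" "\<And>\<psi>. R (T \<psi>) = \<psi>"
    by (auto simp: cinvertible_def)
  obtain K where K: "0 < K" "\<And>\<psi>. norm (R \<psi>) \<le> K * norm \<psi>"
    using bounded_clinear_bound[OF R(1)] by blast
  \<comment> \<open>In the expanded square the cross term is \<open>-2 m\<^sup>2\<close> times the
    squared norm of \<open>N \<psi>\<close>, and the leading term is at most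
    \<open>m\<^sup>2\<close> times it. So \<open>T \<psi>\<close> is small where \<open>N\<close>
    almost attains its norm.\<close>
  have T_le: "(norm (T \<psi>))\<^sup>2 \<le> m\<^sup>2 * (m\<^sup>2 * (norm \<psi>)\<^sup>2 - (norm (N \<psi>))\<^sup>2)" for \<psi>
  proof -
    have NN: "inner (N' (N \<psi>)) \<psi> = (norm (N \<psi>))\<^sup>2"
      by (metis adj inner_commute power2_norm_eq_inner)
    have "(norm (T \<psi>))\<^sup>2
        = (norm (N' (N \<psi>)))\<^sup>2 - 2 * m\<^sup>2 * (norm (N \<psi>))\<^sup>2 + m\<^sup>2 * m\<^sup>2 * (norm \<psi>)\<^sup>2"
      unfolding T_def scaleC_of_real norm_diff_scaleR_squared NN
      by (simp add: power2_eq_square)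
    also have "(norm (N' (N \<psi>)))\<^sup>2 \<le> (m * norm (N \<psi>))\<^sup>2"
      by (intro power_mono adjoint_norm_le[OF adj Nm]) simp
    finally show ?thesis by (simp add: algebra_simps power_mult_distrib)
  qed
  have low: "(norm \<psi>)\<^sup>2 \<le> K\<^sup>2 * (m\<^sup>2 * (m\<^sup>2 * (norm \<psi>)\<^sup>2 - (norm (N \<psi>))\<^sup>2))" for \<psi>
  proof -
    have "(norm \<psi>)\<^sup>2 \<le> (K * norm (T \<psi>))\<^sup>2"
      using K(2)[of "T \<psi>"] by (intro power_mono) (auto simp: R(2))
    also have "\<dots> \<le> K\<^sup>2 * (m\<^sup>2 * (m\<^sup>2 * (norm \<psi>)\<^sup>2 - (norm (N \<psi>))\<^sup>2))"
      unfolding power_mult_distrib by (intro mult_left_mono T_le) simp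
    finally show ?thesis .
  qed
  have delta: "norm (\<delta> 0) \<noteq> 0"
    using norm_coord_le[of "\<delta> 0" 0] by (auto simp: coord_delta)
  have "m \<noteq> 0" using low[of "\<delta> 0"] delta by auto
  with \<open>0 \<le> m\<close> have "0 < m" by simp
  \<comment> \<open>A bounded left inverse of \<open>T\<close> turns \<open>T_le\<close> into the
    bound \<open>sqrt s\<close> for \<open>N\<close>, with \<open>s\<close> strictly below
    \<open>m\<^sup>2\<close>, against the definition of the operator norm.\<close>
  define s where "s = m\<^sup>2 - 1 / (K\<^sup>2 * m\<^sup>2)"
  have Ns: "(norm (N \<psi>))\<^sup>2 \<le> s * (norm \<psi>)\<^sup>2" for \<psi>
    using low[of \<psi>] \<open>0 < m\<close> \<open>0 < K\<close> by (simp add: s_def field_simps)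
  have "0 \<le> s * (norm (\<delta> 0))\<^sup>2"
    using Ns[of "\<delta> 0"] zero_le_power2[of "norm (N (\<delta> 0))"] by linarith
  then have "0 \<le> s" using delta by (simp add: zero_le_mult_iff)
  have "norm (N \<psi>) \<le> sqrt s * norm \<psi>" for \<psi>
    using real_sqrt_le_mono[OF Ns[of \<psi>]] by (simp add: real_sqrt_mult)
  then have "m \<le> sqrt s" unfolding m_def by (rule onorm_bound[rotated]) (simp add: \<open>0 \<le> s\<close>)
  then have "m\<^sup>2 \<le> s" using \<open>0 \<le> s\<close> \<open>0 \<le> m\<close> by (metis power_mono real_sqrt_pow2)
  moreover have "0 < 1 / (K\<^sup>2 * m\<^sup>2)" using \<open>0 < m\<close> \<open>0 < K\<close> by simp
  ultimately show False unfolding s_def by linarith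
qed

text \<open>With \<open>m\<close> the norm of \<open>A\<close>, \<open>not_cinvertible_onorm\<close>
  for \<open>N = N' = A\<close> says that the nonzero polynomial
  \<open>x\<^sup>2 - m\<^sup>2\<close> is not invertible at \<open>A\<close>, so it has a root in
  the spectrum.\<close>

lemma spectrum_nonempty:
  assumes "self_adjoint A"
  shows "spectrum A \<noteq> {}"
proof -
  have A: "bounded_clinear A" using assms by (rule self_adjoint_bounded)
  define p where "p = [:- of_real ((onorm A)\<^sup>2), 0, 1 :: complex:]"
  have "poly_op p A = (\<lambda>\<psi>. A (A \<psi>) - of_real ((onorm A)\<^sup>2) *\<^sub>C \<psi>)"
    by (rule ext) (simp add: p_def poly_op_pCons[OF A] bounded_clinear_simps[OF A]
        scaleC_minus_left)
  then have "\<not> cinvertible (poly_op p A)"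
    using not_cinvertible_onorm[OF A, of A] assms by (simp add: self_adjoint_def)
  moreover have "p \<noteq> 0" by (simp add: p_def)
  ultimately show ?thesis using root_in_spectrum[OF A] by blast
qed

text \<open>For \<open>z = x + i y\<close>, the product of \<open>A - z\<close> and its adjoint is
  \<open>(A - x)\<^sup>2 + y\<^sup>2\<close>, which is coercive if \<open>y\<close> is
  nonzero.\<close>

lemma spectrum_real:
  assumes sa: "self_adjoint A" and "z \<in> spectrum A"
  shows "Im z = 0"
proof (rule ccontr)
  assume b: "Im z \<noteq> 0"
  have A: "bounded_clinear A" using sa by (rule self_adjoint_bounded)
  define Z where "Z = (\<lambda>\<psi>. A \<psi> - z *\<^sub>C \<psi>)"
  define W where "W = (\<lambda>\<psi>. A \<psi> - cnj z *\<^sub>C \<psi>)"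
  define S where "S = (\<lambda>\<psi>. A \<psi> - Re z *\<^sub>R \<psi>)"
  have ZW: "bounded_clinear Z" "bounded_clinear W"
    by (auto simp: Z_def W_def intro!: bounded_clinear_intros A)
  have comm: "Z (W \<psi>) = W (Z \<psi>)" for \<psi>
    by (rule ell2_eqI) (simp add: Z_def W_def bounded_clinear_simps[OF A] algebra_simps)
  have z2: "z * cnj z = of_real ((Re z)\<^sup>2 + (Im z)\<^sup>2)" "z + cnj z = of_real (2 * Re z)"
    by (simp_all add: complex_mult_cnj complex_add_cnj)
  have W_Z: "W (Z \<psi>) = S (S \<psi>) + (Im z)\<^sup>2 *\<^sub>R \<psi>" for \<psi>
  proof -
    have "W (Z \<psi>) = A (A \<psi>) - (z + cnj z) *\<^sub>C A \<psi> + (z * cnj z) *\<^sub>C \<psi>"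
      by (rule ell2_eqI) (simp add: Z_def W_def bounded_clinear_simps[OF A] algebra_simps)
    also have "\<dots> = S (S \<psi>) + (Im z)\<^sup>2 *\<^sub>R \<psi>"
      unfolding z2 scaleC_of_real
      by (simp add: S_def bounded_clinear_simps[OF A] algebra_simps power2_eq_square
          scaleR_2[symmetric] del: scaleR_2)
    finally show ?thesis .
  qed
  have S: "inner (S \<phi>) \<psi> = inner \<phi> (S \<psi>)" for \<phi> \<psi>
    using sa by (simp add: S_def self_adjoint_def inner_diff_left inner_diff_right)
  have coercive: "(Im z)\<^sup>2 * (norm \<psi>)\<^sup>2 \<le> inner (W (Z \<psi>)) \<psi>" for \<psi>
    by (simp add: W_Z inner_add_left S[of "S \<psi>" \<psi>] flip: power2_norm_eq_inner)
  have c: "0 < (Im z)\<^sup>2" using b by simp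
  \<comment> \<open>The factors commute, so surjectivity of the product passes to \<open>Z\<close>;
    boundedness of \<open>W\<close> turns coercivity into the lower bound for
    \<open>Z\<close>.\<close>
  have surjWZ: "surj (\<lambda>\<psi>. W (Z \<psi>))"
    by (rule coercive_surj[OF bounded_clinear_compose[OF ZW(2,1)] c coercive])
  have "surj Z"
  proof (unfold surj_def, rule allI)
    fix \<phi>
    from surjD[OF surjWZ, of \<phi>] show "\<exists>\<psi>. \<phi> = Z \<psi>" by (metis comm)
  qed
  obtain K where K: "0 < K" "\<And>\<psi>. norm (W \<psi>) \<le> K * norm \<psi>"
    using bounded_clinear_bound[OF ZW(2)] by blast
  have "cinvertible Z"
  proof (rule cinvertibleI_bounded_below[OF ZW(1) \<open>surj Z\<close>])
    fix \<psi>
    have "(Im z)\<^sup>2 * (norm \<psi>)\<^sup>2 \<le> norm (W (Z \<psi>)) * norm \<psi>"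
      using coercive norm_cauchy_schwarz by (rule order_trans)
    also have "\<dots> \<le> K * norm (Z \<psi>) * norm \<psi>" by (intro mult_right_mono K) simp
    finally have "norm \<psi> * ((Im z)\<^sup>2 * norm \<psi>) \<le> norm \<psi> * (K * norm (Z \<psi>))"
      by (simp add: power2_eq_square algebra_simps)
    then have "(Im z)\<^sup>2 * norm \<psi> \<le> K * norm (Z \<psi>)"
      using K(1) by (cases "norm \<psi> = 0") auto
    then show "norm \<psi> \<le> norm (Z \<psi>) * (K / (Im z)\<^sup>2)"
      using c by (simp add: field_simps)
  qed
  then show False using \<open>z \<in> spectrum A\<close> by (simp add: spectrum_iff[OF A] Z_def)
qed

text \<open>For real \<open>x\<close> with \<open>|x| > M\<close> the operator \<open>A - x\<close>
  is definite: its multiple by \<open>- sgn x\<close> is coercive with constant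
  \<open>|x| - M\<close>.\<close>

lemma spectrum_bounded:
  assumes sa: "self_adjoint A" and M: "\<And>\<psi>. norm (A \<psi>) \<le> M * norm \<psi>"
    and x: "complex_of_real x \<in> spectrum A"
  shows "\<bar>x\<bar> \<le> M"
proof (rule ccontr)
  assume "\<not> \<bar>x\<bar> \<le> M"
  then have c: "0 < \<bar>x\<bar> - M" by simp
  have A: "bounded_clinear A" using sa by (rule self_adjoint_bounded)
  define Z where "Z = (\<lambda>\<psi>. A \<psi> - of_real x *\<^sub>C \<psi>)"
  have Z: "bounded_clinear Z" by (auto simp: Z_def intro!: bounded_clinear_intros A)
  define T where "T = (\<lambda>\<psi>. of_real (- sgn x) *\<^sub>C Z \<psi>)"
  have coercive: "(\<bar>x\<bar> - M) * (norm \<psi>)\<^sup>2 \<le> inner (T \<psi>) \<psi>" for \<psi>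
  proof -
    have "inner (T \<psi>) \<psi> = \<bar>x\<bar> * (norm \<psi>)\<^sup>2 - sgn x * inner (A \<psi>) \<psi>"
      by (simp add: T_def Z_def scaleC_of_real[of "- sgn x", simplified] scaleC_of_real
          inner_diff_left power2_norm_eq_inner algebra_simps abs_sgn scaleC_minus_left)
    moreover have "sgn x * inner (A \<psi>) \<psi> \<le> M * (norm \<psi>)\<^sup>2"
    proof -
      have "sgn x * inner (A \<psi>) \<psi> \<le> \<bar>sgn x * inner (A \<psi>) \<psi>\<bar>" by simp
      also have "\<dots> \<le> \<bar>inner (A \<psi>) \<psi>\<bar>" by (simp add: abs_mult sgn_real_def)
      also have "\<dots> \<le> norm (A \<psi>) * norm \<psi>" by (rule Cauchy_Schwarz_ineq2)
      also have "\<dots> \<le> M * norm \<psi> * norm \<psi>" by (intro mult_right_mono M) simp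
      finally show ?thesis by (simp add: power2_eq_square)
    qed
    ultimately show ?thesis by (simp add: algebra_simps)
  qed
  have "bounded_clinear T" unfolding T_def by (rule bounded_clinear_scale_compose[OF Z])
  then have "surj T" using c coercive by (rule coercive_surj)
  have "surj Z"
  proof (unfold surj_def, rule allI)
    fix \<phi>
    obtain \<psi> where "\<phi> = T \<psi>" using surjD[OF \<open>surj T\<close>, of \<phi>] by blast
    then show "\<exists>\<psi>. \<phi> = Z \<psi>"
      by (intro exI[of _ "of_real (- sgn x) *\<^sub>C \<psi>"]) (simp add: T_def bounded_clinear_scale[OF Z])
  qed
  have "cinvertible Z"
  proof (rule cinvertibleI_bounded_below[OF Z \<open>surj Z\<close>])
    fix \<psi>
    have "norm (of_real x *\<^sub>C \<psi>) \<le> norm (Z \<psi>) + norm (A \<psi>)"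
      unfolding Z_def using norm_triangle_ineq4[of "A \<psi>" "A \<psi> - of_real x *\<^sub>C \<psi>"]
      by (simp add: add.commute)
    then have "(\<bar>x\<bar> - M) * norm \<psi> \<le> norm (Z \<psi>)" using M[of \<psi>] by (simp add: algebra_simps)
    then show "norm \<psi> \<le> norm (Z \<psi>) * (1 / (\<bar>x\<bar> - M))" using c by (simp add: field_simps)
  qed
  then show False using x by (simp add: spectrum_iff[OF A] Z_def)
qed

text \<open>By \<open>not_cinvertible_onorm\<close>, in the role of the C*-identity, the polynomial
  \<open>q\<close>, equal to \<open>|p|\<^sup>2 - m\<^sup>2\<close> on the reals, is not invertible
  at \<open>A\<close>. A root of \<open>q\<close> in the spectrum is a real point where
  \<open>|p|\<close> equals the operator norm \<open>m\<close>.\<close>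

lemma norm_poly_op_le:
  assumes sa: "self_adjoint A"
    and p: "\<And>x. complex_of_real x \<in> spectrum A \<Longrightarrow> cmod (poly p (of_real x)) \<le> \<epsilon>"
  shows "norm (poly_op p A \<psi>) \<le> \<epsilon> * norm \<psi>"
proof -
  have A: "bounded_clinear A" using sa by (rule self_adjoint_bounded)
  note N = bounded_clinear_poly_op[OF A, of p]
  define m where "m = onorm (poly_op p A)"
  define q where "q = map_poly cnj p * p - [:of_real (m\<^sup>2):]"
  have "poly_op q A = (\<lambda>\<psi>. poly_op (map_poly cnj p) A (poly_op p A \<psi>) - of_real (m\<^sup>2) *\<^sub>C \<psi>)"
    by (rule ext) (simp add: q_def poly_op_diff poly_op_mult[OF A] poly_op_const)
  then have "\<not> cinvertible (poly_op q A)"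
    using not_cinvertible_onorm[OF N inner_poly_op[OF sa]] by (simp add: m_def)
  \<comment> \<open>If \<open>q\<close> is zero, as for constant \<open>p\<close>, every spectral
    point is a root, so the spectrum must be known to have a point.\<close>
  then have "\<exists>z\<in>spectrum A. poly q z = 0"
    using root_in_spectrum[OF A, of q] spectrum_nonempty[OF sa] by (cases "q = 0") auto
  then obtain z where z: "z \<in> spectrum A" "poly q z = 0" by blast
  define x where "x = Re z"
  have zx: "z = of_real x" using spectrum_real[OF sa z(1)] by (simp add: x_def complex_eq_iff)
  have cnj_z: "cnj z = z" by (subst (1 2) zx) simp
  have "poly (map_poly cnj p) z = cnj (poly p z)"
    using cnj_z by (induction p) (simp_all add: map_poly_pCons)
  then have "of_real ((cmod (poly p z))\<^sup>2) = (of_real (m\<^sup>2) :: complex)"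
    using z(2) unfolding complex_norm_square by (simp add: q_def mult.commute)
  then have "(cmod (poly p z))\<^sup>2 = m\<^sup>2" using of_real_eq_iff by blast
  then have "m \<le> cmod (poly p z)" by (metis norm_ge_zero order_refl power2_le_imp_le)
  then have "m \<le> \<epsilon>" using p[of x] z(1) unfolding zx[symmetric] by simp
  have "norm (poly_op p A \<psi>) \<le> m * norm \<psi>"
    unfolding m_def by (rule onorm[OF bounded_clinear_linear[OF N]])
  also have "\<dots> \<le> \<epsilon> * norm \<psi>" using \<open>m \<le> \<epsilon>\<close> by (intro mult_right_mono) auto
  finally show ?thesis .
qed

text \<open>Real and imaginary parts are approximated separately, each within
  \<open>e / 2\<close>.\<close>

lemma Weierstrass_complex_poly:
  fixes g :: "real \<Rightarrow> complex"
  assumes "continuous_on {a..b} g" "0 < e"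
  obtains p :: "complex poly" where "\<And>x. x \<in> {a..b} \<Longrightarrow> cmod (poly p (of_real x) - g x) < e"
proof -
  have real: "\<exists>p :: complex poly. \<forall>x\<in>{a..b}. cmod (poly p (of_real x) - of_real (f x)) < e / 2"
    if f: "continuous_on {a..b} f" for f :: "real \<Rightarrow> real"
  proof -
    obtain h where h: "real_polynomial_function h" "\<And>x. x \<in> {a..b} \<Longrightarrow> \<bar>f x - h x\<bar> < e / 2"
      using half_gt_zero[OF assms(2)]
      by (rule Stone_Weierstrass_real_polynomial_function[OF compact_Icc f]) blast
    then obtain c n where c: "h = (\<lambda>x. \<Sum>i\<le>n. c i * x ^ i)"
      by (auto simp: real_polynomial_function_iff_sum)
    define p where "p = (\<Sum>i\<le>n. monom (complex_of_real (c i)) i)"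
    have "poly p (of_real x) = of_real (h x)" for x
      by (simp add: p_def c poly_sum poly_monom)
    then have "cmod (poly p (of_real x) - of_real (f x)) = \<bar>f x - h x\<bar>" for x
      by (simp add: of_real_diff[symmetric] abs_minus_commute del: of_real_diff)
    then show ?thesis using h(2) by (intro exI[of _ p]) simp
  qed
  have "continuous_on {a..b} (\<lambda>x. Re (g x))" "continuous_on {a..b} (\<lambda>x. Im (g x))"
    by (intro continuous_intros assms)+
  with real obtain p q :: "complex poly" where
    p: "\<forall>x\<in>{a..b}. cmod (poly p (of_real x) - of_real (Re (g x))) < e / 2" and
    q: "\<forall>x\<in>{a..b}. cmod (poly q (of_real x) - of_real (Im (g x))) < e / 2"
    by meson
  show thesis
  proof
    fix x assume "x \<in> {a..b}"
    have "poly (p + smult \<i> q) (of_real x) - g x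
        = (poly p (of_real x) - of_real (Re (g x)))
          + \<i> * (poly q (of_real x) - of_real (Im (g x)))"
      by (subst (1) complex_eq[of "g x"]) (simp add: algebra_simps)
    also have "cmod \<dots> \<le> cmod (poly p (of_real x) - of_real (Re (g x)))
        + cmod (\<i> * (poly q (of_real x) - of_real (Im (g x))))"
      by (rule norm_triangle_ineq)
    also have "\<dots> < e"
      using p q \<open>x \<in> {a..b}\<close> by (fastforce simp: norm_mult)
    finally show "cmod (poly (p + smult \<i> q) (of_real x) - g x) < e" .
  qed
qed

text \<open>The definite description \<open>cfc\<close> is resolved here. By
  \<open>norm_poly_op_le\<close> the vectors \<open>P k (A) \<psi>\<close> are Cauchy for a
  Weierstrass sequence \<open>P\<close>; the limit operator \<open>B\<close> satisfies the estimate
  for every \<open>p\<close>, hence the defining property, and no other operator has that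
  property.\<close>

lemma cfc_approx_spectrum:
  assumes sa: "self_adjoint A" and M: "\<And>\<psi>. norm (A \<psi>) \<le> M * norm \<psi>"
    and g: "continuous_on {-M..M} g"
    and p: "\<And>x. complex_of_real x \<in> spectrum A \<Longrightarrow> cmod (poly p (of_real x) - g x) \<le> \<epsilon>"
  shows "norm (poly_op p A \<psi> - cfc g A \<psi>) \<le> \<epsilon> * norm \<psi>"
proof -
  have A: "bounded_clinear A" using sa by (rule self_adjoint_bounded)
  define S where "S = {x. complex_of_real x \<in> spectrum A}"
  have SM: "S \<subseteq> {-M..M}"
    using spectrum_bounded[OF sa M] by (force simp: S_def abs_le_iff)
  have "\<exists>p :: complex poly. \<forall>x\<in>S. cmod (poly p (of_real x) - g x) \<le> 1 / real (Suc k)" for k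
    using Weierstrass_complex_poly[OF g, of "1 / real (Suc k)"] SM
    by (metis less_imp_le of_nat_0_less_iff subsetD zero_less_Suc zero_less_divide_1_iff)
  then obtain P :: "nat \<Rightarrow> complex poly" where
    P: "\<And>k x. x \<in> S \<Longrightarrow> cmod (poly (P k) (of_real x) - g x) \<le> 1 / real (Suc k)"
    by metis
  have diff: "norm (poly_op p A \<psi> - poly_op q A \<psi>) \<le> (\<epsilon> + \<eta>) * norm \<psi>"
    if "\<And>x. x \<in> S \<Longrightarrow> cmod (poly p (of_real x) - g x) \<le> \<epsilon>"
      "\<And>x. x \<in> S \<Longrightarrow> cmod (poly q (of_real x) - g x) \<le> \<eta>" for p q \<epsilon> \<eta> \<psi>
  proof -
    have "cmod (poly (p - q) (of_real x)) \<le> \<epsilon> + \<eta>" if "complex_of_real x \<in> spectrum A" for x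
      using norm_triangle_ineq4[of "poly p (of_real x) - g x" "poly q (of_real x) - g x"]
        that \<open>\<And>x. x \<in> S \<Longrightarrow> cmod (poly p (of_real x) - g x) \<le> \<epsilon>\<close>[of x]
        \<open>\<And>x. x \<in> S \<Longrightarrow> cmod (poly q (of_real x) - g x) \<le> \<eta>\<close>[of x]
      by (simp add: S_def)
    then show ?thesis
      using norm_poly_op_le[OF sa, of "p - q" "\<epsilon> + \<eta>"] by (simp add: poly_op_diff)
  qed
  have inv0: "(\<lambda>k. 1 / real (Suc k)) \<longlonglongrightarrow> 0"
    using LIMSEQ_inverse_real_of_nat by (simp add: inverse_eq_divide)
  have "Cauchy (\<lambda>k. poly_op (P k) A \<psi>)" for \<psi>
  proof (rule metric_CauchyI)
    fix e :: real assume "0 < e"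
    \<comment> \<open>Strictly above \<open>norm \<psi>\<close>, so that division by
      \<open>K\<close> is safe also for \<open>\<psi> = 0\<close>.\<close>
    define K where "K = norm \<psi> + 1"
    have K: "norm \<psi> < K" "0 < K" by (simp_all add: K_def add_nonneg_pos)
    define d where "d = e / 2 / K"
    have "0 < d" using \<open>0 < e\<close> K by (simp add: d_def)
    then have "\<forall>\<^sub>F k in sequentially. 1 / real (Suc k) < d"
      by (rule order_tendstoD(2)[OF inv0])
    then obtain N where N: "\<And>k. k \<ge> N \<Longrightarrow> 1 / real (Suc k) < d"
      by (auto simp: eventually_sequentially)
    have "dist (poly_op (P i) A \<psi>) (poly_op (P j) A \<psi>) < e" if "i \<ge> N" "j \<ge> N" for i j
    proof -
      have "dist (poly_op (P i) A \<psi>) (poly_op (P j) A \<psi>)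
          \<le> (1 / real (Suc i) + 1 / real (Suc j)) * norm \<psi>"
        unfolding dist_norm by (rule diff) (use P in auto)
      also have "\<dots> \<le> (d + d) * norm \<psi>"
        using N that by (intro mult_right_mono add_mono) (auto intro: less_imp_le)
      also have "\<dots> < (d + d) * K" using \<open>0 < d\<close> K by simp
      also have "\<dots> = e" using K by (simp add: d_def)
      finally show ?thesis .
    qed
    then show "\<exists>N. \<forall>i\<ge>N. \<forall>j\<ge>N. dist (poly_op (P i) A \<psi>) (poly_op (P j) A \<psi>) < e" by blast
  qed
  then have "\<exists>l. (\<lambda>k. poly_op (P k) A \<psi>) \<longlonglongrightarrow> l" for \<psi>
    by (simp add: Cauchy_convergent convergentD)
  then obtain B where B: "\<And>\<psi>. (\<lambda>k. poly_op (P k) A \<psi>) \<longlonglongrightarrow> B \<psi>" by metis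
  have approx: "norm (poly_op p A \<psi> - B \<psi>) \<le> \<epsilon> * norm \<psi>"
    if "\<And>x. x \<in> S \<Longrightarrow> cmod (poly p (of_real x) - g x) \<le> \<epsilon>" for p \<epsilon> \<psi>
  proof (rule tendsto_le)
    show "(\<lambda>k. norm (poly_op p A \<psi> - poly_op (P k) A \<psi>)) \<longlonglongrightarrow> norm (poly_op p A \<psi> - B \<psi>)"
      by (intro tendsto_intros B)
    show "(\<lambda>k. (\<epsilon> + 1 / real (Suc k)) * norm \<psi>) \<longlonglongrightarrow> \<epsilon> * norm \<psi>"
      using tendsto_mult[OF tendsto_add[OF tendsto_const inv0] tendsto_const] by simp
    show "\<forall>\<^sub>F k in sequentially.
        norm (poly_op p A \<psi> - poly_op (P k) A \<psi>) \<le> (\<epsilon> + 1 / real (Suc k)) * norm \<psi>"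
      by (rule always_eventually, rule allI, rule diff) (use that P in auto)
  qed simp
  note poly_P = bounded_clinear_poly_op[OF A]
  have Blin: "bounded_clinear B"
  proof (rule bounded_clinearI)
    fix \<phi> \<psi>
    have "(\<lambda>k. poly_op (P k) A (\<phi> + \<psi>)) \<longlonglongrightarrow> B \<phi> + B \<psi>"
      unfolding bounded_clinear_simps[OF poly_P] by (intro tendsto_intros B)
    then show "B (\<phi> + \<psi>) = B \<phi> + B \<psi>" using B LIMSEQ_unique by blast
  next
    fix c \<psi>
    have "(\<lambda>k. poly_op (P k) A (c *\<^sub>C \<psi>)) \<longlonglongrightarrow> c *\<^sub>C B \<psi>"
      unfolding bounded_clinear_simps[OF poly_P]
      by (intro bounded_linear.tendsto[OF bounded_clinear_linear[OF bounded_clinear_const_scale]] B)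
    then show "B (c *\<^sub>C \<psi>) = c *\<^sub>C B \<psi>" using B LIMSEQ_unique by blast
  next
    fix \<psi>
    have "norm (B \<psi>) \<le> norm (poly_op (P 0) A \<psi>) + norm (poly_op (P 0) A \<psi> - B \<psi>)"
      using norm_triangle_sub[of "B \<psi>" "poly_op (P 0) A \<psi>"] by (simp add: norm_minus_commute)
    also have "\<dots> \<le> onorm (poly_op (P 0) A) * norm \<psi> + 1 * norm \<psi>"
      by (intro add_mono onorm[OF bounded_clinear_linear[OF poly_P]] approx)
        (use P[of _ 0] in auto)
    finally show "norm (B \<psi>) \<le> norm \<psi> * (onorm (poly_op (P 0) A) + 1)"
      by (simp add: algebra_simps)
  qed
  let ?char = "\<lambda>B. bounded_clinear B \<and>
     (\<forall>p :: nat \<Rightarrow> complex poly.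
        uniform_limit S (\<lambda>k x. poly (p k) (complex_of_real x)) g sequentially \<longrightarrow>
        (\<lambda>k. onorm (\<lambda>\<psi>. poly_op (p k) A \<psi> - B \<psi>)) \<longlonglongrightarrow> 0)"
  have diff_lin: "bounded_linear (\<lambda>\<psi>. poly_op p A \<psi> - B' \<psi>)" if "bounded_clinear B'" for p B'
    by (intro bounded_clinear_linear bounded_clinear_intros poly_P that)
  have "cfc g A = B"
    unfolding cfc_def S_def[symmetric]
  proof (rule the_equality)
    show "?char B"
    proof (intro conjI Blin allI impI)
      fix p :: "nat \<Rightarrow> complex poly"
      assume p: "uniform_limit S (\<lambda>k x. poly (p k) (complex_of_real x)) g sequentially"
      show "(\<lambda>k. onorm (\<lambda>\<psi>. poly_op (p k) A \<psi> - B \<psi>)) \<longlonglongrightarrow> 0"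
      proof (rule tendstoI)
        fix e :: real assume "0 < e"
        then have "\<forall>\<^sub>F k in sequentially. \<forall>x\<in>S. dist (poly (p k) (complex_of_real x)) (g x) < e / 2"
          using p half_gt_zero[OF \<open>0 < e\<close>] unfolding uniform_limit_iff by blast
        then show "\<forall>\<^sub>F k in sequentially. dist (onorm (\<lambda>\<psi>. poly_op (p k) A \<psi> - B \<psi>)) 0 < e"
        proof eventually_elim
          case (elim k)
          have "onorm (\<lambda>\<psi>. poly_op (p k) A \<psi> - B \<psi>) \<le> e / 2"
            by (rule onorm_bound, use \<open>0 < e\<close> in simp, rule approx)
              (use elim in \<open>auto simp: dist_norm intro: less_imp_le\<close>)
          then show ?case
            using onorm_pos_le[OF diff_lin[OF Blin], of "p k"] \<open>0 < e\<close> by (simp add: dist_real_def)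
        qed
      qed
    qed
  next
    \<comment> \<open>Uniqueness: the sequence \<open>P\<close> is admissible in the property
      assumed of \<open>B'\<close>, so \<open>P k (A) \<psi>\<close> converges to
      \<open>B' \<psi>\<close> as well as to \<open>B \<psi>\<close>.\<close>
    fix B' assume B': "?char B'"
    have "uniform_limit S (\<lambda>k x. poly (P k) (complex_of_real x)) g sequentially"
      unfolding uniform_limit_iff
    proof (intro allI impI)
      fix e :: real assume "0 < e"
      then have "\<forall>\<^sub>F k in sequentially. 1 / real (Suc k) < e" by (rule order_tendstoD(2)[OF inv0])
      then show "\<forall>\<^sub>F k in sequentially. \<forall>x\<in>S. dist (poly (P k) (complex_of_real x)) (g x) < e"
      proof eventually_elim
        case (elim k)
        then show ?case using P[of _ k] unfolding dist_norm by (blast intro: le_less_trans)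
      qed
    qed
    then have lim: "(\<lambda>k. onorm (\<lambda>\<psi>. poly_op (P k) A \<psi> - B' \<psi>)) \<longlonglongrightarrow> 0" using B' by blast
    show "B' = B"
    proof
      fix \<psi>
      have "(\<lambda>k. poly_op (P k) A \<psi> - B' \<psi>) \<longlonglongrightarrow> 0"
      proof (rule Lim_null_comparison)
        show "\<forall>\<^sub>F k in sequentially. norm (poly_op (P k) A \<psi> - B' \<psi>)
            \<le> onorm (\<lambda>\<psi>. poly_op (P k) A \<psi> - B' \<psi>) * norm \<psi>"
          using B' by (intro always_eventually allI onorm diff_lin) blast
        show "(\<lambda>k. onorm (\<lambda>\<psi>. poly_op (P k) A \<psi> - B' \<psi>) * norm \<psi>) \<longlonglongrightarrow> 0"
          using tendsto_mult_right[OF lim, of "norm \<psi>"] by simp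
      qed
      then have "(\<lambda>k. poly_op (P k) A \<psi>) \<longlonglongrightarrow> B' \<psi>" by (simp add: LIM_zero_iff)
      then show "B' \<psi> = B \<psi>" using B LIMSEQ_unique by blast
    qed
  qed
  with approx p show ?thesis by (simp add: S_def)
qed

text \<open>Closeness is asked on all of \<open>[-M, M]\<close> instead of the spectrum, so that one
  polynomial fits every self-adjoint operator with norm bound \<open>M\<close>.\<close>

lemma cfc_approx:
  assumes "self_adjoint A" "\<And>\<psi>. norm (A \<psi>) \<le> M * norm \<psi>" "continuous_on {-M..M} g"
    and "\<And>x. x \<in> {-M..M} \<Longrightarrow> cmod (poly p (of_real x) - g x) \<le> \<epsilon>"
  shows "norm (poly_op p A \<psi> - cfc g A \<psi>) \<le> \<epsilon> * norm \<psi>"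
proof -
  have "x \<in> {-M..M}" if "complex_of_real x \<in> spectrum A" for x
    using spectrum_bounded[OF assms(1,2) that] by (auto simp: abs_le_iff)
  then show ?thesis using cfc_approx_spectrum[OF assms(1-3)] assms(4) by blast
qed

subsection \<open>Radon measures and positive functionals\<close>

lemma C\<^sub>c_D:
  assumes "g \<in> C\<^sub>c"
  shows "continuous_on UNIV g" and "\<exists>B. \<forall>x. cmod (g x) \<le> B"
proof -
  show cont: "continuous_on UNIV g" using assms by (simp add: C\<^sub>c_def)
  have "compact (g ` closure {x. g x \<noteq> 0})"
    using assms by (intro compact_continuous_image continuous_on_subset[OF cont]) (auto simp: C\<^sub>c_def)
  then obtain B where B: "0 < B" "\<And>x. x \<in> closure {x. g x \<noteq> 0} \<Longrightarrow> cmod (g x) \<le> B"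
    by (auto dest!: compact_imp_bounded simp: bounded_pos)
  have "cmod (g x) \<le> B" for x
    using B closure_subset[of "{x. g x \<noteq> 0}"] by (cases "g x = 0") auto
  then show "\<exists>B. \<forall>x. cmod (g x) \<le> B" by blast
qed

text \<open>Indicators of compact intervals are pointwise limits of dominated functions in
  \<open>C\<^sub>c\<close>, so the integrals determine the measures of these intervals, which form
  an intersection-stable generator of the Borel sets.\<close>

lemma radon_measure_eqI:
  assumes M: "radon_measure M" and N: "radon_measure N"
    and eq: "\<And>g. g \<in> C\<^sub>c \<Longrightarrow> integral\<^sup>L M g = integral\<^sup>L N g"
  shows "M = N"
proof -
  have finite: "emeasure M' {a..b} < \<infinity>" if "radon_measure M'" for M' a b
    using that by (auto simp: radon_measure_def)
  \<comment> \<open>A trapezoid: 1 on \<open>[a, b]\<close>, falling off with slope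
    \<open>n + 1\<close>. The slope is at least 1, so all supports lie in
    \<open>[a - 1, b + 1]\<close>, whose indicator is the integrable dominating function.\<close>
  define f :: "real \<Rightarrow> real \<Rightarrow> nat \<Rightarrow> real \<Rightarrow> real" where
    "f a b n x = max 0 (1 - real (Suc n) * max 0 (max (a - x) (x - b)))" for a b n x
  have f_cont: "continuous_on UNIV (f a b n)" for a b n
    unfolding f_def by (intro continuous_intros)
  have f_bound: "0 \<le> f a b n x" "f a b n x \<le> indicator {a-1..b+1} x" for a b n x
  proof -
    show "0 \<le> f a b n x" by (simp add: f_def)
    show "f a b n x \<le> indicator {a-1..b+1} x"
    proof (cases "x \<in> {a-1..b+1}")
      case False
      then have "1 < max 0 (max (a - x) (x - b))" by auto
      then have "1 * 1 \<le> real (Suc n) * max 0 (max (a - x) (x - b))"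
        by (intro mult_mono) auto
      with False show ?thesis by (simp add: f_def)
    qed (simp add: f_def)
  qed
  have f_Cc: "(\<lambda>x. of_real (f a b n x)) \<in> C\<^sub>c" for a b n
  proof -
    have "closure {x. complex_of_real (f a b n x) \<noteq> 0} \<subseteq> {a-1..b+1}"
    proof (rule closure_minimal)
      show "{x. complex_of_real (f a b n x) \<noteq> 0} \<subseteq> {a-1..b+1}"
      proof
        fix x assume "x \<in> {x. complex_of_real (f a b n x) \<noteq> 0}"
        then have "0 < f a b n x" using f_bound(1)[of a b n x] by simp
        then have "indicat_real {a-1..b+1} x \<noteq> 0" using f_bound(2)[of a b n x] by linarith
        then show "x \<in> {a-1..b+1}" by (simp add: indicator_eq_0_iff del: of_bool_eq_0_iff)
      qed
    qed simp
    then have "compact (closure {x. complex_of_real (f a b n x) \<noteq> 0})"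
      using compact_Int_closed[OF compact_Icc closed_closure] by (metis Int_absorb1)
    then show ?thesis
      by (auto simp: C\<^sub>c_def intro!: continuous_intros f_cont)
  qed
  have f_lim: "(\<lambda>n. f a b n x) \<longlonglongrightarrow> indicator {a..b} x" for a b x
  proof (cases "x \<in> {a..b}")
    case True
    then have "f a b n x = 1" for n by (simp add: f_def)
    with True show ?thesis by simp
  next
    case False
    then have pos: "0 < max 0 (max (a - x) (x - b))" by auto
    obtain n0 :: nat where n0: "1 / max 0 (max (a - x) (x - b)) < real n0"
      using reals_Archimedean2 by blast
    have "f a b n x = 0" if "n \<ge> n0" for n
    proof -
      have "1 < real n0 * max 0 (max (a - x) (x - b))"
        using n0 pos by (simp add: field_simps)
      also have "\<dots> \<le> real (Suc n) * max 0 (max (a - x) (x - b))"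
        using that pos by (intro mult_right_mono) auto
      finally show ?thesis by (simp add: f_def)
    qed
    with False show ?thesis by (auto intro!: tendsto_eventually eventually_sequentiallyI)
  qed
  have lim: "(\<lambda>n. integral\<^sup>L M' (\<lambda>x. complex_of_real (f a b n x)))
      \<longlonglongrightarrow> of_real (measure M' {a..b})" if M': "radon_measure M'" for M' a b
  proof -
    have sets: "sets M' = sets borel" using M' by (simp add: radon_measure_def)
    have "(\<lambda>n. integral\<^sup>L M' (\<lambda>x. complex_of_real (f a b n x)))
        \<longlonglongrightarrow> integral\<^sup>L M' (\<lambda>x. complex_of_real (indicator {a..b} x))"
    proof (rule integral_dominated_convergence[where w = "indicator {a-1..b+1}"])
      show "(\<lambda>x. complex_of_real (f a b n x)) \<in> borel_measurable M'" for n
        using borel_measurable_continuous_onI[OF f_cont[of a b n]] sets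
        by (simp cong: measurable_cong_sets)
      show "(\<lambda>x. complex_of_real (indicator {a..b} x)) \<in> borel_measurable M'"
        using sets by (simp cong: measurable_cong_sets)
      show "integrable M' (indicator {a-1..b+1} :: real \<Rightarrow> real)"
        using finite[OF M'] sets by (intro integrable_real_indicator) auto
      show "AE x in M'. (\<lambda>n. complex_of_real (f a b n x)) \<longlonglongrightarrow> of_real (indicator {a..b} x)"
        by (intro AE_I2 tendsto_of_real f_lim)
      show "AE x in M'. norm (complex_of_real (f a b n x)) \<le> indicator {a-1..b+1} x" for n
        using f_bound by (intro AE_I2) simp
    qed
    also have "integral\<^sup>L M' (\<lambda>x. complex_of_real (indicator {a..b} x)) = of_real (measure M' {a..b})"
      using sets sets_eq_imp_space_eq[OF sets] by (simp add: Int_absorb2)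
    finally show ?thesis .
  qed
  have Icc: "emeasure M {a..b} = emeasure N {a..b}" for a b
  proof -
    have "complex_of_real (measure M {a..b}) = of_real (measure N {a..b})"
      by (rule LIMSEQ_unique[OF lim[OF M, of a b, unfolded eq[OF f_Cc]] lim[OF N]])
    then show ?thesis
      using finite[OF M, of a b] finite[OF N, of a b]
      by (simp add: emeasure_eq_ennreal_measure less_top)
  qed
  let ?E = "range (\<lambda>(a, b). {a..b::real})"
  show ?thesis
  proof (rule measure_eqI_generator_eq[where E = ?E and \<Omega> = UNIV and A = "\<lambda>n. {- real n..real n}"])
    show "Int_stable ?E" by (auto simp: Int_stable_def)
    show "emeasure M X = emeasure N X" if "X \<in> ?E" for X using that Icc by auto
    have "sets borel = sigma_sets UNIV ?E"
      by (subst borel_eq_atLeastAtMost) simp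
    then show "sets M = sigma_sets UNIV ?E" "sets N = sigma_sets UNIV ?E"
      using M N by (simp_all add: radon_measure_def)
    show "(\<Union>n. {- real n..real n}) = UNIV"
    proof (rule UNIV_eq_I[symmetric])
      fix x :: real
      obtain n :: nat where "\<bar>x\<bar> < real n" using reals_Archimedean2 by blast
      then show "x \<in> (\<Union>n. {- real n..real n})" by (intro UN_I[of n]) auto
    qed
    show "emeasure M {- real n..real n} \<noteq> \<infinity>" for n using finite[OF M] by (simp add: less_top)
  qed auto
qed

text \<open>Turns the existence of a representing measure into the value of the definite
  description. Both \<open>empirical_dos\<close> and \<open>dos\<close> have this shape, with
  different \<open>J\<close>.\<close>

lemma the_radon_measure_integral:
  assumes "radon_measure N" "\<And>g. g \<in> C\<^sub>c \<Longrightarrow> integral\<^sup>L N g = J g" "g \<in> C\<^sub>c"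
  shows "integral\<^sup>L (THE M. radon_measure M \<and> (\<forall>g\<in>C\<^sub>c. integral\<^sup>L M g = J g)) g = J g"
proof -
  have "(THE M. radon_measure M \<and> (\<forall>g\<in>C\<^sub>c. integral\<^sup>L M g = J g)) = N"
    by (rule the_equality) (use assms in \<open>auto intro: radon_measure_eqI\<close>)
  then show ?thesis using assms by simp
qed

lemma real_distribution_radon:
  assumes "real_distribution N"
  shows "radon_measure N"
proof -
  interpret real_distribution N by fact
  show ?thesis
    unfolding radon_measure_def
  proof (intro conjI ballI allI impI)
    fix A :: "real set" assume "A \<in> sets borel"
    then show "emeasure N A = (SUP K\<in>{K. K \<subseteq> A \<and> compact K}. emeasure N K)"
      by (intro inner_regular) auto
  qed (auto simp: less_top[symmetric])
qed

section \<open>Representation of functionals by weak limits of Bernstein measures\<close>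

lemma Bernstein_le_1: "x \<in> {0..1} \<Longrightarrow> k \<le> n \<Longrightarrow> Bernstein n k x \<le> 1"
  using member_le_sum[of k "{..n}" "\<lambda>k. Bernstein n k x"]
  by (simp add: Bernstein_nonneg)

text \<open>
  A contractive unital functional is positive, hence its values on the Bernstein polynomials are
  the weights of probability measures, and a weak limit of these represents the functional.
\<close>

theorem contractive_functional_representation:
  fixes I :: "(real \<Rightarrow> complex) \<Rightarrow> complex"
  assumes "0 < M"
    and add: "\<And>f g. continuous_on UNIV f \<Longrightarrow> continuous_on UNIV g \<Longrightarrow> I (\<lambda>x. f x + g x) = I f + I g"
    and scale: "\<And>c f. continuous_on UNIV f \<Longrightarrow> I (\<lambda>x. c * f x) = c * I f"
    and one: "I (\<lambda>_. 1) = 1"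
    and contr: "\<And>f \<epsilon>. continuous_on UNIV f \<Longrightarrow> (\<And>x. x \<in> {-M..M} \<Longrightarrow> cmod (f x) \<le> \<epsilon>) \<Longrightarrow> cmod (I f) \<le> \<epsilon>"
  obtains N where "radon_measure N" "\<And>g. g \<in> C\<^sub>c \<Longrightarrow> integral\<^sup>L N g = I g"
proof -
  have sum: "I (\<lambda>x. \<Sum>k\<in>A. c k * f k x) = (\<Sum>k\<in>A. c k * I (f k))"
    if "finite A" "\<And>k. continuous_on UNIV (f k)" for A :: "nat set" and c f
    using that(1)
  proof (induction A rule: finite_induct)
    case empty
    show ?case using scale[of "\<lambda>_. 1" 0] by simp
  next
    case (insert k A)
    have "I (\<lambda>x. c k * f k x + (\<Sum>k\<in>A. c k * f k x)) = I (\<lambda>x. c k * f k x) + I (\<lambda>x. \<Sum>k\<in>A. c k * f k x)"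
      by (intro add continuous_intros that)
    with insert show ?case by (simp add: scale that)
  qed
  have real: "Im (I (\<lambda>x. of_real (f x))) = 0" and pos: "0 \<le> Re (I (\<lambda>x. of_real (f x)))"
    if f: "continuous_on UNIV f" "\<And>x. x \<in> {-M..M} \<Longrightarrow> f x \<in> {0..1}" for f :: "real \<Rightarrow> real"
  proof -
    define z where "z = I (\<lambda>x. of_real (f x))"
    have cont: "continuous_on UNIV (\<lambda>x. complex_of_real (f x))" by (intro continuous_intros f)
    have aff: "I (\<lambda>x. d * of_real (f x) + c) = d * z + c" for c d
      using add[of "\<lambda>x. d * of_real (f x)" "\<lambda>_. c"] scale[OF cont, of d] scale[of "\<lambda>_. 1" c] cont
      by (simp add: z_def one continuous_on_mult_left)
    \<comment> \<open>Adding the imaginary constant \<open>i t\<close> keeps the modulus on the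
      interval at most \<open>sqrt (1 + t\<^sup>2)\<close>. At \<open>t = 1 / Im z\<close> the left
      side is \<open>t\<^sup>2 + 2\<close> plus a square, so \<open>Im z\<close> must
      vanish.\<close>
    have "(Im z + t)\<^sup>2 \<le> 1 + t\<^sup>2" for t
    proof -
      have "cmod (I (\<lambda>x. 1 * of_real (f x) + \<i> * of_real t)) \<le> sqrt (1 + t\<^sup>2)"
      proof (rule contr)
        fix x assume "x \<in> {-M..M}"
        then have "(f x)\<^sup>2 \<le> 1" using f(2)[of x] by (auto simp: power_le_one)
        then show "cmod (1 * of_real (f x) + \<i> * of_real t) \<le> sqrt (1 + t\<^sup>2)"
          by (simp add: cmod_def)
      qed (intro continuous_intros f)
      then have "cmod (z + \<i> * of_real t) \<le> sqrt (1 + t\<^sup>2)" unfolding aff by simp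
      then have "\<bar>Im z + t\<bar> \<le> sqrt (1 + t\<^sup>2)"
        using abs_Im_le_cmod[of "z + \<i> * of_real t"] by simp
      then have "\<bar>Im z + t\<bar>\<^sup>2 \<le> (sqrt (1 + t\<^sup>2))\<^sup>2" by (intro power_mono) auto
      then show ?thesis by simp
    qed
    from this[of "1 / Im z"] show "Im (I (\<lambda>x. of_real (f x))) = 0"
      unfolding z_def[symmetric] using zero_le_power2[of "Im z"]
      by (cases "Im z = 0") (simp_all add: power2_sum power_divide)
    have "cmod (I (\<lambda>x. (-1) * of_real (f x) + 1)) \<le> 1"
    proof (rule contr)
      fix x assume "x \<in> {-M..M}"
      then have "\<bar>1 - f x\<bar> \<le> 1" using f(2)[of x] by auto
      moreover have "(-1) * of_real (f x) + 1 = complex_of_real (1 - f x)" by simp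
      ultimately show "cmod ((-1) * of_real (f x) + 1) \<le> 1" by (simp only: norm_of_real)
    qed (intro continuous_intros f)
    then have "Re (1 - z) \<le> 1" unfolding aff using complex_Re_le_cmod[of "1 - z"] by simp
    then show "0 \<le> Re (I (\<lambda>x. of_real (f x)))" by (simp add: z_def)
  qed
  define B where "B n k = (\<lambda>x. complex_of_real (Bernstein n k ((x + M) / (2 * M))))" for n k
  define w where "w n k = (if k \<le> n then Re (I (B n k)) else 0)" for n k
  \<comment> \<open>The Bernstein nodes \<open>k / n\<close> carried over to \<open>[-M, M]\<close>.
    For \<open>n = 0\<close> the quotient is 0 and the node is \<open>-M\<close>.\<close>
  define pt where "pt n k = 2 * M * (real k / real n) - M" for n k :: nat
  have unit: "(x + M) / (2 * M) \<in> {0..1}" if "x \<in> {-M..M}" for x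
    using that \<open>0 < M\<close> by (auto simp: field_simps)
  have B_cont: "continuous_on UNIV (B n k)" for n k
    unfolding B_def Bernstein_def using \<open>0 < M\<close> by (intro continuous_intros) auto
  have w: "0 \<le> w n k" "k \<le> n \<Longrightarrow> I (B n k) = of_real (w n k)" for n k
  proof -
    have c: "continuous_on UNIV (\<lambda>x. Bernstein n k ((x + M) / (2 * M)))"
      unfolding Bernstein_def using \<open>0 < M\<close> by (intro continuous_intros) auto
    have b: "Bernstein n k ((x + M) / (2 * M)) \<in> {0..1}" if "x \<in> {-M..M}" "k \<le> n" for x
      using unit[OF that(1)] Bernstein_nonneg Bernstein_le_1[OF unit[OF that(1)] that(2)] by simp
    show "0 \<le> w n k"
      using pos[OF c b] by (cases "k \<le> n") (simp_all add: w_def B_def)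
    show "I (B n k) = of_real (w n k)" if "k \<le> n"
      using real[OF c b[OF _ that]] that by (simp add: w_def B_def complex_eq_iff)
  qed
  have w_sum: "(\<Sum>k\<le>n. w n k) = 1" for n
  proof -
    have "complex_of_real (\<Sum>k\<le>n. w n k) = (\<Sum>k\<le>n. 1 * I (B n k))" by (simp add: w)
    also have "\<dots> = I (\<lambda>x. \<Sum>k\<le>n. 1 * B n k x)" by (rule sum[symmetric]) (auto simp: B_cont)
    also have "(\<lambda>x. \<Sum>k\<le>n. 1 * B n k x) = (\<lambda>_. 1)"
      by (simp add: B_def flip: of_real_sum)
    finally show ?thesis by (simp add: one flip: of_real_sum)
  qed
  define W where "W n = embed_pmf (w n)" for n
  have W: "pmf (W n) k = w n k" for n k
    unfolding W_def
  proof (rule pmf_embed_pmf)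
    have "(\<integral>\<^sup>+k. ennreal (w n k) \<partial>count_space UNIV) = (\<integral>\<^sup>+k. ennreal (w n k) \<partial>count_space {..n})"
      by (rule nn_integral_count_space_eq) (auto simp: w_def)
    also have "\<dots> = ennreal (\<Sum>k\<le>n. w n k)" by (simp add: nn_integral_count_space_finite w)
    finally show "(\<integral>\<^sup>+k. ennreal (w n k) \<partial>count_space UNIV) = 1" by (simp add: w_sum)
  qed (rule w)
  have W_set: "set_pmf (W n) \<subseteq> {..n}" for n by (auto simp: set_pmf_eq W w_def)
  define \<mu> where "\<mu> n = distr (measure_pmf (W n)) borel (pt n)" for n
  have dist: "real_distribution (\<mu> n)" for n
    unfolding \<mu>_def real_distribution_def real_distribution_axioms_def
    by (auto intro!: prob_space.prob_space_distr prob_space_measure_pmf)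
  \<comment> \<open>By linearity the integral of \<open>g\<close> is \<open>I\<close> of the
    \<open>n\<close>th Bernstein approximation of \<open>g\<close>; convergence to
    \<open>I g\<close> then follows from Bernstein's theorem and contractivity.\<close>
  have \<mu>_int: "integral\<^sup>L (\<mu> n) g = I (\<lambda>x. \<Sum>k\<le>n. g (pt n k) * B n k x)"
    if g: "continuous_on UNIV g" for n and g :: "real \<Rightarrow> complex"
  proof -
    have "integral\<^sup>L (\<mu> n) g = (\<integral>k. g (pt n k) \<partial>measure_pmf (W n))"
      unfolding \<mu>_def
      by (rule integral_distr) (auto intro: borel_measurable_continuous_onI[OF g])
    also have "\<dots> = (\<Sum>k\<le>n. pmf (W n) k *\<^sub>R g (pt n k))"
      by (rule integral_measure_pmf) (use W_set in auto)
    also have "\<dots> = (\<Sum>k\<le>n. g (pt n k) * I (B n k))"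
      by (rule sum.cong) (simp_all add: W w scaleR_conv_of_real)
    also have "\<dots> = I (\<lambda>x. \<Sum>k\<le>n. g (pt n k) * B n k x)"
      by (rule sum[symmetric]) (auto simp: B_cont)
    finally show ?thesis .
  qed
  have \<mu>_lim: "(\<lambda>n. integral\<^sup>L (\<mu> n) g) \<longlonglongrightarrow> I g" if g: "continuous_on UNIV g" for g
  proof (rule LIMSEQ_I)
    fix e :: real assume "0 < e"
    then have e: "0 < e / 4" by simp
    define G where "G t = g (2 * M * t - M)" for t
    have G: "continuous_on UNIV G" unfolding G_def
      by (intro continuous_on_compose2[OF g] continuous_intros) auto
    then have c: "continuous_on {0..1} (\<lambda>t. Re (G t))" "continuous_on {0..1} (\<lambda>t. Im (G t))"
      by (auto intro!: continuous_intros intro: continuous_on_subset)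
    obtain N1 where N1: "\<And>n x. N1 \<le> n \<Longrightarrow> x \<in> {0..1} \<Longrightarrow>
        \<bar>Re (G x) - (\<Sum>k\<le>n. Re (G (k / n)) * Bernstein n k x)\<bar> < e / 4"
      using Bernstein_Weierstrass[OF c(1) e] by blast
    obtain N2 where N2: "\<And>n x. N2 \<le> n \<Longrightarrow> x \<in> {0..1} \<Longrightarrow>
        \<bar>Im (G x) - (\<Sum>k\<le>n. Im (G (k / n)) * Bernstein n k x)\<bar> < e / 4"
      using Bernstein_Weierstrass[OF c(2) e] by blast
    have "norm (integral\<^sup>L (\<mu> n) g - I g) < e" if n: "n \<ge> max N1 N2" for n
    proof -
      let ?h = "\<lambda>x. \<Sum>k\<le>n. g (pt n k) * B n k x"
      have h: "continuous_on UNIV ?h" by (intro continuous_intros B_cont)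
      have "cmod (I (\<lambda>x. ?h x + (-1) * g x)) \<le> e / 2"
      proof (rule contr)
        show "continuous_on UNIV (\<lambda>x. ?h x + (-1) * g x)" by (intro continuous_intros h g)
        fix x assume x: "x \<in> {-M..M}"
        define t where "t = (x + M) / (2 * M)"
        have t: "t \<in> {0..1}" unfolding t_def by (rule unit[OF x])
        have "2 * M * t - M = x" using \<open>0 < M\<close> by (simp add: t_def)
        then have gt: "g x = G t" by (simp add: G_def)
        have ht: "?h x = (\<Sum>k\<le>n. G (k / n) * of_real (Bernstein n k t))"
          unfolding G_def pt_def B_def t_def ..
        have "cmod (?h x - g x) \<le> \<bar>Re (?h x - g x)\<bar> + \<bar>Im (?h x - g x)\<bar>" by (rule cmod_le)
        also have "\<dots> \<le> e / 4 + e / 4"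
          using N1[of n t] N2[of n t] n t unfolding gt ht
          by (intro add_mono) (simp_all add: abs_minus_commute)
        finally show "cmod (?h x + (-1) * g x) \<le> e / 2" by simp
      qed
      also have "I (\<lambda>x. ?h x + (-1) * g x) = I ?h - I g"
        using add[OF h, of "\<lambda>x. (-1) * g x"] scale[OF g, of "-1"] g
        by (simp add: continuous_on_minus)
      finally show ?thesis using \<open>0 < e\<close> by (simp add: \<mu>_int[OF g])
    qed
    then show "\<exists>N. \<forall>n\<ge>N. norm (integral\<^sup>L (\<mu> n) g - I g) < e" by blast
  qed
  have "tight \<mu>"
    unfolding tight_def
  proof (intro conjI allI impI dist)
    fix \<epsilon> :: real assume "0 < \<epsilon>"
    \<comment> \<open>Tightness is phrased with half-open intervals, and the node for
      \<open>k = 0\<close> is \<open>-M\<close> itself; hence the extra 1 on the left.\<close>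
    have "measure (\<mu> n) {-M - 1<..M} = 1" for n
    proof -
      have "pt n k \<in> {-M - 1<..M}" if "k \<le> n" for k
      proof -
        have "0 \<le> real k / real n" "real k / real n \<le> 1" using that by (auto simp: divide_le_eq_1)
        then have "0 \<le> 2 * M * (real k / real n)" "2 * M * (real k / real n) \<le> 2 * M * 1"
          using \<open>0 < M\<close> by (intro mult_nonneg_nonneg mult_left_mono; simp)+
        then show ?thesis by (auto simp: pt_def)
      qed
      then have "AE k in measure_pmf (W n). k \<in> pt n -` {-M - 1<..M} \<inter> space (measure_pmf (W n))"
        using W_set by (auto simp: AE_measure_pmf_iff)
      then show ?thesis
        unfolding \<mu>_def by (subst measure_distr) (auto intro: measure_pmf.prob_eq_1[THEN iffD2])
    qed
    then show "\<exists>a b. a < b \<and> (\<forall>n. 1 - \<epsilon> < measure (\<mu> n) {a<..b})"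
      using \<open>0 < \<epsilon>\<close> \<open>0 < M\<close> by (intro exI[of _ "- M - 1"] exI[of _ M]) auto
  qed
  \<comment> \<open>A weakly convergent subsequence is enough, since the integrals along the full
    sequence already converge to \<open>I g\<close>.\<close>
  then obtain r N where r: "strict_mono (r :: nat \<Rightarrow> nat)" and N: "real_distribution N"
    and conv: "weak_conv_m (\<mu> \<circ> r) N"
    using tight_imp_convergent_subsubsequence[of \<mu> id] by (auto simp: strict_mono_def)
  show thesis
  proof
    show "radon_measure N" by (rule real_distribution_radon[OF N])
    fix g assume g: "g \<in> C\<^sub>c"
    obtain K where K: "\<And>x. cmod (g x) \<le> K" using C\<^sub>c_D(2)[OF g] by blast
    have "(\<lambda>n. integral\<^sup>L ((\<mu> \<circ> r) n) g) \<longlonglongrightarrow> integral\<^sup>L N g"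
      using C\<^sub>c_D(1)[OF g]
      by (intro weak_conv_imp_integral_bdd_continuous_conv[OF _ N conv _ K])
        (auto simp: dist continuous_on_eq_continuous_at)
    moreover have "(\<lambda>n. integral\<^sup>L ((\<mu> \<circ> r) n) g) \<longlonglongrightarrow> I g"
      using LIMSEQ_subseq_LIMSEQ[OF \<mu>_lim[OF C\<^sub>c_D(1)[OF g]] r] by (simp add: o_def)
    ultimately show "integral\<^sup>L N g = I g" by (rule LIMSEQ_unique)
  qed
qed

subsection \<open>Equidistribution\<close>

lemma periodic_of_int:
  fixes F :: "real \<Rightarrow> 'a" and k :: int
  assumes "\<And>x. F (x + \<alpha>) = F x"
  shows "F (x + of_int k * \<alpha>) = F x"
proof (induction k rule: int_induct[where k = 0])
  case (step1 i)
  then show ?case using assms[of "x + of_int i * \<alpha>"] by (simp add: algebra_simps)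
next
  case (step2 i)
  then show ?case using assms[of "x + of_int (i - 1) * \<alpha>"] by (simp add: algebra_simps)
qed simp

lemma periodic_reduce:
  fixes x :: real
  assumes "0 < \<alpha>"
  obtains k :: int where "0 \<le> x + of_int k * \<alpha>" "x + of_int k * \<alpha> < \<alpha>"
proof
  have "of_int \<lfloor>x / \<alpha>\<rfloor> * \<alpha> \<le> x" "x < (of_int \<lfloor>x / \<alpha>\<rfloor> + 1) * \<alpha>"
    using assms by (simp_all add: pos_le_divide_eq[symmetric] pos_divide_less_eq[symmetric])
  then show "0 \<le> x + of_int (- \<lfloor>x / \<alpha>\<rfloor>) * \<alpha>" "x + of_int (- \<lfloor>x / \<alpha>\<rfloor>) * \<alpha> < \<alpha>"
    by (simp_all add: algebra_simps)
qed

lemma periodic_bounded: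
  fixes F :: "real \<Rightarrow> 'a :: real_normed_vector"
  assumes "continuous_on UNIV F" "\<And>x. F (x + \<alpha>) = F x" "0 < \<alpha>"
  obtains K where "0 < K" "\<And>x. norm (F x) \<le> K"
proof -
  have "compact (F ` {0..\<alpha>})"
    by (rule compact_continuous_image) (auto intro: continuous_on_subset[OF assms(1)])
  then obtain K where K: "0 < K" "\<And>x. x \<in> {0..\<alpha>} \<Longrightarrow> norm (F x) \<le> K"
    by (auto dest!: compact_imp_bounded simp: bounded_pos)
  show thesis
  proof
    fix x
    obtain k :: int where "0 \<le> x + of_int k * \<alpha>" "x + of_int k * \<alpha> < \<alpha>"
      using periodic_reduce[OF assms(3)] by blast
    then show "norm (F x) \<le> K"
      using K(2)[of "x + of_int k * \<alpha>"] by (simp add: periodic_of_int[of F, OF assms(2)])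
  qed fact
qed

lemma periodic_uniformly_continuous:
  fixes F :: "real \<Rightarrow> 'a :: real_normed_vector"
  assumes "continuous_on UNIV F" "\<And>x. F (x + \<alpha>) = F x" "0 < \<alpha>"
  shows "uniformly_continuous_on UNIV F"
  unfolding uniformly_continuous_on_def
proof (intro allI impI)
  fix e :: real assume "0 < e"
  \<comment> \<open>The margin 1 on both sides, together with \<open>dist y x < 1\<close>, keeps
    \<open>y\<close> in the compact interval after \<open>x\<close> has been moved into the
    period.\<close>
  have "uniformly_continuous_on {-1..\<alpha> + 1} F"
    by (rule compact_uniformly_continuous) (auto intro: continuous_on_subset[OF assms(1)])
  then obtain d where d: "0 < d"
    "\<And>x y. x \<in> {-1..\<alpha> + 1} \<Longrightarrow> y \<in> {-1..\<alpha> + 1} \<Longrightarrow> dist y x < d \<Longrightarrow> dist (F y) (F x) < e"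
    using \<open>0 < e\<close> unfolding uniformly_continuous_on_def by metis
  show "\<exists>d>0. \<forall>x\<in>UNIV. \<forall>y\<in>UNIV. dist y x < d \<longrightarrow> dist (F y) (F x) < e"
  proof (intro exI[of _ "min d 1"] conjI ballI impI)
    fix x y :: real assume xy: "dist y x < min d 1"
    obtain k :: int where k: "0 \<le> x + of_int k * \<alpha>" "x + of_int k * \<alpha> < \<alpha>"
      using periodic_reduce[OF assms(3)] by blast
    have "dist (F (y + of_int k * \<alpha>)) (F (x + of_int k * \<alpha>)) < e"
      by (rule d(2)) (use k xy in \<open>auto simp: dist_real_def\<close>)
    then show "dist (F y) (F x) < e" by (simp add: periodic_of_int[of F, OF assms(2)])
  qed (use d(1) in auto)
qed

text \<open>After \<open>t\<close> is reduced to \<open>s\<close> in \<open>[0, \<alpha>)\<close>,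
  the part of the window beyond \<open>\<alpha>\<close> is moved back by one period.\<close>

lemma integral_periodic_translate:
  fixes F :: "real \<Rightarrow> complex"
  assumes F: "continuous_on UNIV F" and per: "\<And>x. F (x + \<alpha>) = F x" and \<alpha>: "0 < \<alpha>"
  shows "integral {0..\<alpha>} (\<lambda>x. F (x + t)) = integral {0..\<alpha>} F"
proof -
  obtain k :: int where "0 \<le> t + of_int k * \<alpha>" "t + of_int k * \<alpha> < \<alpha>"
    using periodic_reduce[OF \<alpha>] by blast
  moreover define s where "s = t + of_int k * \<alpha>"
  ultimately have s: "0 \<le> s" "s \<le> \<alpha>" by auto
  have int: "F integrable_on {a..b}" for a b
    by (rule integrable_continuous_real) (rule continuous_on_subset[OF F subset_UNIV])
  have "F (x + t) = F (x + s)" for x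
    using periodic_of_int[of F \<alpha> "x + t" k, OF per] by (simp add: s_def add.assoc)
  then have "integral {0..\<alpha>} (\<lambda>x. F (x + t)) = integral {0..\<alpha>} (\<lambda>x. F (x + s))" by simp
  also have "\<dots> = integral {s..\<alpha> + s} F"
    using integral_shift_real_ivl[of s s "\<alpha> + s" F] by simp
  also have "\<dots> = integral {s..\<alpha>} F + integral {\<alpha>..\<alpha> + s} F"
    using s Henstock_Kurzweil_Integration.integral_combine[OF _ _ int[of s "\<alpha> + s"], of \<alpha>] by simp
  also have "integral {\<alpha>..\<alpha> + s} F = integral {0..s} F"
    using integral_shift_real_ivl[of \<alpha> \<alpha> "\<alpha> + s" F] by (simp add: per)
  also have "integral {s..\<alpha>} F + integral {0..s} F = integral {0..\<alpha>} F"
    using s Henstock_Kurzweil_Integration.integral_combine[OF _ _ int[of 0 \<alpha>], of s]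
    by (simp add: add.commute)
  finally show ?thesis .
qed

text \<open>Each unit shift exchanges one boundary term for another, at a cost of at most
  \<open>2 K\<close>. Negative \<open>h\<close> is covered by shifting back from the translated
  function.\<close>

lemma sum_interval_shift_bound:
  fixes f :: "int \<Rightarrow> 'a :: real_normed_vector"
  assumes K: "\<And>x. norm (f x) \<le> K"
  shows "norm ((\<Sum>x=-int L..int L. f (x + h)) - (\<Sum>x=-int L..int L. f x)) \<le> 2 * K * \<bar>of_int h\<bar>"
proof -
  have nat: "norm ((\<Sum>x=-int L..int L. g (x + int m)) - (\<Sum>x=-int L..int L. g x)) \<le> 2 * K * real m"
    if g: "\<And>x. norm (g x) \<le> K" for g :: "int \<Rightarrow> 'a" and m
  proof (induction m)
    case (Suc m)
    define u where "u = (\<lambda>x. g (x + int m))"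
    have "(\<Sum>x=-int L..int L. u (x + 1)) = (\<Sum>x=-int L+1..int L+1. u x)"
      by (rule sum.reindex_bij_witness[of _ "\<lambda>x. x - 1" "\<lambda>x. x + 1"]) auto
    also have "\<dots> = (\<Sum>x=-int L..int L+1. u x) - u (- int L)"
      by (subst (2) simp_from_to) simp
    also have "(\<Sum>x=-int L..int L+1. u x) = (\<Sum>x=-int L..int L. u x) + u (int L + 1)"
    proof -
      have "{-int L..int L+1} = insert (int L + 1) {-int L..int L}" by auto
      then show ?thesis by simp
    qed
    finally have "(\<Sum>x=-int L..int L. u (x + 1)) - (\<Sum>x=-int L..int L. u x)
        = u (int L + 1) - u (- int L)" by simp
    moreover have "norm (u (int L + 1) - u (- int L)) \<le> K + K"
      by (rule order_trans[OF norm_triangle_ineq4]) (unfold u_def, intro add_mono g)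
    ultimately have "norm ((\<Sum>x=-int L..int L. u (x + 1)) - (\<Sum>x=-int L..int L. u x)) \<le> K + K"
      by simp
    from norm_triangle_mono[OF this Suc.IH[folded u_def, unfolded u_def[symmetric]]]
    show ?case by (simp add: u_def algebra_simps)
  qed simp
  show ?thesis
  proof (cases "0 \<le> h")
    case True
    then show ?thesis using nat[of f "nat h", OF K] by simp
  next
    case False
    then show ?thesis
      using nat[of "\<lambda>x. f (x + h)" "nat (- h)", OF K] by (simp add: norm_minus_commute add.assoc)
  qed
qed

text \<open>
  The averages at two points differ little, since Kronecker's theorem brings one point close to an
  integer translate of the other modulo \<open>\<alpha>\<close>; averaging over the second point gives the integral.
\<close>

theorem equidistribution:
  fixes F :: "real \<Rightarrow> complex"
  assumes F: "continuous_on UNIV F" and per: "\<And>x. F (x + \<alpha>) = F x"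
    and \<alpha>: "0 < \<alpha>" "\<alpha> \<notin> \<rat>"
  shows "(\<lambda>L. (\<Sum>x=-int L..int L. F (b - of_int x)) / of_nat (2 * L + 1))
    \<longlonglongrightarrow> (LBINT b':{0..\<alpha>}. F b') / of_real \<alpha>"
proof -
  define V where "V = (\<lambda>L c. (\<Sum>x=-int L..int L. F (c - of_int x)) / of_nat (2 * L + 1))"
  obtain K where K: "0 < K" "\<And>x. norm (F x) \<le> K"
    using periodic_bounded[OF F per \<alpha>(1)] by blast
  have card: "card {-int L..int L} = 2 * L + 1" for L by simp
  have V_bound: "norm (V L c) \<le> K" for L c
  proof -
    have "norm (\<Sum>x=-int L..int L. F (c - of_int x)) \<le> of_nat (card {-int L..int L}) * K"
      by (rule sum_norm_bound) (rule K)
    then show ?thesis unfolding V_def card norm_divide norm_of_nat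
      by (simp add: field_simps)
  qed
  have V_diff: "(\<lambda>L. V L b - V L c) \<longlonglongrightarrow> 0" for c
  proof (rule LIMSEQ_I)
    fix e :: real assume "0 < e"
    then obtain d where d: "0 < d" "\<And>x y. \<bar>y - x\<bar> < d \<Longrightarrow> norm (F y - F x) < e / 2"
      using periodic_uniformly_continuous[OF F per \<alpha>(1)] half_gt_zero[OF \<open>0 < e\<close>]
      unfolding uniformly_continuous_on_def dist_norm real_norm_def by (metis UNIV_I)
    \<comment> \<open>By Kronecker, \<open>b\<close> lies within \<open>d\<close> of
      \<open>c - h\<close> modulo \<open>\<alpha>\<close>. The averages at \<open>b\<close> and
      \<open>c\<close> then differ by at most \<open>e / 2\<close> and the boundary cost of a shift
      by \<open>h\<close>.\<close>
    obtain h k where hk: "\<bar>of_int k * \<alpha> - of_int h - (b - c)\<bar> < d"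
      using sequence_of_fractional_parts_is_dense[OF \<alpha>(2) d(1)] by blast
    \<comment> \<open>The cost \<open>2 K |h|\<close> has to stay below \<open>e / 2\<close> times
      the number \<open>2 L + 1\<close> of sites; the factor 8 leaves room.\<close>
    obtain N :: nat where N: "8 * K * \<bar>of_int h\<bar> / e < real N" using reals_Archimedean2 by blast
    have "norm (V L b - V L c) < e" if "L \<ge> N" for L
    proof -
      let ?S = "\<lambda>f. \<Sum>x=-int L..int L. f x"
      let ?n = "real (2 * L + 1)"
      have "norm (?S (\<lambda>x. F (b - of_int x)) - ?S (\<lambda>x. F (c - of_int (x + h)))) \<le> ?n * (e / 2)"
      proof -
        have "norm (F (b - of_int x) - F (c - of_int (x + h))) \<le> e / 2" for x
        proof -
          have "F (c - of_int (x + h)) = F (c - of_int (x + h) + of_int k * \<alpha>)"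
            by (simp add: periodic_of_int[of F, OF per])
          moreover have "norm (F (b - of_int x) - F (c - of_int (x + h) + of_int k * \<alpha>)) < e / 2"
            by (rule d(2)) (use hk in \<open>simp add: abs_minus_commute algebra_simps\<close>)
          ultimately show ?thesis by simp
        qed
        then have "norm (\<Sum>x=-int L..int L. F (b - of_int x) - F (c - of_int (x + h)))
            \<le> of_nat (card {-int L..int L}) * (e / 2)"
          by (intro sum_norm_bound)
        then show ?thesis by (simp add: sum_subtractf add.commute)
      qed
      moreover have "norm (?S (\<lambda>x. F (c - of_int (x + h))) - ?S (\<lambda>x. F (c - of_int x)))
          \<le> 2 * K * \<bar>of_int h\<bar>"
        by (rule sum_interval_shift_bound[of "\<lambda>x. F (c - of_int x)"]) (rule K)
      ultimately have "norm (?S (\<lambda>x. F (b - of_int x)) - ?S (\<lambda>x. F (c - of_int x)))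
          \<le> ?n * (e / 2) + 2 * K * \<bar>of_int h\<bar>"
        using norm_triangle_mono by fastforce
      also have "2 * K * \<bar>of_int h\<bar> < ?n * (e / 2)"
      proof -
        have "8 * K * \<bar>of_int h\<bar> < real N * e" using N \<open>0 < e\<close> by (simp add: field_simps)
        also have "\<dots> \<le> real L * e" using that \<open>0 < e\<close> by simp
        also have "\<dots> \<le> ?n * e" using \<open>0 < e\<close> by simp
        finally have "8 * (K * \<bar>of_int h\<bar>) < ?n * e" by simp
        moreover have "0 \<le> K * \<bar>of_int h\<bar>" using K(1) by simp
        ultimately show ?thesis by simp
      qed
      finally have "norm (?S (\<lambda>x. F (b - of_int x)) - ?S (\<lambda>x. F (c - of_int x))) < e * ?n"
        by (simp add: mult.commute)
      then show ?thesis
        unfolding V_def diff_divide_distrib[symmetric] norm_divide norm_of_nat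
        by (subst pos_divide_less_eq) simp_all
    qed
    then show "\<exists>N. \<forall>L\<ge>N. norm (V L b - V L c - 0) < e" by auto
  qed
  have nz: "complex_of_nat (2 * L + 1) \<noteq> 0" for L by (subst of_nat_eq_0_iff) simp
  have V_cont: "continuous_on UNIV (V L)" for L
    unfolding V_def by (intro continuous_intros continuous_on_compose2[OF F]) (use nz in auto)
  have int: "set_integrable lborel {0..\<alpha>} f" if "continuous_on UNIV f" for f :: "real \<Rightarrow> complex"
    by (rule borel_integrable_atLeastAtMost')
      (rule continuous_on_subset[OF that subset_UNIV])
  \<comment> \<open>All averages have the same integral as \<open>F\<close>, by translation
    invariance. Integrating \<open>V L b - V L c\<close> over \<open>c\<close> thus compares
    \<open>V L b\<close> with the mean of \<open>F\<close>.\<close>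
  have V_int: "(LBINT c:{0..\<alpha>}. V L c) = (LBINT c:{0..\<alpha>}. F c)" for L
  proof -
    have "integral {0..\<alpha>} (V L)
        = (\<Sum>x=-int L..int L. integral {0..\<alpha>} (\<lambda>c. F (c - of_int x))) / of_nat (2 * L + 1)"
      unfolding V_def
      by (subst integral_divide, subst integral_sum)
        (auto intro!: integrable_continuous_real continuous_intros continuous_on_compose2[OF F])
    also have "(\<Sum>x=-int L..int L. integral {0..\<alpha>} (\<lambda>c. F (c - of_int x)))
        = of_nat (card {-int L..int L}) * integral {0..\<alpha>} F"
      using integral_periodic_translate[OF F per \<alpha>(1), of "- of_int _"] by simp
    also have "\<dots> / of_nat (2 * L + 1) = integral {0..\<alpha>} F"
      unfolding card by (rule nonzero_mult_div_cancel_left[OF nz])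
    finally show ?thesis
      using set_borel_integral_eq_integral(2)[OF int[OF V_cont]]
        set_borel_integral_eq_integral(2)[OF int[OF F]] by simp
  qed
  have "(\<lambda>L. LBINT c:{0..\<alpha>}. V L b - V L c) \<longlonglongrightarrow> (LBINT c:{0..\<alpha>}. 0)"
    unfolding set_lebesgue_integral_def
  proof (rule integral_dominated_convergence[where w = "\<lambda>c. indicator {0..\<alpha>} c *\<^sub>R (2 * K)"])
    show "integrable lborel (\<lambda>c. indicator {0..\<alpha>} c *\<^sub>R (2 * K))"
      using \<alpha>(1) by (intro integrable_scaleR_left integrable_real_indicator) auto
    show "AE c in lborel. (\<lambda>L. indicator {0..\<alpha>} c *\<^sub>R (V L b - V L c))
        \<longlonglongrightarrow> indicator {0..\<alpha>} c *\<^sub>R (0 :: complex)"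
      by (intro AE_I2 tendsto_scaleR tendsto_const V_diff)
    show "(\<lambda>c. indicator {0..\<alpha>} c *\<^sub>R (V L b - V L c)) \<in> borel_measurable lborel" for L
      using borel_measurable_continuous_onI[OF V_cont[of L]] by measurable
    show "AE c in lborel. norm (indicator {0..\<alpha>} c *\<^sub>R (V L b - V L c))
        \<le> indicator {0..\<alpha>} c *\<^sub>R (2 * K)" for L
    proof (intro AE_I2)
      fix c
      have "norm (V L b - V L c) \<le> 2 * K"
        using norm_triangle_ineq4[of "V L b" "V L c"] V_bound[of L b] V_bound[of L c] by linarith
      then show "norm (indicator {0..\<alpha>} c *\<^sub>R (V L b - V L c)) \<le> indicator {0..\<alpha>} c *\<^sub>R (2 * K)"
        by (simp add: indicator_def)
    qed
  qed simp
  moreover have "(LBINT c:{0..\<alpha>}. V L b - V L c) = of_real \<alpha> * V L b - (LBINT c:{0..\<alpha>}. F c)" for L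
  proof -
    have "(LBINT c:{0..\<alpha>}. V L b - V L c) = (LBINT c:{0..\<alpha>}. V L b) - (LBINT c:{0..\<alpha>}. V L c)"
      by (rule set_integral_diff) (auto intro: int V_cont)
    also have "(LBINT c:{0..\<alpha>}. V L b) = of_real \<alpha> * V L b"
      using \<alpha>(1) by (simp add: set_integral_const scaleR_conv_of_real)
    finally show ?thesis by (simp add: V_int)
  qed
  ultimately have "(\<lambda>L. of_real \<alpha> * V L b - (LBINT c:{0..\<alpha>}. F c)) \<longlonglongrightarrow> 0"
    by (simp add: set_lebesgue_integral_def)
  then have "(\<lambda>L. of_real \<alpha> * V L b) \<longlonglongrightarrow> (LBINT c:{0..\<alpha>}. F c)"
    by (simp add: LIM_zero_iff)
  then have "(\<lambda>L. of_real \<alpha> * V L b / of_real \<alpha>) \<longlonglongrightarrow> (LBINT c:{0..\<alpha>}. F c) / of_real \<alpha>"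
    by (rule tendsto_divide) (use \<alpha>(1) in auto)
  then show ?thesis using \<alpha>(1) by (simp add: V_def)
qed

subsection \<open>Shifts and kernel operators\<close>

lemma cinner_delta: "cinner (\<delta> x) \<psi> = coord \<psi> x"
proof -
  have "cinner (\<delta> x) \<psi> = (\<Sum>\<^sub>\<infinity>n\<in>{x}. coord \<psi> n)"
    unfolding cinner_def by (rule infsum_cong_neutral) (auto simp: coord_delta)
  then show ?thesis by simp
qed

lemma norm_delta_le: "norm (\<delta> x) \<le> 1"
proof (rule norm_ell2_le)
  fix F :: "int set" assume "finite F"
  then have "(\<Sum>n\<in>F. (cmod (coord (\<delta> x) n))\<^sup>2) = (\<Sum>n\<in>F \<inter> {x}. 1)"
    by (intro sum.mono_neutral_cong_right) (auto simp: coord_delta)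
  also have "\<dots> \<le> (\<Sum>n\<in>{x}. 1)" by (rule sum_mono2) auto
  finally show "(\<Sum>n\<in>F. (cmod (coord (\<delta> x) n))\<^sup>2) \<le> 1\<^sup>2" by simp
qed simp

lift_definition shift :: "int \<Rightarrow> ell2 \<Rightarrow> ell2" is "\<lambda>k \<psi> n. \<psi> (n + k)"
  by (rule square_summable_shift)

lemma coord_shift [simp]: "coord (shift k \<psi>) n = coord \<psi> (n + k)"
  by (simp add: shift.rep_eq)

lemma infsum_shift:
  fixes k :: int and f :: "int \<Rightarrow> 'a :: {comm_monoid_add, t2_space}"
  shows "(\<Sum>\<^sub>\<infinity>n. f (n + k)) = (\<Sum>\<^sub>\<infinity>n. f n)"
proof -
  have "bij_betw (\<lambda>n::int. n + k) UNIV UNIV"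
    by (rule bij_betw_byWitness[where f' = "\<lambda>n. n - k"]) auto
  then show ?thesis by (rule infsum_reindex_bij_betw)
qed

lemma norm_shift [simp]: "norm (shift k \<psi>) = norm \<psi>"
  using infsum_shift[of "\<lambda>n. (cmod (coord \<psi> n))\<^sup>2" k] by (simp add: norm_ell2_def)

lemma inner_shift: "inner (shift k \<phi>) \<psi> = inner \<phi> (shift (- k) \<psi>)"
  using infsum_shift[of "\<lambda>n. inner (coord \<phi> n) (coord \<psi> (n - k))" k]
  by (simp add: inner_ell2_def)

lemma bounded_clinear_shift: "bounded_clinear (shift k)"
  by (rule bounded_clinearI[where K = 1]) (auto intro: ell2_eqI)

lemma shift_zero: "shift 0 \<psi> = \<psi>"
  by (rule ell2_eqI) simp

lemma shift_delta: "shift k (\<delta> x) = \<delta> (x - k)"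
  by (rule ell2_eqI) (auto simp: coord_delta)

lemma laplacian_shift: "laplacian \<psi> = shift 1 \<psi> - 2 *\<^sub>R \<psi> + shift (-1) \<psi>"
  by (rule ell2_eqI) (simp add: laplacian.rep_eq)

text \<open>Bounds on finite partial sums encode summability and size of rows and columns at once; a
  common bound makes the notion symmetric under transposition.\<close>

definition schur :: "(int \<Rightarrow> int \<Rightarrow> real) \<Rightarrow> real \<Rightarrow> bool" where
  "schur k K \<longleftrightarrow> (\<forall>F. finite F \<longrightarrow>
    (\<forall>n. (\<Sum>m\<in>F. \<bar>k n m\<bar>) \<le> K) \<and> (\<forall>m. (\<Sum>n\<in>F. \<bar>k n m\<bar>) \<le> K))"

definition kernel_op :: "(int \<Rightarrow> int \<Rightarrow> real) \<Rightarrow> ell2 \<Rightarrow> ell2" where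
  "kernel_op k \<psi> = Abs_ell2 (\<lambda>n. \<Sum>\<^sub>\<infinity>m. of_real (k n m) * coord \<psi> m)"

lemma schur_nonneg: "schur k K \<Longrightarrow> 0 \<le> K"
  unfolding schur_def using sum.empty finite.emptyI by metis

lemma schur_transpose: "schur k K \<Longrightarrow> schur (\<lambda>n m. k m n) K"
  by (simp add: schur_def)

lemma schur_abs_summable:
  assumes "schur k K"
  shows "(\<lambda>m. norm (of_real (k n m) * coord \<psi> m)) summable_on UNIV"
proof (rule nonneg_bdd_above_summable_on)
  show "bdd_above (sum (\<lambda>m. norm (of_real (k n m) * coord \<psi> m)) ` {F. F \<subseteq> UNIV \<and> finite F})"
  proof (rule bdd_aboveI2)
    fix F :: "int set" assume "F \<in> {F. F \<subseteq> UNIV \<and> finite F}"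
    then have "finite F" by simp
    have "(\<Sum>m\<in>F. norm (of_real (k n m) * coord \<psi> m)) \<le> (\<Sum>m\<in>F. \<bar>k n m\<bar> * norm \<psi>)"
      by (intro sum_mono) (simp add: norm_mult mult_left_mono norm_coord_le)
    also have "\<dots> \<le> K * norm \<psi>"
      using assms \<open>finite F\<close>
      by (simp add: schur_def sum_distrib_right[symmetric] mult_right_mono)
    finally show "(\<Sum>m\<in>F. norm (of_real (k n m) * coord \<psi> m)) \<le> K * norm \<psi>" .
  qed
qed simp

lemmas schur_summable = abs_summable_summable[OF schur_abs_summable]

text \<open>Cauchy-Schwarz with weight \<open>|k n m|\<close> spends the row bound, exchanging the
  two sums spends the column bound. The estimate is made for finite \<open>G\<close> and passed to
  the limit.\<close>

lemma schur_test:
  assumes k: "schur k K" and "finite F"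
  shows "(\<Sum>n\<in>F. (cmod (\<Sum>\<^sub>\<infinity>m. of_real (k n m) * coord \<psi> m))\<^sup>2) \<le> (K * norm \<psi>)\<^sup>2"
proof (rule tendsto_upperbound)
  show "((\<lambda>G. \<Sum>n\<in>F. (cmod (\<Sum>m\<in>G. of_real (k n m) * coord \<psi> m))\<^sup>2)
      \<longlongrightarrow> (\<Sum>n\<in>F. (cmod (\<Sum>\<^sub>\<infinity>m. of_real (k n m) * coord \<psi> m))\<^sup>2)) (finite_subsets_at_top UNIV)"
    by (intro tendsto_intros infsum_tendsto schur_summable[OF k])
  show "\<forall>\<^sub>F G in finite_subsets_at_top UNIV.
      (\<Sum>n\<in>F. (cmod (\<Sum>m\<in>G. of_real (k n m) * coord \<psi> m))\<^sup>2) \<le> (K * norm \<psi>)\<^sup>2"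
  proof (rule eventually_finite_subsets_at_top_weakI)
    fix G :: "int set" assume "finite G"
    let ?p = "\<lambda>m. cmod (coord \<psi> m)"
    have row: "(cmod (\<Sum>m\<in>G. of_real (k n m) * coord \<psi> m))\<^sup>2
        \<le> K * (\<Sum>m\<in>G. \<bar>k n m\<bar> * (?p m)\<^sup>2)" for n
    proof -
      have "cmod (\<Sum>m\<in>G. of_real (k n m) * coord \<psi> m) \<le> (\<Sum>m\<in>G. \<bar>k n m\<bar> * ?p m)"
        by (rule order_trans[OF norm_sum]) (simp add: norm_mult)
      also have "\<dots> = (\<Sum>m\<in>G. sqrt \<bar>k n m\<bar> * (sqrt \<bar>k n m\<bar> * ?p m))"
        by (rule sum.cong) (simp_all flip: mult.assoc)
      finally have "(cmod (\<Sum>m\<in>G. of_real (k n m) * coord \<psi> m))\<^sup>2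
          \<le> (\<Sum>m\<in>G. sqrt \<bar>k n m\<bar> * (sqrt \<bar>k n m\<bar> * ?p m))\<^sup>2"
        by (rule power_mono) simp
      also have "\<dots> \<le> (\<Sum>m\<in>G. (sqrt \<bar>k n m\<bar>)\<^sup>2) * (\<Sum>m\<in>G. (sqrt \<bar>k n m\<bar> * ?p m)\<^sup>2)"
        by (rule Cauchy_Schwarz_ineq_sum)
      also have "\<dots> \<le> K * (\<Sum>m\<in>G. \<bar>k n m\<bar> * (?p m)\<^sup>2)"
        using k \<open>finite G\<close>
        by (simp add: power_mult_distrib schur_def) (intro mult_right_mono sum_nonneg; simp)
      finally show ?thesis .
    qed
    have "(\<Sum>n\<in>F. (cmod (\<Sum>m\<in>G. of_real (k n m) * coord \<psi> m))\<^sup>2)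
        \<le> (\<Sum>n\<in>F. K * (\<Sum>m\<in>G. \<bar>k n m\<bar> * (?p m)\<^sup>2))"
      by (intro sum_mono row)
    also have "\<dots> = K * (\<Sum>m\<in>G. (\<Sum>n\<in>F. \<bar>k n m\<bar>) * (?p m)\<^sup>2)"
      by (simp add: sum_distrib_left[symmetric] sum_distrib_right) (subst sum.swap, simp)
    also have "\<dots> \<le> K * (\<Sum>m\<in>G. K * (?p m)\<^sup>2)"
      using k \<open>finite F\<close>
      by (intro mult_left_mono sum_mono mult_right_mono) (auto simp: schur_def schur_nonneg[OF k])
    also have "\<dots> = K\<^sup>2 * (\<Sum>m\<in>G. (?p m)\<^sup>2)"
      by (simp add: sum_distrib_left[symmetric] power2_eq_square)
    also have "\<dots> \<le> K\<^sup>2 * (norm \<psi>)\<^sup>2"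
      by (intro mult_left_mono sum_coord_le_norm \<open>finite G\<close>) simp
    finally show "(\<Sum>n\<in>F. (cmod (\<Sum>m\<in>G. of_real (k n m) * coord \<psi> m))\<^sup>2) \<le> (K * norm \<psi>)\<^sup>2"
      by (simp add: power_mult_distrib)
  qed
qed simp

lemma coord_kernel_op:
  assumes "schur k K"
  shows "coord (kernel_op k \<psi>) n = (\<Sum>\<^sub>\<infinity>m. of_real (k n m) * coord \<psi> m)"
  unfolding kernel_op_def
  by (subst Abs_ell2_inverse) (auto intro!: square_summable_if_bounded schur_test[OF assms])

lemma norm_kernel_op:
  assumes "schur k K"
  shows "norm (kernel_op k \<psi>) \<le> K * norm \<psi>"
  by (rule norm_ell2_le)
    (auto simp: coord_kernel_op[OF assms] schur_nonneg[OF assms] intro: schur_test[OF assms])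

lemma bounded_clinear_kernel_op:
  assumes k: "schur k K"
  shows "bounded_clinear (kernel_op k)"
proof (rule bounded_clinearI[where K = K])
  show "kernel_op k (\<phi> + \<psi>) = kernel_op k \<phi> + kernel_op k \<psi>" for \<phi> \<psi>
    by (rule ell2_eqI)
      (simp add: coord_kernel_op[OF k] distrib_left infsum_add schur_summable[OF k])
  show "kernel_op k (c *\<^sub>C \<psi>) = c *\<^sub>C kernel_op k \<psi>" for c \<psi>
    by (rule ell2_eqI)
      (simp add: coord_kernel_op[OF k] mult.left_commute[of _ c] infsum_cmult_right')
  show "norm (kernel_op k \<psi>) \<le> norm \<psi> * K" for \<psi>
    using norm_kernel_op[OF k, of \<psi>] by (simp add: mult.commute)
qed

lemma kernel_op_diff:
  assumes k: "schur k K" and l: "schur l K'" and d: "schur (\<lambda>n m. k n m - l n m) K''"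
  shows "kernel_op k \<psi> - kernel_op l \<psi> = kernel_op (\<lambda>n m. k n m - l n m) \<psi>"
proof (rule ell2_eqI)
  fix n
  have "(\<Sum>\<^sub>\<infinity>m. of_real (k n m) * coord \<psi> m) = (\<Sum>\<^sub>\<infinity>m. of_real (l n m) * coord \<psi> m)
      + (\<Sum>\<^sub>\<infinity>m. of_real (k n m - l n m) * coord \<psi> m)"
    by (subst infsum_add[OF schur_summable[OF l] schur_summable[OF d], symmetric])
      (simp add: algebra_simps)
  then show "coord (kernel_op k \<psi> - kernel_op l \<psi>) n
      = coord (kernel_op (\<lambda>n m. k n m - l n m) \<psi>) n"
    by (simp add: coord_kernel_op[OF k] coord_kernel_op[OF l] coord_kernel_op[OF d])
qed

text \<open>Fubini: absolute convergence of the double series follows from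
  \<open>x y \<le> x\<^sup>2 + y\<^sup>2\<close>, after which column sums control the
  \<open>\<phi>\<close> part and row sums the \<open>\<psi>\<close> part. Kernels are real, so the
  transpose is the adjoint.\<close>

lemma inner_kernel_op:
  assumes k: "schur k K"
  shows "inner (kernel_op k \<phi>) \<psi> = inner \<phi> (kernel_op (\<lambda>n m. k m n) \<psi>)"
proof -
  define f where "f n m = k n m * inner (coord \<phi> m) (coord \<psi> n)" for n m
  let ?p = "\<lambda>m. cmod (coord \<phi> m)" and ?q = "\<lambda>m. cmod (coord \<psi> m)"
  have "(\<lambda>x. norm ((\<lambda>(n, m). f n m) x)) summable_on UNIV \<times> UNIV"
  proof (rule nonneg_bdd_above_summable_on)
    show "bdd_above (sum (\<lambda>x. norm ((\<lambda>(n, m). f n m) x)) ` {E. E \<subseteq> UNIV \<times> UNIV \<and> finite E})"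
    proof (rule bdd_aboveI2)
      fix E :: "(int \<times> int) set" assume "E \<in> {E. E \<subseteq> UNIV \<times> UNIV \<and> finite E}"
      then have E: "finite E" by simp
      define F G where "F = fst ` E" and "G = snd ` E"
      have FG: "finite F" "finite G" "E \<subseteq> F \<times> G" using E by (force simp: F_def G_def)+
      have f_le: "norm (f n m) \<le> \<bar>k n m\<bar> * (?p m)\<^sup>2 + \<bar>k n m\<bar> * (?q n)\<^sup>2" for n m
      proof -
        have "\<bar>inner (coord \<phi> m) (coord \<psi> n)\<bar> \<le> ?p m * ?q n" by (rule Cauchy_Schwarz_ineq2)
        also have "\<dots> \<le> (?p m)\<^sup>2 + (?q n)\<^sup>2"
          using sum_squares_bound[of "?p m" "?q n"]
            mult_nonneg_nonneg[OF norm_ge_zero[of "coord \<phi> m"] norm_ge_zero[of "coord \<psi> n"]]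
          by linarith
        finally show ?thesis
          by (simp add: f_def abs_mult mult_left_mono flip: distrib_left)
      qed
      have "(\<Sum>x\<in>E. norm ((\<lambda>(n, m). f n m) x)) \<le> (\<Sum>x\<in>F \<times> G. norm ((\<lambda>(n, m). f n m) x))"
        using FG by (intro sum_mono2) auto
      also have "\<dots> = (\<Sum>n\<in>F. \<Sum>m\<in>G. norm (f n m))"
        by (simp add: sum.cartesian_product case_prod_unfold)
      also have "\<dots> \<le> (\<Sum>n\<in>F. \<Sum>m\<in>G. \<bar>k n m\<bar> * (?p m)\<^sup>2 + \<bar>k n m\<bar> * (?q n)\<^sup>2)"
        by (intro sum_mono f_le)
      also have "\<dots> = (\<Sum>m\<in>G. (\<Sum>n\<in>F. \<bar>k n m\<bar>) * (?p m)\<^sup>2) + (\<Sum>n\<in>F. (\<Sum>m\<in>G. \<bar>k n m\<bar>) * (?q n)\<^sup>2)"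
        by (simp add: sum.distrib sum_distrib_right sum.swap[of _ F G])
      also have "\<dots> \<le> (\<Sum>m\<in>G. K * (?p m)\<^sup>2) + (\<Sum>n\<in>F. K * (?q n)\<^sup>2)"
        using k FG by (intro add_mono sum_mono mult_right_mono) (auto simp: schur_def)
      also have "\<dots> \<le> K * (norm \<phi>)\<^sup>2 + K * (norm \<psi>)\<^sup>2"
        unfolding sum_distrib_left[symmetric]
        by (intro add_mono mult_left_mono sum_coord_le_norm FG schur_nonneg[OF k])
      finally show "(\<Sum>x\<in>E. norm ((\<lambda>(n, m). f n m) x)) \<le> K * (norm \<phi>)\<^sup>2 + K * (norm \<psi>)\<^sup>2" .
    qed
  qed simp
  then have sum: "(\<lambda>(n, m). f n m) summable_on UNIV \<times> UNIV" by (rule abs_summable_summable)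
  note kT = schur_transpose[OF k]
  have "inner (kernel_op k \<phi>) \<psi> = (\<Sum>\<^sub>\<infinity>n. \<Sum>\<^sub>\<infinity>m. f n m)"
    unfolding inner_ell2_def coord_kernel_op[OF k]
  proof (rule infsum_cong)
    fix n
    have "((\<lambda>m. inner (of_real (k n m) * coord \<phi> m) (coord \<psi> n)) has_sum
        inner (\<Sum>\<^sub>\<infinity>m. of_real (k n m) * coord \<phi> m) (coord \<psi> n)) UNIV"
      by (rule has_sum_bounded_linear[OF bounded_linear_inner_left])
        (rule has_sum_infsum[OF schur_summable[OF k]])
    then show "inner (\<Sum>\<^sub>\<infinity>m. of_real (k n m) * coord \<phi> m) (coord \<psi> n) = (\<Sum>\<^sub>\<infinity>m. f n m)"
      by (simp add: infsumI[symmetric] f_def flip: scaleR_conv_of_real)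
  qed
  also have "\<dots> = (\<Sum>\<^sub>\<infinity>m. \<Sum>\<^sub>\<infinity>n. f n m)" by (rule infsum_swap_banach[OF sum])
  also have "\<dots> = inner \<phi> (kernel_op (\<lambda>n m. k m n) \<psi>)"
    unfolding inner_ell2_def coord_kernel_op[OF kT]
  proof (rule infsum_cong)
    fix m
    have "((\<lambda>n. inner (coord \<phi> m) (of_real (k n m) * coord \<psi> n)) has_sum
        inner (coord \<phi> m) (\<Sum>\<^sub>\<infinity>n. of_real (k n m) * coord \<psi> n)) UNIV"
      by (rule has_sum_bounded_linear[OF bounded_linear_inner_right])
        (rule has_sum_infsum[OF schur_summable[OF kT]])
    then show "(\<Sum>\<^sub>\<infinity>n. f n m) = inner (coord \<phi> m) (\<Sum>\<^sub>\<infinity>n. of_real (k n m) * coord \<psi> n)"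
      by (simp add: infsumI f_def flip: scaleR_conv_of_real)
  qed
  finally show ?thesis .
qed

text \<open>Output and input index shift independently. With one offset zero, a change of the
  kernel's parameter is traded for a shift on one side only.\<close>

lemma kernel_op_shift:
  assumes k: "schur k K" and l: "schur l K'" and "\<And>n m. l n m = k (n + i) (m + j)"
  shows "shift i (kernel_op k \<psi>) = kernel_op l (shift j \<psi>)"
proof (rule ell2_eqI)
  fix n
  show "coord (shift i (kernel_op k \<psi>)) n = coord (kernel_op l (shift j \<psi>)) n"
    using infsum_shift[of "\<lambda>m. of_real (k (n + i) m) * coord \<psi> m" j]
    by (simp add: coord_kernel_op[OF k] coord_kernel_op[OF l] assms(3))
qed

section \<open>Lattice sums and the Green's function of the Laplacian\<close>

lemma sum_geometric_int:
  fixes q :: real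
  assumes q: "0 \<le> q" "q < 1" and "finite F"
  shows "(\<Sum>m\<in>F. q ^ nat \<bar>m\<bar>) \<le> 2 / (1 - q)"
proof -
  have half: "(\<Sum>m\<in>G. q ^ nat \<bar>m\<bar>) \<le> 1 / (1 - q)"
    if G: "finite G" "inj_on (\<lambda>m. nat \<bar>m\<bar>) G" for G :: "int set"
  proof -
    have "(\<Sum>m\<in>G. q ^ nat \<bar>m\<bar>) = (\<Sum>j\<in>(\<lambda>m. nat \<bar>m\<bar>) ` G. q ^ j)"
      using G(2) by (simp add: sum.reindex)
    also have "\<dots> \<le> (\<Sum>j. q ^ j)"
      using q G(1) by (intro sum_le_suminf) (auto simp: summable_geometric)
    also have "\<dots> = 1 / (1 - q)" using q by (simp add: suminf_geometric)
    finally show ?thesis .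
  qed
  have "F = {m\<in>F. 0 \<le> m} \<union> {m\<in>F. m < 0}" by auto
  then have "(\<Sum>m\<in>F. q ^ nat \<bar>m\<bar>) = (\<Sum>m\<in>{m\<in>F. 0 \<le> m} \<union> {m\<in>F. m < 0}. q ^ nat \<bar>m\<bar>)" by simp
  also have "\<dots> = (\<Sum>m\<in>{m\<in>F. 0 \<le> m}. q ^ nat \<bar>m\<bar>) + (\<Sum>m\<in>{m\<in>F. m < 0}. q ^ nat \<bar>m\<bar>)"
    by (rule sum.union_disjoint) (use \<open>finite F\<close> in auto)
  also have "\<dots> \<le> 1 / (1 - q) + 1 / (1 - q)"
    by (intro add_mono half) (auto simp: \<open>finite F\<close> inj_on_def)
  finally show ?thesis by simp
qed

lemma sum_geometric_int_shift:
  fixes q :: real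
  assumes q: "0 \<le> q" "q < 1" and "finite F"
  shows "(\<Sum>m\<in>F. q ^ nat \<bar>m - i\<bar>) \<le> 2 / (1 - q)"
proof -
  have "(\<Sum>m\<in>F. q ^ nat \<bar>m - i\<bar>) = (\<Sum>m\<in>(\<lambda>m. m - i) ` F. q ^ nat \<bar>m\<bar>)"
    by (simp add: sum.reindex inj_on_def)
  then show ?thesis using sum_geometric_int[OF q, of "(\<lambda>m. m - i) ` F"] \<open>finite F\<close> by simp
qed

text \<open>Compare with the lattice point \<open>a i\<close> just below \<open>t\<close>: the
  offset is less than \<open>a\<close> and costs a factor \<open>exp (c a)\<close>, and a geometric
  sum remains. The bound is free of \<open>t\<close>, whence the later uniformity in
  \<open>b\<close>.\<close>

lemma sum_exp_decay:
  assumes "0 < a" "0 < c"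
  obtains K where "0 < K"
    "\<And>F t. finite F \<Longrightarrow> (\<Sum>m\<in>F. exp (- c * \<bar>t - a * real_of_int m\<bar>)) \<le> K"
proof
  define q where "q = exp (- (c * a))"
  have q: "0 \<le> q" "q < 1" using assms by (auto simp: q_def)
  show "0 < exp (c * a) * (2 / (1 - q))" using q by simp
  fix F :: "int set" and t :: real assume "finite F"
  define i where "i = \<lfloor>t / a\<rfloor>"
  have i: "a * of_int i \<le> t" "t < a * of_int i + a"
  proof -
    have "of_int i \<le> t / a" "t / a < of_int i + 1" unfolding i_def by linarith+
    then show "a * of_int i \<le> t" "t < a * of_int i + a" using \<open>0 < a\<close> by (auto simp: field_simps)
  qed
  have "exp (- c * \<bar>t - a * of_int m\<bar>) \<le> exp (c * a) * q ^ nat \<bar>m - i\<bar>" for m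
  proof -
    have "a * \<bar>of_int (m - i)\<bar> = \<bar>a * of_int m - a * of_int i\<bar>"
      using \<open>0 < a\<close> by (simp add: abs_mult flip: right_diff_distrib)
    also have "\<dots> \<le> \<bar>t - a * of_int m\<bar> + a" using i by linarith
    finally have "c * (a * \<bar>of_int (m - i)\<bar>) \<le> c * (\<bar>t - a * of_int m\<bar> + a)"
      using \<open>0 < c\<close> by (intro mult_left_mono) auto
    then have "exp (- c * \<bar>t - a * of_int m\<bar>) \<le> exp (c * a + real (nat \<bar>m - i\<bar>) * (- (c * a)))"
      by (simp add: algebra_simps)
    also have "\<dots> = exp (c * a) * q ^ nat \<bar>m - i\<bar>"
      by (simp only: exp_add exp_of_nat_mult q_def)
    finally show ?thesis .
  qed
  then have "(\<Sum>m\<in>F. exp (- c * \<bar>t - a * of_int m\<bar>)) \<le> (\<Sum>m\<in>F. exp (c * a) * q ^ nat \<bar>m - i\<bar>)"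
    by (rule sum_mono)
  also have "\<dots> \<le> exp (c * a) * (2 / (1 - q))"
    unfolding sum_distrib_left[symmetric]
    by (intro mult_left_mono sum_geometric_int_shift q \<open>finite F\<close>) simp
  finally show "(\<Sum>m\<in>F. exp (- c * \<bar>t - a * of_int m\<bar>)) \<le> exp (c * a) * (2 / (1 - q))" .
qed

text \<open>With \<open>s = 2 - \<mu>\<close>, the recursion
  \<open>s g(n) = g(n + 1) + g(n - 1)\<close> off the origin is solved by \<open>q ^ |n|\<close> for
  a root of \<open>q\<^sup>2 - s q + 1\<close>. The roots have product 1, and
  \<open>|s| > 2\<close>, that is \<open>\<mu>\<close> outside \<open>[0, 4]\<close>, makes them
  real and distinct, so one lies inside the unit disc.\<close>

lemma resolvent_entry_formula:
  assumes "\<mu> \<notin> {0..4}"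
  obtains c q where "\<bar>q\<bar> < 1" "\<And>n m. resolvent_entry \<mu> n m = of_real (c * q ^ nat \<bar>n - m\<bar>)"
proof -
  define s where "s = 2 - \<mu>"
  have s: "2 < \<bar>s\<bar>" using assms by (auto simp: s_def)
  define r where "r = sqrt (s\<^sup>2 - 4)"
  have "2\<^sup>2 < \<bar>s\<bar>\<^sup>2" using s by (intro power_strict_mono) auto
  then have r: "r\<^sup>2 = s\<^sup>2 - 4" "0 < r" by (simp_all add: r_def)
  \<comment> \<open>\<open>d / 2\<close> is the root of larger modulus; the sign of \<open>r\<close>
    is matched to that of \<open>s\<close> so that nothing cancels. Its reciprocal is
    \<open>q\<close>.\<close>
  define d where "d = s + sgn s * r"
  have sgn2: "(sgn s)\<^sup>2 = 1" using s by (auto simp: sgn_real_def)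
  have "d = sgn s * (\<bar>s\<bar> + r)" by (simp add: d_def distrib_left mult.commute[of "sgn s" "\<bar>s\<bar>"] abs_mult_sgn)
  moreover have "\<bar>sgn s\<bar> = 1" using s by (auto simp: sgn_real_def)
  ultimately have "\<bar>d\<bar> = \<bar>s\<bar> + r" using r(2) by (simp add: abs_mult)
  then have d: "2 < \<bar>d\<bar>" using s r(2) by simp
  define q where "q = 2 / d"
  have q1: "\<bar>q\<bar> < 1" using d by (simp add: q_def)
  have q0: "q \<noteq> 0" using d by (auto simp: q_def)
  have "d\<^sup>2 + 4 = 2 * s * d"
    by (simp add: d_def power2_sum power_mult_distrib sgn2 r(1)) (simp add: power2_eq_square algebra_simps)
  then have root: "q\<^sup>2 + 1 = s * q"
    using d by (auto simp: q_def power_divide field_simps power2_eq_square)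
  have "q\<^sup>2 < 1" using q1 by (simp add: abs_square_less_1)
  \<comment> \<open>Normalized by the equation at 0, which asks for \<open>c (s - 2 q) = 1\<close>,
    where \<open>s - 2 q = (1 - q\<^sup>2) / q\<close> by \<open>root\<close>.\<close>
  define c where "c = q / (1 - q\<^sup>2)"
  define g :: "int \<Rightarrow> real" where "g n = c * q ^ nat \<bar>n\<bar>" for n
  have g_eq: "s * g n - g (n + 1) - g (n - 1) = (if n = 0 then 1 else 0)" for n
  proof -
    consider "n = 0" | j where "n = int (Suc j)" | j where "n = - int (Suc j)"
      by (metis int_cases int_of_nat_induct nat.exhaust of_nat_0 of_nat_eq_iff)
    then show ?thesis
    proof cases
      case 1
      have "s * q - 2 * q\<^sup>2 = 1 - q\<^sup>2" using root by simp
      moreover have "c * (1 - q\<^sup>2) = q" using \<open>q\<^sup>2 < 1\<close> by (simp add: c_def)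
      moreover have "q * (s * c - 2 * (c * q)) = c * (s * q - 2 * q\<^sup>2)"
        by (simp add: algebra_simps power2_eq_square)
      ultimately have "q * (s * c - 2 * (c * q)) = q" by simp
      with 1 q0 show ?thesis by (simp add: g_def mult.commute)
    next
      case (2 j)
      have "nat \<bar>n\<bar> = Suc j" "nat \<bar>n + 1\<bar> = Suc (Suc j)" "nat \<bar>n - 1\<bar> = j" using 2 by auto
      then have "s * g n - g (n + 1) - g (n - 1) = c * q ^ j * (s * q - (q\<^sup>2 + 1))"
        by (simp add: g_def algebra_simps power2_eq_square)
      with 2 root show ?thesis by simp
    next
      case (3 j)
      have "nat \<bar>n\<bar> = Suc j" "nat \<bar>n - 1\<bar> = Suc (Suc j)" "nat \<bar>n + 1\<bar> = j" using 3 by auto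
      then have "s * g n - g (n + 1) - g (n - 1) = c * q ^ j * (s * q - (q\<^sup>2 + 1))"
        by (simp add: g_def algebra_simps power2_eq_square)
      with 3 root show ?thesis by simp
    qed
  qed
  have "(\<lambda>n. (cmod (of_real (g n)))\<^sup>2) summable_on UNIV"
  proof (rule square_summable_if_bounded)
    fix F :: "int set" assume "finite F"
    have "(cmod (of_real (g n)))\<^sup>2 = c\<^sup>2 * (q\<^sup>2) ^ nat \<bar>n\<bar>" for n
      unfolding norm_of_real power2_abs g_def power_mult_distrib
      by (simp add: mult.commute flip: power_mult)
    then have "(\<Sum>n\<in>F. (cmod (of_real (g n)))\<^sup>2) = c\<^sup>2 * (\<Sum>n\<in>F. (q\<^sup>2) ^ nat \<bar>n\<bar>)"
      by (simp only: sum_distrib_left)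
    also have "\<dots> \<le> c\<^sup>2 * (2 / (1 - q\<^sup>2))"
      by (intro mult_left_mono sum_geometric_int \<open>q\<^sup>2 < 1\<close> \<open>finite F\<close>) auto
    finally show "(\<Sum>n\<in>F. (cmod (of_real (g n)))\<^sup>2) \<le> c\<^sup>2 * (2 / (1 - q\<^sup>2))" .
  qed
  then have coord_g: "coord (Abs_ell2 (\<lambda>n. of_real (g n))) = (\<lambda>n. of_real (g n))"
    by (simp add: Abs_ell2_inverse)
  define D where "D = (\<lambda>\<psi>. - laplacian \<psi> - \<mu> *\<^sub>R \<psi>)"
  \<comment> \<open>\<open>laplacian_resolvent\<close> is a plain function inverse, so its value at
    \<open>\<delta> m\<close> can be read off from a preimage once \<open>D\<close> is injective.
    Here \<open>|s| > 2\<close> beats the two shifts of norm 1.\<close>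
  have "inj D"
  proof (rule injI)
    fix \<phi> \<psi> assume eq: "D \<phi> = D \<psi>"
    define v where "v = \<phi> - \<psi>"
    have "s *\<^sub>R v = shift 1 v + shift (-1) v"
      using eq by (simp add: D_def v_def laplacian_shift s_def algebra_simps
          bounded_clinear_simps[OF bounded_clinear_shift] scaleR_2)
    then have "norm (s *\<^sub>R v) \<le> norm (shift 1 v) + norm (shift (-1) v)"
      by (simp only: norm_triangle_ineq)
    then have "(\<bar>s\<bar> - 2) * norm v \<le> 0" by (simp add: algebra_simps)
    then have "norm v \<le> 0" using s by (simp add: mult_le_0_iff)
    then show "\<phi> = \<psi>" by (simp add: v_def)
  qed
  have "resolvent_entry \<mu> n m = of_real (c * q ^ nat \<bar>n - m\<bar>)" for n m
  proof -
    let ?u = "shift (- m) (Abs_ell2 (\<lambda>n. of_real (g n)))"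
    have "D ?u = \<delta> m"
    proof (rule ell2_eqI)
      fix n
      have "coord (D ?u) n = of_real (s * g (n - m) - g (n - m + 1) - g (n - m - 1))"
        by (simp add: D_def laplacian.rep_eq coord_g s_def algebra_simps)
      then show "coord (D ?u) n = coord (\<delta> m) n" unfolding g_eq by (simp add: coord_delta)
    qed
    then have u: "laplacian_resolvent \<mu> (\<delta> m) = ?u"
      unfolding laplacian_resolvent_def D_def[symmetric] by (rule inv_f_eq[OF \<open>inj D\<close>])
    then show ?thesis
      unfolding resolvent_entry_def cinner_delta u coord_shift coord_g by (simp add: g_def)
  qed
  with q1 show thesis by (rule that)
qed

subsection \<open>The reduced chain operator\<close>

text \<open>One \<open>K\<close> for all \<open>b\<close>, all amplitudes \<open>D\<close> and all
  kernels: rows are sums over a lattice of spacing \<open>\<alpha>\<close>, columns over one of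
  spacing 1, and the bound in \<open>sum_exp_decay\<close> ignores the offset.\<close>

lemma schur_exp_decay:
  assumes "0 < \<alpha>" "0 < c"
  obtains K where "0 < K"
    "\<And>k D b. 0 \<le> D \<Longrightarrow>
      (\<And>n m. \<bar>k n m\<bar> \<le> D * exp (- c * \<bar>of_int n - \<alpha> * of_int m - b\<bar>)) \<Longrightarrow> schur k (D * K)"
proof -
  obtain K1 where K1: "0 < K1"
    "\<And>F t. finite F \<Longrightarrow> (\<Sum>m\<in>F. exp (- c * \<bar>t - \<alpha> * real_of_int m\<bar>)) \<le> K1"
    using sum_exp_decay[OF assms] by blast
  obtain K2 where K2: "0 < K2"
    "\<And>F t. finite F \<Longrightarrow> (\<Sum>m\<in>F. exp (- c * \<bar>t - 1 * real_of_int m\<bar>)) \<le> K2"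
    using sum_exp_decay[OF zero_less_one \<open>0 < c\<close>] by blast
  show thesis
  proof
    show "0 < max K1 K2" using K1 by simp
    fix k :: "int \<Rightarrow> int \<Rightarrow> real" and D b :: real
    assume D: "0 \<le> D" and k: "\<And>n m. \<bar>k n m\<bar> \<le> D * exp (- c * \<bar>of_int n - \<alpha> * of_int m - b\<bar>)"
    show "schur k (D * max K1 K2)"
      unfolding schur_def
    proof (intro allI impI conjI)
      fix F :: "int set" and n assume "finite F"
      have "\<bar>k n m\<bar> \<le> D * exp (- c * \<bar>(of_int n - b) - \<alpha> * of_int m\<bar>)" for m
      proof -
        have "\<bar>of_int n - \<alpha> * of_int m - b\<bar> = \<bar>(of_int n - b) - \<alpha> * of_int m\<bar>" by linarith
        then show ?thesis using k[of n m] by simp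
      qed
      then have "(\<Sum>m\<in>F. \<bar>k n m\<bar>) \<le> D * (\<Sum>m\<in>F. exp (- c * \<bar>(of_int n - b) - \<alpha> * of_int m\<bar>))"
        unfolding sum_distrib_left by (intro sum_mono)
      also have "\<dots> \<le> D * max K1 K2"
        using K1(2)[OF \<open>finite F\<close>, of "of_int n - b"] D by (intro mult_left_mono) auto
      finally show "(\<Sum>m\<in>F. \<bar>k n m\<bar>) \<le> D * max K1 K2" .
    next
      fix F :: "int set" and m assume "finite F"
      have "\<bar>k n m\<bar> \<le> D * exp (- c * \<bar>(\<alpha> * of_int m + b) - 1 * of_int n\<bar>)" for n
      proof -
        have "\<bar>of_int n - \<alpha> * of_int m - b\<bar> = \<bar>(\<alpha> * of_int m + b) - 1 * of_int n\<bar>" by linarith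
        then show ?thesis using k[of n m] by simp
      qed
      then have "(\<Sum>n\<in>F. \<bar>k n m\<bar>) \<le> D * (\<Sum>n\<in>F. exp (- c * \<bar>(\<alpha> * of_int m + b) - 1 * of_int n\<bar>))"
        unfolding sum_distrib_left by (intro sum_mono)
      also have "\<dots> \<le> D * max K1 K2"
        using K2(2)[OF \<open>finite F\<close>, of "\<alpha> * of_int m + b"] D by (intro mult_left_mono) auto
      finally show "(\<Sum>n\<in>F. \<bar>k n m\<bar>) \<le> D * max K1 K2" .
    qed
  qed
qed

lemma exp_decay_uniformly_continuous:
  fixes h :: "real \<Rightarrow> real"
  assumes h: "continuous_on UNIV h" and "0 < C" "0 < c" and "\<And>x. \<bar>h x\<bar> \<le> C * exp (- c * \<bar>x\<bar>)"
    and "0 < e"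
  obtains d where "0 < d" "\<And>x y. \<bar>x - y\<bar> < d \<Longrightarrow> \<bar>h x - h y\<bar> < e"
proof -
  \<comment> \<open>Chosen so that \<open>c R = 2 C / e\<close>; since \<open>exp u > u\<close>, the
    decay bound is below \<open>e / 2\<close> beyond \<open>R\<close>.\<close>
  define R where "R = 2 * C / e / c"
  have "0 \<le> R" using assms by (simp add: R_def)
  have small: "\<bar>h x\<bar> < e / 2" if "R < \<bar>x\<bar>" for x
  proof -
    have "2 * C / e = c * R" using \<open>0 < c\<close> by (simp add: R_def)
    also have "\<dots> < c * \<bar>x\<bar>" using that \<open>0 < c\<close> by simp
    also have "\<dots> < exp (c * \<bar>x\<bar>)" using exp_ge_add_one_self[of "c * \<bar>x\<bar>"] by linarith
    finally have "C * exp (- c * \<bar>x\<bar>) < e / 2"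
      using \<open>0 < e\<close> by (simp add: exp_minus field_simps)
    then show ?thesis using assms(4)[of x] by linarith
  qed
  have "uniformly_continuous_on {-R-1..R+1} h"
    by (rule compact_uniformly_continuous) (auto intro: continuous_on_subset[OF h])
  then obtain d where d: "0 < d"
    "\<And>x y. x \<in> {-R-1..R+1} \<Longrightarrow> y \<in> {-R-1..R+1} \<Longrightarrow> dist y x < d \<Longrightarrow> dist (h y) (h x) < e"
    using \<open>0 < e\<close> unfolding uniformly_continuous_on_def by metis
  show thesis
  proof
    show "0 < min d 1" using d by simp
    fix x y :: real assume xy: "\<bar>x - y\<bar> < min d 1"
    show "\<bar>h x - h y\<bar> < e"
    proof (cases "\<bar>x\<bar> \<le> R \<or> \<bar>y\<bar> \<le> R")
      case True
      then have "x \<in> {-R-1..R+1}" "y \<in> {-R-1..R+1}" using xy by auto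
      then show ?thesis using d(2)[of y x] xy by (simp add: dist_real_def)
    next
      case False
      then show ?thesis using small[of x] small[of y] by linarith
    qed
  qed
qed

text \<open>The coupling matrix from the chain of spacing \<open>\<alpha>\<close> to that of spacing
  1, displaced by \<open>b\<close>. For even \<open>h\<close> its transpose is the coupling in the
  other direction.\<close>

definition hop :: "real \<Rightarrow> (real \<Rightarrow> real) \<Rightarrow> real \<Rightarrow> int \<Rightarrow> int \<Rightarrow> real" where
  "hop \<alpha> h b n m = h (of_int n - \<alpha> * of_int m - b)"

lemma schur_hop:
  assumes "0 < \<alpha>" "exponentially_decaying h"
  obtains K where "\<And>b. schur (hop \<alpha> h b) K"
proof -
  obtain C c where C: "0 < C" "0 < c" "\<And>x. \<bar>h x\<bar> \<le> C * exp (- c * \<bar>x\<bar>)"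
    using assms(2) by (auto simp: exponentially_decaying_def)
  obtain K where K: "0 < K" "\<And>k D b. 0 \<le> D \<Longrightarrow>
      (\<And>n m. \<bar>k n m\<bar> \<le> D * exp (- c * \<bar>of_int n - \<alpha> * of_int m - b\<bar>)) \<Longrightarrow> schur k (D * K)"
    by (rule schur_exp_decay[OF assms(1) C(2)]) blast
  have "schur (hop \<alpha> h b) (C * K)" for b
    by (rule K(2)[where b = b]) (use C in \<open>auto simp: hop_def\<close>)
  then show thesis by (rule that)
qed

text \<open>
  The square root of the modulus of continuity is traded against half of the exponential decay.
\<close>

lemma schur_hop_diff:
  assumes "0 < \<alpha>" "exponentially_decaying h" "continuous_on UNIV h" "0 < e"
  obtains d where "0 < d" "\<And>b b'. \<bar>b - b'\<bar> < d \<Longrightarrow> schur (\<lambda>n m. hop \<alpha> h b n m - hop \<alpha> h b' n m) e"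
proof -
  obtain C c where C: "0 < C" "0 < c" "\<And>x. \<bar>h x\<bar> \<le> C * exp (- c * \<bar>x\<bar>)"
    using assms(2) by (auto simp: exponentially_decaying_def)
  obtain K where K: "0 < K" "\<And>k D b. 0 \<le> D \<Longrightarrow>
      (\<And>n m. \<bar>k n m\<bar> \<le> D * exp (- (c / 2) * \<bar>of_int n - \<alpha> * of_int m - b\<bar>)) \<Longrightarrow> schur k (D * K)"
    by (rule schur_exp_decay[OF assms(1) half_gt_zero[OF C(2)]]) blast
  \<comment> \<open>For \<open>|b - b'| < 1\<close> the two decay bounds add up to at most
    \<open>E exp (- c |u|)\<close>; the factor \<open>exp c\<close> pays for the
    displacement.\<close>
  define E where "E = C * (1 + exp c)"
  have "0 < E" using C by (simp add: E_def add_pos_pos)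
  \<comment> \<open>Solves \<open>sqrt (w E) = e / K\<close>: the geometric mean of the bounds
    \<open>w\<close> and \<open>E exp (- c |u|)\<close> then has Schur bound
    \<open>e\<close>.\<close>
  define w where "w = (e / K)\<^sup>2 / E"
  have "0 < w" using assms(4) K(1) \<open>0 < E\<close> by (simp add: w_def)
  then obtain d where d: "0 < d" "\<And>x y. \<bar>x - y\<bar> < d \<Longrightarrow> \<bar>h x - h y\<bar> < w"
    by (rule exp_decay_uniformly_continuous[OF assms(3) C]) blast
  show thesis
  proof
    show "0 < min d 1" using d by simp
    fix b b' :: real assume bb: "\<bar>b - b'\<bar> < min d 1"
    have "\<bar>hop \<alpha> h b n m - hop \<alpha> h b' n m\<bar>
        \<le> e / K * exp (- (c / 2) * \<bar>of_int n - \<alpha> * of_int m - b\<bar>)" for n m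
    proof (rule power2_le_imp_le)
      let ?u = "of_int n - \<alpha> * of_int m - b" and ?v = "of_int n - \<alpha> * of_int m - b'"
      have "\<bar>h ?u - h ?v\<bar> \<le> C * exp (- c * \<bar>?u\<bar>) + C * exp (- c * \<bar>?v\<bar>)"
        using C(3)[of ?u] C(3)[of ?v] by linarith
      also have "C * exp (- c * \<bar>?v\<bar>) \<le> C * exp (c + - c * \<bar>?u\<bar>)"
      proof -
        have "\<bar>?u\<bar> \<le> \<bar>?v\<bar> + 1" using bb by linarith
        then have "c * \<bar>?u\<bar> \<le> c * (\<bar>?v\<bar> + 1)" using C(2) by (intro mult_left_mono) auto
        then show ?thesis using C(1) by (simp add: algebra_simps)
      qed
      also have "C * exp (- c * \<bar>?u\<bar>) + C * exp (c + - c * \<bar>?u\<bar>) = E * exp (- c * \<bar>?u\<bar>)"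
        by (simp only: E_def exp_add distrib_left distrib_right mult_1_right mult.assoc)
      finally have le: "\<bar>h ?u - h ?v\<bar> \<le> E * exp (- c * \<bar>?u\<bar>)" by simp
      have "\<bar>h ?u - h ?v\<bar> < w" by (rule d(2)) (use bb in linarith)
      then have "\<bar>h ?u - h ?v\<bar>\<^sup>2 \<le> w * (E * exp (- c * \<bar>?u\<bar>))"
        unfolding power2_eq_square by (intro mult_mono le) (use \<open>0 < w\<close> in auto)
      also have "\<dots> = (e / K * exp (- (c / 2) * \<bar>?u\<bar>))\<^sup>2"
      proof -
        have "exp (- c * \<bar>?u\<bar>) = (exp (- (c / 2) * \<bar>?u\<bar>))\<^sup>2" by (simp flip: exp_double)
        then show ?thesis using \<open>0 < E\<close> by (simp only: w_def power_mult_distrib) simp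
      qed
      finally show "\<bar>hop \<alpha> h b n m - hop \<alpha> h b' n m\<bar>\<^sup>2
          \<le> (e / K * exp (- (c / 2) * \<bar>?u\<bar>))\<^sup>2" by (simp add: hop_def)
    qed (use assms(4) K(1) in simp)
    then have "schur (\<lambda>n m. hop \<alpha> h b n m - hop \<alpha> h b' n m) (e / K * K)"
      by (rule K(2)[rotated]) (use assms(4) K(1) in simp)
    then show "schur (\<lambda>n m. hop \<alpha> h b n m - hop \<alpha> h b' n m) e" using K(1) by simp
  qed
qed

text \<open>The interface through which the averaging argument sees \<open>H\<^sub>r\<close>.
  Continuity in \<open>b\<close> is strong continuity, which combines with the uniform bound
  \<open>M\<close> to give continuity of iterates.\<close>

locale covariant_family =
  fixes A :: "real \<Rightarrow> ell2 \<Rightarrow> ell2" and \<alpha> M :: real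
  assumes selfadj: "\<And>b. self_adjoint (A b)"
    and bound: "\<And>b \<psi>. norm (A b \<psi>) \<le> M * norm \<psi>"
    and M_pos: "0 < M"
    and strongly_continuous: "\<And>\<psi>. continuous_on UNIV (\<lambda>b. A b \<psi>)"
    and covariant: "\<And>k b \<psi>. shift k (A b \<psi>) = A (b - of_int k) (shift k \<psi>)"
    and periodic: "\<And>b. A (b + \<alpha>) = A b"
    and irrational: "\<alpha> \<notin> \<rat>" and period_pos: "0 < \<alpha>"

text \<open>Translating the chain of spacing 1 by an integer is absorbed by the offset
  \<open>b\<close> in both couplings. Relabelling the other chain by one site moves \<open>b\<close>
  by \<open>\<alpha>\<close> and cancels, as \<open>R\<close> commutes with shifts.\<close>

lemma covariant_family_H\<^sub>r:
  assumes \<theta>: "\<theta> < 1" "\<theta> \<notin> \<rat>" and \<mu>: "\<mu> \<notin> {0..4}"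
    and even: "\<And>\<eta>. h (- \<eta>) = h \<eta>" and h: "continuous_on UNIV h" "exponentially_decaying h"
  obtains M where "covariant_family (H\<^sub>r \<theta> \<mu> h) (1 - \<theta>) M"
proof -
  define \<alpha> where "\<alpha> = 1 - \<theta>"
  have \<alpha>: "0 < \<alpha>" using \<theta> by (simp add: \<alpha>_def)
  obtain K where K: "\<And>b. schur (hop \<alpha> h b) K" using schur_hop[OF \<alpha> h(2)] by blast
  obtain c q where q: "\<bar>q\<bar> < 1"
    and entry: "\<And>n m. resolvent_entry \<mu> n m = of_real (c * q ^ nat \<bar>n - m\<bar>)"
    using resolvent_entry_formula[OF \<mu>] by metis
  define G where "G n m = c * q ^ nat \<bar>n - m\<bar>" for n m :: int
  define K' where "K' = \<bar>c\<bar> * (2 / (1 - \<bar>q\<bar>))"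
  have G_sym: "G m n = G n m" for m n by (simp add: G_def abs_minus_commute)
  have row: "(\<Sum>n\<in>F. \<bar>G n m\<bar>) \<le> K'" if "finite F" for F m
  proof -
    have "(\<Sum>n\<in>F. \<bar>G n m\<bar>) = \<bar>c\<bar> * (\<Sum>n\<in>F. \<bar>q\<bar> ^ nat \<bar>n - m\<bar>)"
      by (simp add: G_def abs_mult power_abs sum_distrib_left)
    also have "\<dots> \<le> K'"
      unfolding K'_def by (intro mult_left_mono sum_geometric_int_shift q that) auto
    finally show ?thesis .
  qed
  have G: "schur G K'"
    unfolding schur_def using row by (simp add: G_sym[of _ "_ :: int"])
  have GT: "(\<lambda>n m. G m n) = G" by (intro ext) (rule G_sym)
  define B where "B b = kernel_op (hop \<alpha> h b)" for b
  define T where "T b = kernel_op (\<lambda>n m. hop \<alpha> h b m n)" for b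
  define R where "R = kernel_op G"
  note KT = schur_transpose[OF K]
  have bcl: "bounded_clinear (B b)" "bounded_clinear (T b)" "bounded_clinear R" for b
    by (auto simp: B_def T_def R_def intro: bounded_clinear_kernel_op K KT G)
  have le: "norm (B b \<psi>) \<le> K * norm \<psi>" "norm (T b \<psi>) \<le> K * norm \<psi>"
    "norm (R \<psi>) \<le> K' * norm \<psi>" for b \<psi>
    by (auto simp: B_def T_def R_def intro: norm_kernel_op K KT G)
  note K_nn = schur_nonneg[OF K] schur_nonneg[OF G]
  have adj: "inner (B b \<phi>) \<psi> = inner \<phi> (T b \<psi>)" "inner (T b \<phi>) \<psi> = inner \<phi> (B b \<psi>)"
    "inner (R \<phi>) \<psi> = inner \<phi> (R \<psi>)" for b \<phi> \<psi>
    unfolding B_def T_def R_def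
    by (rule inner_kernel_op[OF K] inner_kernel_op[OF KT] inner_kernel_op[OF G, unfolded GT])+
  \<comment> \<open>Evenness of \<open>h\<close> identifies the inner coupling with the transpose of
    the outer one; this is what makes the operator symmetric.\<close>
  have H: "H\<^sub>r \<theta> \<mu> h b \<psi> = - laplacian \<psi> - B b (R (T b \<psi>))" for b \<psi>
  proof -
    have 1: "h ((1 - \<theta>) * of_int n + b - of_int m) = hop \<alpha> h b m n" for n m
      using even[of "of_int m - \<alpha> * of_int n - b"] by (simp add: hop_def \<alpha>_def algebra_simps)
    have 2: "h (of_int n - (1 - \<theta>) * of_int m - b) = hop \<alpha> h b n m" for n m
      by (simp add: hop_def \<alpha>_def)
    have 3: "resolvent_entry \<mu> n m = of_real (G n m)" for n m by (simp add: entry G_def)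
    show ?thesis
      unfolding H\<^sub>r_def 1 2 3 coord_kernel_op[OF KT, symmetric] coord_kernel_op[OF G, symmetric]
        coord_kernel_op[OF K, symmetric] coord_uminus[symmetric] coord_diff[symmetric]
        coord_inverse B_def R_def T_def ..
  qed
  have lap: "norm (laplacian \<psi>) \<le> 4 * norm \<psi>" for \<psi>
  proof -
    have "norm (laplacian \<psi>) \<le> norm (shift 1 \<psi>) + norm (2 *\<^sub>R \<psi>) + norm (shift (-1) \<psi>)"
      unfolding laplacian_shift
      by (rule order_trans[OF norm_triangle_ineq add_right_mono[OF norm_triangle_ineq4]])
    then show ?thesis by simp
  qed
  define M where "M = 4 + K * (K' * K)"
  have "bounded_clinear (\<lambda>\<psi>. shift 1 \<psi> - of_real 2 *\<^sub>C \<psi> + shift (-1) \<psi>)"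
    by (intro bounded_clinear_intros bounded_clinear_shift)
  then have "bounded_clinear laplacian"
    unfolding scaleC_of_real laplacian_shift[symmetric] .
  then have H_bcl: "bounded_clinear (H\<^sub>r \<theta> \<mu> h b)" for b
    unfolding H[abs_def] by (intro bounded_clinear_intros bounded_clinear_compose[OF bcl(1)]
        bounded_clinear_compose[OF bcl(3)] bcl)
  show thesis
  proof (rule that, unfold_locales, unfold \<alpha>_def[symmetric])
    fix b
    have "inner (laplacian \<phi>) \<psi> = inner \<phi> (laplacian \<psi>)" for \<phi> \<psi>
      by (simp add: laplacian_shift inner_add_left inner_add_right inner_diff_left
          inner_diff_right inner_shift)
    then show "self_adjoint (H\<^sub>r \<theta> \<mu> h b)"
      by (simp add: self_adjoint_def H_bcl) (simp add: H inner_diff_left inner_diff_right adj)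
    show "H\<^sub>r \<theta> \<mu> h (b + \<alpha>) = H\<^sub>r \<theta> \<mu> h b"
    proof
      fix \<psi>
      have 1: "T (b + \<alpha>) \<psi> = shift 1 (T b \<psi>)"
        using kernel_op_shift[OF KT KT, where i = 1 and j = 0, of "b + \<alpha>" b \<psi>]
        by (simp add: T_def hop_def algebra_simps shift_zero)
      have 2: "R (shift 1 v) = shift 1 (R v)" for v
        using kernel_op_shift[OF G G, where i = 1 and j = 1, of v] by (simp add: R_def G_def)
      have 3: "B (b + \<alpha>) (shift 1 v) = B b v" for v
        using kernel_op_shift[OF K K, where i = 0 and j = 1, of "b + \<alpha>" b v]
        by (simp add: B_def hop_def algebra_simps shift_zero)
      show "H\<^sub>r \<theta> \<mu> h (b + \<alpha>) \<psi> = H\<^sub>r \<theta> \<mu> h b \<psi>" by (simp add: H 1 2 3)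
    qed
  next
    fix b \<psi>
    have "norm (B b (R (T b \<psi>))) \<le> K * (K' * (K * norm \<psi>))"
      by (rule order_trans[OF le(1)], intro mult_left_mono K_nn,
          rule order_trans[OF le(3)], intro mult_left_mono K_nn, rule le)
    then show "norm (H\<^sub>r \<theta> \<mu> h b \<psi>) \<le> M * norm \<psi>"
      using norm_triangle_ineq4[of "- laplacian \<psi>" "B b (R (T b \<psi>))"] lap[of \<psi>]
      by (simp add: H M_def algebra_simps)
  next
    show "0 < M" using K_nn by (simp add: M_def add_pos_nonneg)
  next
    fix k b \<psi>
    have 1: "shift k (B b v) = B (b - of_int k) v" for v
      using kernel_op_shift[OF K K, where i = k and j = 0, of "b - of_int k" b v]
      by (simp add: B_def hop_def algebra_simps shift_zero)
    have 2: "T b \<psi> = T (b - of_int k) (shift k \<psi>)"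
      using kernel_op_shift[OF KT KT, where i = 0 and j = k, of "b - of_int k" b \<psi>]
      by (simp add: T_def hop_def algebra_simps shift_zero)
    have "shift k (- laplacian \<psi>) = - laplacian (shift k \<psi>)"
      by (rule ell2_eqI) (simp add: laplacian.rep_eq algebra_simps)
    then show "shift k (H\<^sub>r \<theta> \<mu> h b \<psi>) = H\<^sub>r \<theta> \<mu> h (b - of_int k) (shift k \<psi>)"
      by (simp add: H bounded_clinear_simps[OF bounded_clinear_shift] 1 flip: 2)
  next
    fix \<psi>
    show "continuous_on UNIV (\<lambda>b. H\<^sub>r \<theta> \<mu> h b \<psi>)"
      unfolding continuous_on_iff
    proof (intro ballI allI impI)
      fix b e :: real assume "0 < e"
      \<comment> \<open>Each of the two coupling operators contributes
        \<open>K K' norm \<psi>\<close> times its own change; 1 is added so that \<open>N\<close> is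
        positive and the final bound strict.\<close>
      define N where "N = 2 * (K * (K' * norm \<psi>)) + 1"
      have "0 < N" using K_nn by (simp add: N_def add_nonneg_pos)
      then have "0 < e / N" using \<open>0 < e\<close> by simp
      then obtain d where d: "0 < d" "\<And>b b'. \<bar>b - b'\<bar> < d \<Longrightarrow>
          schur (\<lambda>n m. hop \<alpha> h b n m - hop \<alpha> h b' n m) (e / N)"
        by (rule schur_hop_diff[OF \<alpha> h(2,1)]) blast
      have "dist (H\<^sub>r \<theta> \<mu> h b' \<psi>) (H\<^sub>r \<theta> \<mu> h b \<psi>) < e" if "dist b' b < d" for b'
      proof -
        have s: "schur (\<lambda>n m. hop \<alpha> h b n m - hop \<alpha> h b' n m) (e / N)"
          by (rule d(2)) (use that in \<open>simp add: dist_real_def abs_minus_commute\<close>)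
        have Bd: "norm (B b v - B b' v) \<le> e / N * norm v" for v
          unfolding B_def kernel_op_diff[OF K K s] by (rule norm_kernel_op[OF s])
        have Td: "norm (T b v - T b' v) \<le> e / N * norm v" for v
          unfolding T_def kernel_op_diff[OF KT KT schur_transpose[OF s]]
          by (rule norm_kernel_op[OF schur_transpose[OF s]])
        have "H\<^sub>r \<theta> \<mu> h b' \<psi> - H\<^sub>r \<theta> \<mu> h b \<psi>
            = (B b (R (T b \<psi>)) - B b' (R (T b \<psi>))) + B b' (R (T b \<psi> - T b' \<psi>))"
          by (simp add: H bounded_clinear_simps[OF bcl(1)] bounded_clinear_simps[OF bcl(3)])
        also have "norm \<dots> \<le> e / N * (K' * (K * norm \<psi>)) + K * (K' * (e / N * norm \<psi>))"
        proof (rule order_trans[OF norm_triangle_ineq add_mono])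
          have "norm (R (T b \<psi>)) \<le> K' * (K * norm \<psi>)"
            by (rule order_trans[OF le(3)]) (intro mult_left_mono K_nn le)
          then show "norm (B b (R (T b \<psi>)) - B b' (R (T b \<psi>))) \<le> e / N * (K' * (K * norm \<psi>))"
            using \<open>0 < e\<close> \<open>0 < N\<close> by (intro order_trans[OF Bd] mult_left_mono) auto
          show "norm (B b' (R (T b \<psi> - T b' \<psi>))) \<le> K * (K' * (e / N * norm \<psi>))"
            by (rule order_trans[OF le(1)], intro mult_left_mono K_nn,
                rule order_trans[OF le(3)], intro mult_left_mono K_nn Td)
        qed
        also have "\<dots> = e * ((N - 1) / N)" by (simp add: N_def)
        also have "\<dots> < e" using \<open>0 < e\<close> \<open>0 < N\<close> by (simp add: field_simps)
        finally show ?thesis by (simp add: dist_norm)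
      qed
      then show "\<exists>d>0. \<forall>b'\<in>UNIV. dist b' b < d \<longrightarrow> dist (H\<^sub>r \<theta> \<mu> h b' \<psi>) (H\<^sub>r \<theta> \<mu> h b \<psi>) < e"
        using d(1) by blast
    qed
  next
    show "\<alpha> \<notin> \<rat>" using Rats_diff[OF Rats_1, of \<alpha>] \<theta>(2) by (auto simp: \<alpha>_def)
    show "0 < \<alpha>" by (rule \<alpha>)
  qed
qed

subsection \<open>Functional calculus as a functional of the symbol\<close>

text \<open>Identification principle: \<open>g\<close> and \<open>v\<close> are tested on the same
  polynomial, chosen anew for each \<open>e\<close>, which ties \<open>v\<close> to
  \<open>cfc g A \<psi>\<close>. The factor \<open>K\<close> lets each application collect its own
  constants.\<close>

lemma cfc_eqI:
  assumes A: "self_adjoint A" "\<And>\<psi>. norm (A \<psi>) \<le> M * norm \<psi>" "continuous_on {-M..M} g"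
    and approx: "\<And>e. 0 < e \<Longrightarrow> \<exists>p. (\<forall>x\<in>{-M..M}. cmod (poly p (of_real x) - g x) \<le> K * e) \<and>
      norm (poly_op p A \<psi> - v) \<le> K * e"
  shows "cfc g A \<psi> = v"
proof (rule ccontr)
  assume "cfc g A \<psi> \<noteq> v"
  then have pos: "0 < norm (cfc g A \<psi> - v)" by simp
  define c where "c = K * (norm \<psi> + 1)"
  have le: "norm (cfc g A \<psi> - v) \<le> c * e" if "0 < e" for e
  proof -
    obtain p where p: "\<And>x. x \<in> {-M..M} \<Longrightarrow> cmod (poly p (of_real x) - g x) \<le> K * e"
      "norm (poly_op p A \<psi> - v) \<le> K * e"
      using approx[OF \<open>0 < e\<close>] by blast
    have "cfc g A \<psi> - v = (poly_op p A \<psi> - v) - (poly_op p A \<psi> - cfc g A \<psi>)" by simp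
    also have "norm \<dots> \<le> K * e + K * e * norm \<psi>"
      by (rule order_trans[OF norm_triangle_ineq4]) (intro add_mono p cfc_approx[OF A])
    finally show ?thesis by (simp add: c_def algebra_simps)
  qed
  have "norm (cfc g A \<psi> - v) \<le> c" using le[of 1] by simp
  with pos have c: "0 < c" by (rule less_le_trans)
  \<comment> \<open>With \<open>e\<close> equal to the norm of the difference over
    \<open>2 c\<close>, the estimate says that a positive number is at most its half.\<close>
  then show False
    using le[of "norm (cfc g A \<psi> - v) / (2 * c)"] pos by simp
qed

lemma Weierstrass_le:
  fixes g :: "real \<Rightarrow> complex"
  assumes "continuous_on UNIV g" "0 < e"
  obtains p :: "complex poly" where "\<And>x. x \<in> {a..b} \<Longrightarrow> cmod (poly p (of_real x) - g x) \<le> e"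
  using Weierstrass_complex_poly[OF continuous_on_subset[OF assms(1)] assms(2), of a b]
  by (metis less_imp_le subset_UNIV)

context
  fixes A :: "ell2 \<Rightarrow> ell2" and M :: real
  assumes sa: "self_adjoint A" and bound: "\<And>\<psi>. norm (A \<psi>) \<le> M * norm \<psi>"
begin

text \<open>The zero polynomial approximates \<open>g\<close> within
  \<open>\<epsilon>\<close>.\<close>

lemma cfc_norm_le:
  assumes "continuous_on UNIV g" "\<And>x. x \<in> {-M..M} \<Longrightarrow> cmod (g x) \<le> \<epsilon>"
  shows "norm (cfc g A \<psi>) \<le> \<epsilon> * norm \<psi>"
  using cfc_approx[OF sa bound continuous_on_subset[OF assms(1)], of 0 \<epsilon> \<psi>] assms(2) by simp

lemma cfc_add:
  assumes f: "continuous_on UNIV f" and g: "continuous_on UNIV g"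
  shows "cfc (\<lambda>x. f x + g x) A \<psi> = cfc f A \<psi> + cfc g A \<psi>"
proof (rule cfc_eqI[OF sa bound])
  show "continuous_on {-M..M} (\<lambda>x. f x + g x)"
    by (intro continuous_intros continuous_on_subset[OF f] continuous_on_subset[OF g]) auto
  fix e :: real assume "0 < e"
  obtain p :: "complex poly" where p: "\<And>x. x \<in> {-M..M} \<Longrightarrow> cmod (poly p (of_real x) - f x) \<le> e"
    using Weierstrass_le[OF f \<open>0 < e\<close>] by metis
  obtain q :: "complex poly" where q: "\<And>x. x \<in> {-M..M} \<Longrightarrow> cmod (poly q (of_real x) - g x) \<le> e"
    using Weierstrass_le[OF g \<open>0 < e\<close>] by metis
  have "cmod (poly (p + q) (of_real x) - (f x + g x)) \<le> 2 * e" if "x \<in> {-M..M}" for x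
    using norm_triangle_ineq[of "poly p (of_real x) - f x" "poly q (of_real x) - g x"] p[OF that] q[OF that]
    by (simp add: add_diff_add)
  moreover have "2 * e \<le> (2 + 2 * norm \<psi>) * e" using \<open>0 < e\<close> by (simp add: algebra_simps)
  moreover have "norm (poly_op (p + q) A \<psi> - (cfc f A \<psi> + cfc g A \<psi>)) \<le> e * norm \<psi> + e * norm \<psi>"
    unfolding poly_op_add add_diff_add
    by (rule order_trans[OF norm_triangle_ineq])
      (intro add_mono cfc_approx[OF sa bound] continuous_on_subset[OF f] continuous_on_subset[OF g] p q, auto)
  moreover have "e * norm \<psi> + e * norm \<psi> \<le> (2 + 2 * norm \<psi>) * e" using \<open>0 < e\<close> by (simp add: algebra_simps)
  ultimately show "\<exists>p. (\<forall>x\<in>{-M..M}. cmod (poly p (of_real x) - (f x + g x)) \<le> (2 + 2 * norm \<psi>) * e) \<and>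
      norm (poly_op p A \<psi> - (cfc f A \<psi> + cfc g A \<psi>)) \<le> (2 + 2 * norm \<psi>) * e"
    by (intro exI[of _ "p + q"]) (meson order_trans)
qed

lemma cfc_scale:
  assumes f: "continuous_on UNIV f"
  shows "cfc (\<lambda>x. c * f x) A \<psi> = c *\<^sub>C cfc f A \<psi>"
proof (rule cfc_eqI[OF sa bound])
  show "continuous_on {-M..M} (\<lambda>x. c * f x)"
    by (intro continuous_intros continuous_on_subset[OF f]) auto
  fix e :: real assume "0 < e"
  obtain p :: "complex poly" where p: "\<And>x. x \<in> {-M..M} \<Longrightarrow> cmod (poly p (of_real x) - f x) \<le> e"
    using Weierstrass_le[OF f \<open>0 < e\<close>] by metis
  have "cmod (poly (smult c p) (of_real x) - c * f x) \<le> cmod c * e" if "x \<in> {-M..M}" for x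
    using p[OF that] by (simp add: norm_mult mult_left_mono flip: right_diff_distrib)
  moreover have "norm (poly_op (smult c p) A \<psi> - c *\<^sub>C cfc f A \<psi>) \<le> cmod c * (e * norm \<psi>)"
    unfolding poly_op_smult[OF self_adjoint_bounded[OF sa]] scaleC_diff_right[symmetric] norm_scaleC
    by (intro mult_left_mono cfc_approx[OF sa bound] continuous_on_subset[OF f] p) auto
  moreover have "cmod c * e \<le> cmod c * (1 + norm \<psi>) * e" "cmod c * (e * norm \<psi>) \<le> cmod c * (1 + norm \<psi>) * e"
    using \<open>0 < e\<close> by (simp_all add: algebra_simps)
  ultimately show "\<exists>p. (\<forall>x\<in>{-M..M}. cmod (poly p (of_real x) - c * f x) \<le> cmod c * (1 + norm \<psi>) * e) \<and>
      norm (poly_op p A \<psi> - c *\<^sub>C cfc f A \<psi>) \<le> cmod c * (1 + norm \<psi>) * e"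
    by (intro exI[of _ "smult c p"]) (meson order_trans)
qed

lemma cfc_one: "cfc (\<lambda>_. 1) A \<psi> = \<psi>"
  by (rule cfc_eqI[OF sa bound, where K = 1]) (auto intro!: exI[of _ "[:1:]"] simp: poly_op_const)

end

lemma bounded_linear_coord: "bounded_linear (\<lambda>\<psi>. coord \<psi> n)"
  by (rule bounded_linear_intro[where K = 1])
    (simp_all add: norm_coord_le scaleR_conv_of_real)

subsection \<open>Truncation\<close>

lemma coord_restrict [simp]: "coord (restrict_ell2 S \<psi>) n = indicator S n * coord \<psi> n"
  by (simp add: restrict_ell2.rep_eq)

lemma norm_restrict_mono:
  assumes "S \<subseteq> T"
  shows "norm (restrict_ell2 S \<psi>) \<le> norm (restrict_ell2 T \<psi>)"
proof (rule norm_ell2_le)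
  fix F :: "int set" assume "finite F"
  have "(\<Sum>n\<in>F. (cmod (coord (restrict_ell2 S \<psi>) n))\<^sup>2) \<le> (\<Sum>n\<in>F. (cmod (coord (restrict_ell2 T \<psi>) n))\<^sup>2)"
    using assms by (intro sum_mono) (auto simp: indicator_def)
  also have "\<dots> \<le> (norm (restrict_ell2 T \<psi>))\<^sup>2" using \<open>finite F\<close> by (rule sum_coord_le_norm)
  finally show "(\<Sum>n\<in>F. (cmod (coord (restrict_ell2 S \<psi>) n))\<^sup>2) \<le> (norm (restrict_ell2 T \<psi>))\<^sup>2" .
qed simp

lemma norm_restrict_le: "norm (restrict_ell2 S \<psi>) \<le> norm \<psi>"
proof -
  have "restrict_ell2 UNIV \<psi> = \<psi>" by (rule ell2_eqI) simp
  then show ?thesis using norm_restrict_mono[of S UNIV \<psi>] by simp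
qed

lemma bounded_clinear_restrict: "bounded_clinear (restrict_ell2 S)"
  by (rule bounded_clinearI[where K = 1])
    (auto intro!: ell2_eqI simp: norm_restrict_le distrib_left)

lemmas restrict_simps = bounded_clinear_simps[OF bounded_clinear_restrict]

lemma inner_restrict: "inner (restrict_ell2 S \<phi>) \<psi> = inner \<phi> (restrict_ell2 S \<psi>)"
  unfolding inner_ell2_def by (rule infsum_cong) (simp add: indicator_def)

lemma restrict_compl: "\<psi> - restrict_ell2 S \<psi> = restrict_ell2 (- S) \<psi>"
  by (rule ell2_eqI) (simp add: indicator_def)

lemma shift_restrict: "shift k (restrict_ell2 S \<psi>) = restrict_ell2 {n. n + k \<in> S} (shift k \<psi>)"
  by (rule ell2_eqI) (simp add: indicator_def)

lemma \<Lambda>_absorbs_finite: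
  assumes "finite F"
  obtains R where "F \<subseteq> \<Lambda> R"
proof
  show "F \<subseteq> \<Lambda> (nat (Max (insert 0 (abs ` F))))"
  proof
    fix x assume "x \<in> F"
    then have "\<bar>x\<bar> \<le> Max (insert 0 (abs ` F))" using assms by (intro Max_ge) auto
    then show "x \<in> \<Lambda> (nat (Max (insert 0 (abs ` F))))" by (auto simp: \<Lambda>_def)
  qed
qed

lemma \<Lambda>_mono: "R \<le> S \<Longrightarrow> \<Lambda> R \<subseteq> \<Lambda> S"
  by (auto simp: \<Lambda>_def)

lemma finite_\<Lambda>: "finite (\<Lambda> L)"
  by (simp add: \<Lambda>_def)

lemma card_\<Lambda>: "card (\<Lambda> L) = 2 * L + 1"
  by (simp add: \<Lambda>_def)

lemma tail_small:
  assumes "0 < e"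
  obtains R where "norm (restrict_ell2 (- \<Lambda> R) \<psi>) \<le> e"
proof -
  have "(sum (\<lambda>n. (cmod (coord \<psi> n))\<^sup>2) \<longlongrightarrow> (norm \<psi>)\<^sup>2) (finite_subsets_at_top UNIV)"
    unfolding norm_ell2_squared by (rule infsum_tendsto[OF square_summable_coord])
  then have "\<forall>\<^sub>F F in finite_subsets_at_top UNIV. (norm \<psi>)\<^sup>2 - e\<^sup>2 < (\<Sum>n\<in>F. (cmod (coord \<psi> n))\<^sup>2)"
    using assms by (intro order_tendstoD) auto
  then obtain E where E: "finite E" "(norm \<psi>)\<^sup>2 - e\<^sup>2 < (\<Sum>n\<in>E. (cmod (coord \<psi> n))\<^sup>2)"
    unfolding eventually_finite_subsets_at_top by blast
  obtain R where R: "E \<subseteq> \<Lambda> R" using \<Lambda>_absorbs_finite[OF E(1)] by blast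
  have "norm (restrict_ell2 (- \<Lambda> R) \<psi>) \<le> e"
  proof (rule norm_ell2_le)
    fix F :: "int set" assume "finite F"
    have "(\<Sum>n\<in>F. (cmod (coord (restrict_ell2 (- \<Lambda> R) \<psi>) n))\<^sup>2) = (\<Sum>n\<in>F - \<Lambda> R. (cmod (coord \<psi> n))\<^sup>2)"
      by (rule sum.mono_neutral_cong_right) (use \<open>finite F\<close> in \<open>auto simp: indicator_def\<close>)
    also have "\<dots> + (\<Sum>n\<in>E. (cmod (coord \<psi> n))\<^sup>2) = (\<Sum>n\<in>(F - \<Lambda> R) \<union> E. (cmod (coord \<psi> n))\<^sup>2)"
      by (rule sum.union_disjoint[symmetric]) (use \<open>finite F\<close> E(1) R in auto)
    also have "\<dots> \<le> (norm \<psi>)\<^sup>2" by (rule sum_coord_le_norm) (use \<open>finite F\<close> E(1) in auto)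
    finally show "(\<Sum>n\<in>F. (cmod (coord (restrict_ell2 (- \<Lambda> R) \<psi>) n))\<^sup>2) \<le> e\<^sup>2"
      using E(2) by simp
  qed (use assms in simp)
  then show thesis by (rule that)
qed

text \<open>The finitely many centres of an \<open>e / 2\<close>-net have a common radius
  \<open>R\<close>, and restriction does not increase the distance to the net.\<close>

lemma compact_tail_small:
  assumes "compact S" "0 < e"
  obtains R where "\<And>\<psi>. \<psi> \<in> S \<Longrightarrow> norm (restrict_ell2 (- \<Lambda> R) \<psi>) \<le> e"
proof -
  obtain N where N: "finite N" "S \<subseteq> (\<Union>\<phi>\<in>N. ball \<phi> (e / 2))"
    using assms compact_eq_totally_bounded[of S] by (meson half_gt_zero)
  have "\<exists>R. norm (restrict_ell2 (- \<Lambda> R) \<phi>) \<le> e / 2" for \<phi>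
    using tail_small[OF half_gt_zero[OF assms(2)], of \<phi>] by blast
  then obtain r where r: "\<And>\<phi>. norm (restrict_ell2 (- \<Lambda> (r \<phi>)) \<phi>) \<le> e / 2" by metis
  define R where "R = Max (insert 0 (r ` N))"
  show thesis
  proof
    fix \<psi> assume "\<psi> \<in> S"
    then obtain \<phi> where \<phi>: "\<phi> \<in> N" "norm (\<psi> - \<phi>) < e / 2"
      using N(2) by (auto simp: dist_norm norm_minus_commute)
    have "r \<phi> \<le> R" using \<phi>(1) N(1) by (simp add: R_def)
    then have "norm (restrict_ell2 (- \<Lambda> R) \<phi>) \<le> e / 2"
      using norm_restrict_mono[of "- \<Lambda> R" "- \<Lambda> (r \<phi>)" \<phi>] \<Lambda>_mono r[of \<phi>] by fastforce
    moreover have "norm (restrict_ell2 (- \<Lambda> R) (\<psi> - \<phi>)) \<le> e / 2"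
      using norm_restrict_le[of "- \<Lambda> R" "\<psi> - \<phi>"] \<phi>(2) by linarith
    moreover have "restrict_ell2 (- \<Lambda> R) \<psi> = restrict_ell2 (- \<Lambda> R) (\<psi> - \<phi>) + restrict_ell2 (- \<Lambda> R) \<phi>"
      by (simp add: restrict_simps)
    ultimately show "norm (restrict_ell2 (- \<Lambda> R) \<psi>) \<le> e"
      using norm_triangle_ineq[of "restrict_ell2 (- \<Lambda> R) (\<psi> - \<phi>)" "restrict_ell2 (- \<Lambda> R) \<phi>"] by simp
  qed
qed

section \<open>Averages over the boxes\<close>

definition avg :: "nat \<Rightarrow> (int \<Rightarrow> 'a :: real_normed_field) \<Rightarrow> 'a" where
  "avg L f = (\<Sum>x\<in>\<Lambda> L. f x) / of_nat (card (\<Lambda> L))"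

lemma null_sequence_squeeze:
  fixes f g :: "nat \<Rightarrow> real"
  assumes "\<And>n. f n \<le> g n" "g \<longlonglongrightarrow> 0" "\<And>n. 0 \<le> f n"
  shows "f \<longlonglongrightarrow> 0"
  by (rule tendsto_sandwich[of "\<lambda>_. 0" f _ g]) (auto simp: assms)

lemma avg_add: "avg L (\<lambda>x. f x + g x) = avg L f + avg L g"
  by (simp add: avg_def sum.distrib add_divide_distrib)

lemma avg_diff: "avg L (\<lambda>x. f x - g x) = avg L f - avg L g"
  by (simp add: avg_def sum_subtractf diff_divide_distrib)

lemma avg_mult: "avg L (\<lambda>x. c * f x) = c * avg L f"
  by (simp add: avg_def flip: sum_distrib_left)

lemma avg_const: "avg L (\<lambda>x. c) = c"
  by (simp only: avg_def sum_constant card_\<Lambda>) (metis nonzero_mult_div_cancel_left of_nat_eq_0_iff add_is_0 one_neq_zero)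

lemma avg_sum: "avg L (\<lambda>x. \<Sum>i\<in>I. f i x) = (\<Sum>i\<in>I. avg L (f i))"
  unfolding avg_def by (subst sum.swap) (rule sum_divide_distrib)

lemma avg_mono:
  fixes f g :: "int \<Rightarrow> real"
  shows "(\<And>x. x \<in> \<Lambda> L \<Longrightarrow> f x \<le> g x) \<Longrightarrow> avg L f \<le> avg L g"
  unfolding avg_def by (intro divide_right_mono sum_mono) auto

lemma norm_avg_le: "norm (avg L f) \<le> avg L (\<lambda>x. norm (f x))"
  unfolding avg_def norm_divide norm_of_nat by (intro divide_right_mono norm_sum) auto

section \<open>Covariant families: continuity, truncation error and density of states\<close>

context covariant_family
begin

lemma bcl: "bounded_clinear (A b)"
  by (rule self_adjoint_bounded[OF selfadj])

lemma periodic_int: "A (b + of_int k * \<alpha>) = A b"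
  by (rule periodic_of_int[of A, OF periodic])

text \<open>Split \<open>A(b) v(b)\<close> as \<open>A(b) (v(b) - v(b0)) + A(b) v(b0)\<close>: the
  uniform norm bound controls the first term, strong continuity the second.\<close>

lemma iterate_continuous: "continuous_on UNIV (\<lambda>b. (A b ^^ i) \<psi>)"
proof (induction i)
  case (Suc i)
  show ?case
    unfolding continuous_on_def
  proof (intro ballI)
    fix b0 :: real
    have IH: "((\<lambda>b. (A b ^^ i) \<psi>) \<longlongrightarrow> (A b0 ^^ i) \<psi>) (at b0)"
      using Suc by (auto simp: continuous_on_def)
    have "((\<lambda>b. A b ((A b ^^ i) \<psi> - (A b0 ^^ i) \<psi>)) \<longlongrightarrow> 0) (at b0)"
    proof (rule Lim_null_comparison)
      show "\<forall>\<^sub>F b in at b0. norm (A b ((A b ^^ i) \<psi> - (A b0 ^^ i) \<psi>)) \<le> M * norm ((A b ^^ i) \<psi> - (A b0 ^^ i) \<psi>)"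
        by (intro always_eventually allI bound)
      show "((\<lambda>b. M * norm ((A b ^^ i) \<psi> - (A b0 ^^ i) \<psi>)) \<longlongrightarrow> 0) (at b0)"
        using tendsto_mult_right_zero[OF tendsto_norm_zero[OF LIM_zero[OF IH]]] .
    qed
    moreover have "((\<lambda>b. A b ((A b0 ^^ i) \<psi>)) \<longlongrightarrow> A b0 ((A b0 ^^ i) \<psi>)) (at b0)"
      using strongly_continuous[of "(A b0 ^^ i) \<psi>"] by (auto simp: continuous_on_def)
    ultimately have "((\<lambda>b. A b ((A b ^^ i) \<psi> - (A b0 ^^ i) \<psi>) + A b ((A b0 ^^ i) \<psi>))
        \<longlongrightarrow> 0 + A b0 ((A b0 ^^ i) \<psi>)) (at b0)"
      by (rule tendsto_add)
    then show "((\<lambda>b. (A b ^^ Suc i) \<psi>) \<longlongrightarrow> (A b0 ^^ Suc i) \<psi>) (at b0 within UNIV)"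
      by (simp add: bounded_clinear_simps[OF bcl])
  qed
qed simp

lemma iterate_norm: "norm ((A b ^^ i) \<psi>) \<le> M ^ i * norm \<psi>"
proof (induction i)
  case (Suc i)
  have "norm (A b ((A b ^^ i) \<psi>)) \<le> M * (M ^ i * norm \<psi>)"
    using Suc M_pos by (intro order_trans[OF bound] mult_left_mono) auto
  then show ?case by simp
qed simp

lemma iterate_covariant: "shift k ((A b ^^ i) \<psi>) = (A (b - of_int k) ^^ i) (shift k \<psi>)"
  by (induction i) (simp_all add: covariant)

lemma poly_continuous: "continuous_on UNIV (\<lambda>b. poly_op p (A b) \<psi>)"
  unfolding poly_op_def
  by (intro continuous_intros bounded_linear.continuous_on[OF bounded_clinear_linear[OF bounded_clinear_const_scale]]
      iterate_continuous)

lemma poly_covariant: "shift k (poly_op p (A b) \<psi>) = poly_op p (A (b - of_int k)) (shift k \<psi>)"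
  unfolding poly_op_def
  by (simp add: linear_sum[OF bounded_linear.linear[OF bounded_clinear_linear[OF bounded_clinear_shift]]]
      bounded_clinear_scale[OF bounded_clinear_shift] iterate_covariant)

text \<open>Polynomials of \<open>A\<close> intertwine with shifts, and one polynomial approximates
  \<open>g\<close> for both \<open>b\<close> and \<open>b - x\<close>; \<open>cfc_eqI\<close>
  carries the relation over to \<open>g\<close>.\<close>

lemma cfc_covariant:
  assumes g: "continuous_on UNIV g"
  shows "coord (cfc g (A b) (\<delta> x)) x = coord (cfc g (A (b - of_int x)) (\<delta> 0)) 0"
proof -
  note gM = continuous_on_subset[OF g subset_UNIV]
  have "cfc g (A (b - of_int x)) (\<delta> 0) = shift x (cfc g (A b) (\<delta> x))"
  proof (rule cfc_eqI[OF selfadj bound gM, where K = 1])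
    fix e :: real assume "0 < e"
    obtain p :: "complex poly" where p: "\<And>x. x \<in> {-M..M} \<Longrightarrow> cmod (poly p (of_real x) - g x) \<le> e"
      using Weierstrass_le[OF g \<open>0 < e\<close>] by metis
    have "poly_op p (A (b - of_int x)) (\<delta> 0) - shift x (cfc g (A b) (\<delta> x))
        = shift x (poly_op p (A b) (\<delta> x) - cfc g (A b) (\<delta> x))"
      by (simp add: poly_covariant shift_delta bounded_clinear_simps[OF bounded_clinear_shift])
    moreover have "norm (poly_op p (A b) (\<delta> x) - cfc g (A b) (\<delta> x)) \<le> e * 1"
      using \<open>0 < e\<close> norm_delta_le
      by (intro order_trans[OF cfc_approx[OF selfadj bound gM p]] mult_left_mono) auto
    ultimately show "\<exists>p. (\<forall>x\<in>{-M..M}. cmod (poly p (of_real x) - g x) \<le> 1 * e) \<and>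
        norm (poly_op p (A (b - of_int x)) (\<delta> 0) - shift x (cfc g (A b) (\<delta> x))) \<le> 1 * e"
      using p by (intro exI[of _ p]) simp
  qed
  then show ?thesis by simp
qed

text \<open>A uniform limit of the continuous functions obtained from polynomials: the error
  \<open>1 / (k + 1)\<close> from \<open>cfc_approx\<close> does not depend on
  \<open>b\<close>.\<close>

lemma cfc_continuous:
  assumes g: "continuous_on UNIV g"
  shows "continuous_on UNIV (\<lambda>b. coord (cfc g (A b) (\<delta> 0)) 0)"
proof -
  note gM = continuous_on_subset[OF g subset_UNIV]
  have "\<exists>p :: complex poly. \<forall>x\<in>{-M..M}. cmod (poly p (of_real x) - g x) \<le> 1 / real (Suc k)" for k
    using Weierstrass_le[OF g, of "1 / real (Suc k)" "- M" M] by (metis of_nat_0_less_iff zero_less_Suc zero_less_divide_1_iff)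
  then obtain P :: "nat \<Rightarrow> complex poly" where
    P: "\<And>k x. x \<in> {-M..M} \<Longrightarrow> cmod (poly (P k) (of_real x) - g x) \<le> 1 / real (Suc k)"
    by metis
  show ?thesis
  proof (rule uniform_limit_theorem)
    show "\<forall>\<^sub>F k in sequentially. continuous_on UNIV (\<lambda>b. coord (poly_op (P k) (A b) (\<delta> 0)) 0)"
      by (intro always_eventually allI bounded_linear.continuous_on[OF bounded_linear_coord] poly_continuous)
    show "uniform_limit UNIV (\<lambda>k b. coord (poly_op (P k) (A b) (\<delta> 0)) 0)
        (\<lambda>b. coord (cfc g (A b) (\<delta> 0)) 0) sequentially"
    proof (rule uniform_limitI)
      fix e :: real assume "0 < e"
      have "(\<lambda>k. 1 / real (Suc k)) \<longlonglongrightarrow> 0"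
        using LIMSEQ_inverse_real_of_nat by (simp add: inverse_eq_divide)
      then have "\<forall>\<^sub>F k in sequentially. 1 / real (Suc k) < e" using \<open>0 < e\<close> by (rule order_tendstoD(2))
      then show "\<forall>\<^sub>F k in sequentially. \<forall>b\<in>UNIV.
          dist (coord (poly_op (P k) (A b) (\<delta> 0)) 0) (coord (cfc g (A b) (\<delta> 0)) 0) < e"
      proof eventually_elim
        case (elim k)
        show ?case
        proof
          fix b
          have "dist (coord (poly_op (P k) (A b) (\<delta> 0)) 0) (coord (cfc g (A b) (\<delta> 0)) 0)
              \<le> norm (poly_op (P k) (A b) (\<delta> 0) - cfc g (A b) (\<delta> 0))"
            unfolding dist_norm coord_diff[symmetric] by (rule norm_coord_le)
          also have "\<dots> \<le> 1 / real (Suc k) * norm (\<delta> 0)" by (rule cfc_approx[OF selfadj bound gM P])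
          also have "\<dots> \<le> 1 / real (Suc k) * 1" by (intro mult_left_mono norm_delta_le) simp
          finally show "dist (coord (poly_op (P k) (A b) (\<delta> 0)) 0) (coord (cfc g (A b) (\<delta> 0)) 0) < e"
            using elim by simp
        qed
      qed
    qed
  qed simp
qed

lemma uniform_tail:
  assumes "0 < e"
  obtains R where "\<And>b. norm (restrict_ell2 (- \<Lambda> R) ((A b ^^ i) (\<delta> 0))) \<le> e"
proof -
  have "compact ((\<lambda>b. (A b ^^ i) (\<delta> 0)) ` {0..\<alpha>})"
    by (intro compact_continuous_image continuous_on_subset[OF iterate_continuous]) auto
  then obtain R where R: "\<And>\<psi>. \<psi> \<in> (\<lambda>b. (A b ^^ i) (\<delta> 0)) ` {0..\<alpha>} \<Longrightarrow> norm (restrict_ell2 (- \<Lambda> R) \<psi>) \<le> e"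
    using compact_tail_small[OF _ assms] by blast
  show thesis
  proof
    fix b
    obtain k :: int where "0 \<le> b + of_int k * \<alpha>" "b + of_int k * \<alpha> < \<alpha>"
      using periodic_reduce[OF period_pos] by blast
    then have "(A (b + of_int k * \<alpha>) ^^ i) (\<delta> 0) \<in> (\<lambda>b. (A b ^^ i) (\<delta> 0)) ` {0..\<alpha>}" by (intro imageI) simp
    then show "norm (restrict_ell2 (- \<Lambda> R) ((A b ^^ i) (\<delta> 0))) \<le> e"
      using R by (simp add: periodic_int)
  qed
qed

text \<open>Only boundary sites see the outside of the box; their fraction tends to zero.\<close>

lemma avg_tail:
  "(\<lambda>L. avg L (\<lambda>x. norm (restrict_ell2 (- \<Lambda> L) ((A b ^^ i) (\<delta> x))))) \<longlonglongrightarrow> 0"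
proof (rule LIMSEQ_I)
  fix e :: real assume "0 < e"
  obtain R where R: "\<And>b. norm (restrict_ell2 (- \<Lambda> R) ((A b ^^ i) (\<delta> 0))) \<le> e / 2"
    using uniform_tail[OF half_gt_zero[OF \<open>0 < e\<close>]] by blast
  define t where "t L = (\<lambda>x. norm (restrict_ell2 (- \<Lambda> L) ((A b ^^ i) (\<delta> x))))" for L
  have t_le: "t L x \<le> M ^ i" for L x
  proof -
    have "t L x \<le> norm ((A b ^^ i) (\<delta> x))" unfolding t_def by (rule norm_restrict_le)
    also have "\<dots> \<le> M ^ i * norm (\<delta> x)" by (rule iterate_norm)
    also have "\<dots> \<le> M ^ i * 1" using M_pos by (intro mult_left_mono norm_delta_le) simp
    finally show ?thesis by simp
  qed
  \<comment> \<open>Translating \<open>x\<close> to 0 moves the outside of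
    \<open>\<Lambda> L\<close> beyond \<open>\<Lambda> R\<close>, where the tail bound applies at
    the parameter \<open>b - x\<close>.\<close>
  have t_small: "t L x \<le> e / 2" if "R \<le> L" "x \<in> \<Lambda> (L - R)" for L x
  proof -
    have "t L x = norm (restrict_ell2 {n. n + x \<in> - \<Lambda> L} ((A (b - of_int x) ^^ i) (\<delta> 0)))"
      unfolding t_def by (subst norm_shift[of x, symmetric])
        (simp add: shift_restrict iterate_covariant shift_delta)
    also have "\<dots> \<le> norm (restrict_ell2 (- \<Lambda> R) ((A (b - of_int x) ^^ i) (\<delta> 0)))"
      by (rule norm_restrict_mono) (use that in \<open>auto simp: \<Lambda>_def\<close>)
    also have "\<dots> \<le> e / 2" by (rule R)
    finally show ?thesis .
  qed
  \<comment> \<open>The \<open>2 R\<close> boundary sites contribute at most \<open>M ^ i\<close>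
    each; \<open>N\<close> keeps their total below \<open>e / 2\<close> per site of the box.\<close>
  obtain N :: nat where N: "2 * real R * M ^ i / (e / 2) < real N" using reals_Archimedean2 by blast
  have "norm (avg L (t L)) < e" if L: "L \<ge> max N R" for L
  proof -
    have sub: "\<Lambda> (L - R) \<subseteq> \<Lambda> L" by (rule \<Lambda>_mono) simp
    have "(\<Sum>x\<in>\<Lambda> L. t L x) = (\<Sum>x\<in>\<Lambda> (L - R). t L x) + (\<Sum>x\<in>\<Lambda> L - \<Lambda> (L - R). t L x)"
      using sum.subset_diff[OF sub finite_\<Lambda>, of "t L"] by simp
    also have "\<dots> \<le> real (card (\<Lambda> (L - R))) * (e / 2) + real (card (\<Lambda> L - \<Lambda> (L - R))) * M ^ i"
      using L by (intro add_mono sum_bounded_above t_small t_le) auto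
    also have "card (\<Lambda> L - \<Lambda> (L - R)) = 2 * R"
      using L by (subst card_Diff_subset[OF finite_\<Lambda> sub]) (simp add: card_\<Lambda>, arith)
    also have "real (card (\<Lambda> (L - R))) * (e / 2) \<le> real (2 * L + 1) * (e / 2)"
      using \<open>0 < e\<close> by (intro mult_right_mono) (auto simp: card_\<Lambda>)
    also have "real (2 * R) * M ^ i < real (2 * L + 1) * (e / 2)"
    proof -
      have "2 * real R * M ^ i < real N * (e / 2)" using N \<open>0 < e\<close> by (simp add: field_simps)
      also have "\<dots> \<le> real (2 * L + 1) * (e / 2)" using L \<open>0 < e\<close> by (intro mult_right_mono) auto
      finally show ?thesis by simp
    qed
    finally have "(\<Sum>x\<in>\<Lambda> L. t L x) < e * real (2 * L + 1)" by (simp add: algebra_simps)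
    then have "avg L (t L) < e" unfolding avg_def card_\<Lambda> by (subst pos_divide_less_eq) simp_all
    moreover have "0 \<le> avg L (t L)" by (simp add: avg_def t_def sum_nonneg)
    ultimately show ?thesis by simp
  qed
  then show "\<exists>N. \<forall>L\<ge>N. norm (avg L (\<lambda>x. norm (restrict_ell2 (- \<Lambda> L) ((A b ^^ i) (\<delta> x)))) - 0) < e"
    by (intro exI[of _ "max N R"]) (simp add: t_def)
qed

text \<open>Shaped so that \<open>H\<^sub>r\<^sub>L\<close> is literally the case
  \<open>A = H\<^sub>r\<close>.\<close>

definition AL :: "nat \<Rightarrow> real \<Rightarrow> ell2 \<Rightarrow> ell2" where
  "AL L b = restrict_ell2 (\<Lambda> L) \<circ> A b \<circ> restrict_ell2 (\<Lambda> L)"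

lemma bound_AL: "norm (AL L b \<psi>) \<le> M * norm \<psi>"
proof -
  have "norm (AL L b \<psi>) \<le> M * norm (restrict_ell2 (\<Lambda> L) \<psi>)"
    unfolding AL_def o_def by (rule order_trans[OF norm_restrict_le bound])
  also have "\<dots> \<le> M * norm \<psi>" using M_pos by (intro mult_left_mono norm_restrict_le) simp
  finally show ?thesis .
qed

lemma bcl_AL: "bounded_clinear (AL L b)"
  unfolding AL_def o_def
  by (intro bounded_clinear_compose[OF bounded_clinear_restrict] bounded_clinear_compose[OF bcl]
      bounded_clinear_restrict)

lemma selfadj_AL: "self_adjoint (AL L b)"
  using selfadj[of b] bcl_AL by (simp add: self_adjoint_def AL_def inner_restrict)

text \<open>The induction runs on averages, as the error at single sites near the boundary need not
  be small. One step amplifies the previous error by at most \<open>M\<close> and adds what lies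
  outside the box before and after applying \<open>A\<close>.\<close>

lemma avg_iterate_AL: "(\<lambda>L. avg L (\<lambda>x. norm ((A b ^^ i) (\<delta> x) - (AL L b ^^ i) (\<delta> x)))) \<longlonglongrightarrow> 0"
proof (induction i)
  case 0
  show ?case using avg_const[of _ "0 :: real"] by simp
next
  case (Suc i)
  define t where "t i L = (\<lambda>x. norm (restrict_ell2 (- \<Lambda> L) ((A b ^^ i) (\<delta> x))))" for i L
  define D where "D i L = (\<lambda>x. norm ((A b ^^ i) (\<delta> x) - (AL L b ^^ i) (\<delta> x)))" for i L
  have t_lim: "(\<lambda>L. avg L (t i L)) \<longlonglongrightarrow> 0" for i unfolding t_def by (rule avg_tail)
  have D_lim: "(\<lambda>L. avg L (D i L)) \<longlonglongrightarrow> 0" unfolding D_def by (rule Suc)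
  have step: "D (Suc i) L x \<le> M * D i L x + (t (Suc i) L x + M * t i L x)" for L x
  proof -
    let ?P = "restrict_ell2 (\<Lambda> L)" and ?v = "(A b ^^ i) (\<delta> x)" and ?w = "(AL L b ^^ i) (\<delta> x)"
    have eq: "A b ?v - AL L b ?w = AL L b (?v - ?w) + ((A b ?v - ?P (A b ?v)) + ?P (A b (?v - ?P ?v)))"
      unfolding AL_def o_def by (simp add: restrict_simps bounded_clinear_simps[OF bcl])
    have 1: "norm (AL L b (?v - ?w)) \<le> M * D i L x" unfolding D_def by (rule bound_AL)
    have 2: "norm (A b ?v - ?P (A b ?v)) \<le> t (Suc i) L x" by (simp add: restrict_compl t_def)
    have 3: "norm (?P (A b (?v - ?P ?v))) \<le> M * t i L x"
      unfolding restrict_compl t_def by (rule order_trans[OF norm_restrict_le bound])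
    have "norm ((A b ?v - ?P (A b ?v)) + ?P (A b (?v - ?P ?v))) \<le> t (Suc i) L x + M * t i L x"
      by (rule order_trans[OF norm_triangle_ineq add_mono[OF 2 3]])
    from order_trans[OF norm_triangle_ineq add_mono[OF 1 this]]
    show ?thesis unfolding D_def[of "Suc i"] funpow.simps o_apply eq .
  qed
  have "avg L (D (Suc i) L) \<le> M * avg L (D i L) + (avg L (t (Suc i) L) + M * avg L (t i L))" for L
    unfolding avg_mult[symmetric] avg_add[symmetric] by (rule avg_mono) (rule step)
  moreover have "(\<lambda>L. M * avg L (D i L) + (avg L (t (Suc i) L) + M * avg L (t i L))) \<longlonglongrightarrow> 0"
    by (intro tendsto_add_zero tendsto_mult_right_zero t_lim D_lim)
  moreover have "0 \<le> avg L (D (Suc i) L)" for L by (simp add: avg_def D_def sum_nonneg)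
  ultimately have "(\<lambda>L. avg L (D (Suc i) L)) \<longlonglongrightarrow> 0"
    by (rule null_sequence_squeeze)
  then show ?case by (simp add: D_def)
qed

lemma avg_poly_AL: "(\<lambda>L. avg L (\<lambda>x. norm (poly_op p (A b) (\<delta> x) - poly_op p (AL L b) (\<delta> x)))) \<longlonglongrightarrow> 0"
proof -
  let ?D = "\<lambda>i L x. norm ((A b ^^ i) (\<delta> x) - (AL L b ^^ i) (\<delta> x))"
  let ?E = "\<lambda>L. avg L (\<lambda>x. norm (poly_op p (A b) (\<delta> x) - poly_op p (AL L b) (\<delta> x)))"
  have "avg L (\<lambda>x. norm (poly_op p (A b) (\<delta> x) - poly_op p (AL L b) (\<delta> x)))
      \<le> (\<Sum>i\<le>degree p. cmod (coeff p i) * avg L (?D i L))" for L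
    unfolding avg_mult[symmetric] avg_sum[symmetric]
  proof (rule avg_mono)
    fix x
    have "poly_op p (A b) (\<delta> x) - poly_op p (AL L b) (\<delta> x)
        = (\<Sum>i\<le>degree p. coeff p i *\<^sub>C ((A b ^^ i) (\<delta> x) - (AL L b ^^ i) (\<delta> x)))"
      by (simp add: poly_op_def scaleC_diff_right sum_subtractf)
    also have "norm \<dots> \<le> (\<Sum>i\<le>degree p. cmod (coeff p i) * ?D i L x)"
      by (rule order_trans[OF norm_sum]) simp
    finally show "norm (poly_op p (A b) (\<delta> x) - poly_op p (AL L b) (\<delta> x))
        \<le> (\<Sum>i\<le>degree p. cmod (coeff p i) * ?D i L x)" .
  qed
  moreover have "(\<lambda>L. \<Sum>i\<le>degree p. cmod (coeff p i) * avg L (?D i L)) \<longlonglongrightarrow> 0"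
    by (rule tendsto_null_sum) (rule tendsto_mult_right_zero[OF avg_iterate_AL])
  moreover have "0 \<le> ?E L" for L by (simp add: avg_def sum_nonneg)
  ultimately show "?E \<longlonglongrightarrow> 0" by (rule null_sequence_squeeze)
qed

text \<open>Twice \<open>e / 4\<close> comes from one polynomial that serves both operators at every
  \<open>L\<close> and \<open>x\<close>, since truncations obey the same bound \<open>M\<close>; the
  averaged polynomial error is below \<open>e / 2\<close> for large \<open>L\<close>.\<close>

lemma avg_cfc_AL:
  assumes g: "continuous_on UNIV g"
  shows "(\<lambda>L. avg L (\<lambda>x. coord (cfc g (A b) (\<delta> x)) x) - avg L (\<lambda>x. coord (cfc g (AL L b) (\<delta> x)) x)) \<longlonglongrightarrow> 0"
proof (rule LIMSEQ_I)
  fix e :: real assume "0 < e"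
  then have "0 < e / 4" by simp
  note gM = continuous_on_subset[OF g subset_UNIV]
  obtain p :: "complex poly" where p: "\<And>x. x \<in> {-M..M} \<Longrightarrow> cmod (poly p (of_real x) - g x) \<le> e / 4"
    using Weierstrass_le[OF g \<open>0 < e / 4\<close>] by metis
  define D where "D L x = norm (poly_op p (A b) (\<delta> x) - poly_op p (AL L b) (\<delta> x))" for L x
  have "\<forall>\<^sub>F L in sequentially. avg L (D L) < e / 2"
    using avg_poly_AL[of p b] half_gt_zero[OF \<open>0 < e\<close>] unfolding D_def by (rule order_tendstoD(2))
  then obtain N where N: "\<And>L. L \<ge> N \<Longrightarrow> avg L (D L) < e / 2" by (auto simp: eventually_sequentially)
  have "norm (avg L (\<lambda>x. coord (cfc g (A b) (\<delta> x)) x) - avg L (\<lambda>x. coord (cfc g (AL L b) (\<delta> x)) x)) < e"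
    if "L \<ge> N" for L
  proof -
    have "cmod (coord (cfc g (A b) (\<delta> x)) x - coord (cfc g (AL L b) (\<delta> x)) x) \<le> D L x + e / 2" for x
    proof -
      have 1: "norm (poly_op p (A b) (\<delta> x) - cfc g (A b) (\<delta> x)) \<le> e / 4"
        using order_trans[OF cfc_approx[OF selfadj bound gM p] mult_left_mono[OF norm_delta_le]] \<open>0 < e\<close>
        by simp
      have 2: "norm (poly_op p (AL L b) (\<delta> x) - cfc g (AL L b) (\<delta> x)) \<le> e / 4"
        using order_trans[OF cfc_approx[OF selfadj_AL bound_AL gM p] mult_left_mono[OF norm_delta_le]] \<open>0 < e\<close>
        by simp
      have "cmod (coord (cfc g (A b) (\<delta> x)) x - coord (cfc g (AL L b) (\<delta> x)) x)
          \<le> norm (cfc g (A b) (\<delta> x) - cfc g (AL L b) (\<delta> x))"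
        unfolding coord_diff[symmetric] by (rule norm_coord_le)
      also have "cfc g (A b) (\<delta> x) - cfc g (AL L b) (\<delta> x)
          = (poly_op p (A b) (\<delta> x) - poly_op p (AL L b) (\<delta> x))
            + ((poly_op p (AL L b) (\<delta> x) - cfc g (AL L b) (\<delta> x))
              - (poly_op p (A b) (\<delta> x) - cfc g (A b) (\<delta> x)))" by simp
      also have "norm \<dots> \<le> D L x + (e / 4 + e / 4)"
        unfolding D_def
        by (rule order_trans[OF norm_triangle_ineq add_left_mono[OF order_trans[OF norm_triangle_ineq4 add_mono[OF 2 1]]]])
      finally show ?thesis by simp
    qed
    then have "avg L (\<lambda>x. cmod (coord (cfc g (A b) (\<delta> x)) x - coord (cfc g (AL L b) (\<delta> x)) x)) \<le> avg L (\<lambda>x. D L x + e / 2)"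
      by (intro avg_mono)
    also have "\<dots> < e" using N[OF that] by (simp add: avg_add avg_const)
    finally show ?thesis unfolding avg_diff[symmetric] by (rule le_less_trans[OF norm_avg_le])
  qed
  then show "\<exists>N. \<forall>L\<ge>N. norm (avg L (\<lambda>x. coord (cfc g (A b) (\<delta> x)) x)
      - avg L (\<lambda>x. coord (cfc g (AL L b) (\<delta> x)) x) - 0) < e" by auto
qed

text \<open>By \<open>cfc_covariant\<close> and \<open>cfc_continuous\<close> the untruncated
  averages are orbit averages of a continuous periodic function; truncation changes them by a null
  sequence. The limit is obtained at every \<open>b\<close>.\<close>

theorem dos_limit:
  assumes g: "continuous_on UNIV g"
  shows "(\<lambda>L. avg L (\<lambda>x. coord (cfc g (AL L b) (\<delta> x)) x))
    \<longlonglongrightarrow> (LBINT b':{0..\<alpha>}. coord (cfc g (A b') (\<delta> 0)) 0) / of_real \<alpha>"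
proof -
  have "avg L (\<lambda>x. coord (cfc g (A b) (\<delta> x)) x)
      = (\<Sum>x=-int L..int L. coord (cfc g (A (b - of_int x)) (\<delta> 0)) 0) / of_nat (2 * L + 1)" for L
    unfolding avg_def card_\<Lambda> unfolding \<Lambda>_def
    by (intro arg_cong2[where f = "(/)"] sum.cong refl cfc_covariant[OF g])
  then have "(\<lambda>L. avg L (\<lambda>x. coord (cfc g (A b) (\<delta> x)) x))
      \<longlonglongrightarrow> (LBINT b':{0..\<alpha>}. coord (cfc g (A b') (\<delta> 0)) 0) / of_real \<alpha>"
    by (simp only:, intro equidistribution[OF cfc_continuous[OF g] _ period_pos irrational]) (simp add: periodic)
  from tendsto_diff[OF this avg_cfc_AL[OF g, of b]] show ?thesis by simp
qed

text \<open>Each diagonal entry depends on \<open>g\<close> linearly, contractively and with value 1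
  at the constant 1, and averaging over sites keeps all three, so the representation theorem
  applies.\<close>

lemma empirical_representation:
  obtains N where "radon_measure N"
    "\<And>g. g \<in> C\<^sub>c \<Longrightarrow> integral\<^sup>L N g = avg L (\<lambda>x. coord (cfc g (AL L b) (\<delta> x)) x)"
proof (rule contractive_functional_representation[OF M_pos,
      where I = "\<lambda>g. avg L (\<lambda>x. coord (cfc g (AL L b) (\<delta> x)) x)"])
  show "avg L (\<lambda>x. coord (cfc (\<lambda>y. f y + g y) (AL L b) (\<delta> x)) x)
      = avg L (\<lambda>x. coord (cfc f (AL L b) (\<delta> x)) x) + avg L (\<lambda>x. coord (cfc g (AL L b) (\<delta> x)) x)"
    if "continuous_on UNIV f" "continuous_on UNIV g" for f g
    by (simp add: cfc_add[OF selfadj_AL bound_AL that] avg_add)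
  show "avg L (\<lambda>x. coord (cfc (\<lambda>y. c * f y) (AL L b) (\<delta> x)) x) = c * avg L (\<lambda>x. coord (cfc f (AL L b) (\<delta> x)) x)"
    if "continuous_on UNIV f" for c f
    by (simp add: cfc_scale[OF selfadj_AL bound_AL that] avg_mult)
  show "avg L (\<lambda>x. coord (cfc (\<lambda>_. 1) (AL L b) (\<delta> x)) x) = 1"
    by (simp add: cfc_one[OF selfadj_AL bound_AL] coord_delta avg_const)
  show "cmod (avg L (\<lambda>x. coord (cfc f (AL L b) (\<delta> x)) x)) \<le> \<epsilon>"
    if f: "continuous_on UNIV f" "\<And>x. x \<in> {-M..M} \<Longrightarrow> cmod (f x) \<le> \<epsilon>" for f \<epsilon>
  proof -
    have "0 \<le> \<epsilon>" using order_trans[OF norm_ge_zero f(2)[of 0]] M_pos by simp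
    then have "cmod (coord (cfc f (AL L b) (\<delta> x)) x) \<le> \<epsilon>" for x
      using norm_coord_le cfc_norm_le[OF selfadj_AL bound_AL f] mult_left_mono[OF norm_delta_le[of x], of \<epsilon>]
      by (meson order_trans mult_left_le norm_delta_le)
    then have "avg L (\<lambda>x. cmod (coord (cfc f (AL L b) (\<delta> x)) x)) \<le> avg L (\<lambda>x. \<epsilon>)" by (intro avg_mono)
    then show ?thesis unfolding avg_const by (rule order_trans[OF norm_avg_le])
  qed
qed (rule that)

text \<open>\<open>cfc_continuous\<close> makes the integrand integrable; the factor
  \<open>1 / \<alpha>\<close> makes the functional unital and contractive.\<close>

lemma dos_representation:
  obtains N where "radon_measure N"
    "\<And>g. g \<in> C\<^sub>c \<Longrightarrow> integral\<^sup>L N g = (LBINT b':{0..\<alpha>}. coord (cfc g (A b') (\<delta> 0)) 0) / of_real \<alpha>"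
proof (rule contractive_functional_representation[OF M_pos,
      where I = "\<lambda>g. (LBINT b':{0..\<alpha>}. coord (cfc g (A b') (\<delta> 0)) 0) / of_real \<alpha>"])
  let ?F = "\<lambda>g b. coord (cfc g (A b) (\<delta> 0)) 0"
  have int: "set_integrable lborel {0..\<alpha>} (?F f)" if "continuous_on UNIV f" for f
    by (rule borel_integrable_atLeastAtMost') (rule continuous_on_subset[OF cfc_continuous[OF that] subset_UNIV])
  show "(LBINT b':{0..\<alpha>}. ?F (\<lambda>y. f y + g y) b') / of_real \<alpha>
      = (LBINT b':{0..\<alpha>}. ?F f b') / of_real \<alpha> + (LBINT b':{0..\<alpha>}. ?F g b') / of_real \<alpha>"
    if "continuous_on UNIV f" "continuous_on UNIV g" for f g
    by (simp add: cfc_add[OF selfadj bound that] set_integral_add(2)[OF int[OF that(1)] int[OF that(2)]] add_divide_distrib)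
  show "(LBINT b':{0..\<alpha>}. ?F (\<lambda>y. c * f y) b') / of_real \<alpha> = c * ((LBINT b':{0..\<alpha>}. ?F f b') / of_real \<alpha>)"
    if "continuous_on UNIV f" for c f
    by (simp add: cfc_scale[OF selfadj bound that])
  show "(LBINT b':{0..\<alpha>}. ?F (\<lambda>_. 1) b') / of_real \<alpha> = 1"
    using period_pos by (simp add: cfc_one[OF selfadj bound] coord_delta set_integral_const scaleR_conv_of_real)
  show "cmod ((LBINT b':{0..\<alpha>}. ?F f b') / of_real \<alpha>) \<le> \<epsilon>"
    if f: "continuous_on UNIV f" "\<And>x. x \<in> {-M..M} \<Longrightarrow> cmod (f x) \<le> \<epsilon>" for f \<epsilon>
  proof -
    have "0 \<le> \<epsilon>" using order_trans[OF norm_ge_zero f(2)[of 0]] M_pos by simp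
    then have F_le: "cmod (?F f b') \<le> \<epsilon>" for b'
      using norm_coord_le cfc_norm_le[OF selfadj bound f]
      by (meson order_trans mult_left_le norm_delta_le)
    have "cmod (LBINT b':{0..\<alpha>}. ?F f b') \<le> (LBINT b':{0..\<alpha>}. \<epsilon>)"
      unfolding set_lebesgue_integral_def
    proof (rule Bochner_Integration.integral_norm_bound_integral)
      show "integrable lborel (\<lambda>b. indicator {0..\<alpha>} b *\<^sub>R ?F f b)"
        using int[OF f(1)] by (simp add: set_integrable_def)
      show "integrable lborel (\<lambda>b. indicator {0..\<alpha>} b *\<^sub>R \<epsilon>)"
        using period_pos by (intro integrable_scaleR_left integrable_real_indicator) auto
    qed (use F_le \<open>0 \<le> \<epsilon>\<close> in \<open>auto simp: indicator_def\<close>)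
    also have "\<dots> = \<alpha> * \<epsilon>" using period_pos by (simp add: set_integral_const)
    finally show ?thesis using period_pos by (simp add: norm_divide field_simps)
  qed
qed (rule that)

end

theorem corollary3p8:
  fixes \<theta> \<mu> :: real and h :: "real \<Rightarrow> real"
  assumes "0 < \<theta>" "\<theta> < 1" "\<theta> \<notin> \<rat>"
    and "\<mu> \<notin> {0..4}"
    and "\<And>\<eta>. h (- \<eta>) = h \<eta>" "smooth h" "exponentially_decaying h"
  shows "AE b in lebesgue. b \<in> {0..<1 - \<theta>} \<longrightarrow>
    (\<forall>g\<in>C\<^sub>c.
      (\<lambda>L. (\<Sum>x\<in>\<Lambda> L. cinner (\<delta> x) (cfc g (H\<^sub>r\<^sub>L \<theta> \<mu> h L b) (\<delta> x))) /
          of_nat (card (\<Lambda> L)))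
        \<longlonglongrightarrow> (LBINT b':{0..1 - \<theta>}. cinner (\<delta> 0) (cfc g (H\<^sub>r \<theta> \<mu> h b') (\<delta> 0))) /
              of_real (1 - \<theta>)) \<and>
    (\<forall>g\<in>C\<^sub>c.
      (\<lambda>L. integral\<^sup>L (empirical_dos \<theta> \<mu> h b L) g) \<longlonglongrightarrow> integral\<^sup>L (dos \<theta> \<mu> h) g)"
proof -
  have "h differentiable at x" for x
    using assms(6)[unfolded smooth_def, rule_format, of 0 x]
    by (simp add: field_differentiable_imp_differentiable)
  then have "continuous_on UNIV h"
    by (simp add: continuous_on_eq_continuous_at differentiable_imp_continuous_within)
  then obtain M where "covariant_family (H\<^sub>r \<theta> \<mu> h) (1 - \<theta>) M"
    using covariant_family_H\<^sub>r[OF assms(2-5) _ assms(7)] by blast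
  then interpret covariant_family "H\<^sub>r \<theta> \<mu> h" "1 - \<theta>" M .
  have AL: "H\<^sub>r\<^sub>L \<theta> \<mu> h L b = AL L b" for L b
    by (simp add: H\<^sub>r\<^sub>L_def AL_def)
  have lim: "(\<lambda>L. (\<Sum>x\<in>\<Lambda> L. cinner (\<delta> x) (cfc g (H\<^sub>r\<^sub>L \<theta> \<mu> h L b) (\<delta> x))) / of_nat (card (\<Lambda> L)))
      \<longlonglongrightarrow> (LBINT b':{0..1 - \<theta>}. cinner (\<delta> 0) (cfc g (H\<^sub>r \<theta> \<mu> h b') (\<delta> 0))) / of_real (1 - \<theta>)"
    if "g \<in> C\<^sub>c" for g b
    using dos_limit[OF C\<^sub>c_D(1)[OF that], of b] by (simp only: AL cinner_delta avg_def)
  \<comment> \<open>Being a definite description, \<open>empirical_dos\<close> has its intended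
    integrals only once a representing measure is exhibited; the same holds for \<open>dos\<close>
    below.\<close>
  have emp: "integral\<^sup>L (empirical_dos \<theta> \<mu> h b L) g
      = (\<Sum>x\<in>\<Lambda> L. cinner (\<delta> x) (cfc g (H\<^sub>r\<^sub>L \<theta> \<mu> h L b) (\<delta> x))) / of_nat (card (\<Lambda> L))"
    if "g \<in> C\<^sub>c" for g b L
  proof -
    obtain N where "radon_measure N"
      "\<And>g. g \<in> C\<^sub>c \<Longrightarrow> integral\<^sup>L N g = (\<Sum>x\<in>\<Lambda> L. cinner (\<delta> x) (cfc g (H\<^sub>r\<^sub>L \<theta> \<mu> h L b) (\<delta> x))) / of_nat (card (\<Lambda> L))"
      using empirical_representation[of L b] unfolding AL cinner_delta avg_def by blast
    then show ?thesis unfolding empirical_dos_def using that by (rule the_radon_measure_integral)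
  qed
  have dos: "integral\<^sup>L (dos \<theta> \<mu> h) g
      = (LBINT b':{0..1 - \<theta>}. cinner (\<delta> 0) (cfc g (H\<^sub>r \<theta> \<mu> h b') (\<delta> 0))) / of_real (1 - \<theta>)"
    if "g \<in> C\<^sub>c" for g
  proof -
    obtain N where "radon_measure N" "\<And>g. g \<in> C\<^sub>c \<Longrightarrow> integral\<^sup>L N g
        = (LBINT b':{0..1 - \<theta>}. cinner (\<delta> 0) (cfc g (H\<^sub>r \<theta> \<mu> h b') (\<delta> 0))) / of_real (1 - \<theta>)"
      using dos_representation unfolding cinner_delta by blast
    then show ?thesis unfolding dos_def using that by (rule the_radon_measure_integral)
  qed
  \<comment> \<open>The limit is available at each \<open>b\<close>, so the exceptional null set is
    empty here; weak convergence is the same limit rewritten by \<open>emp\<close> and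
    \<open>dos\<close>.\<close>
  show ?thesis
    by (rule AE_I2, intro impI conjI ballI) (simp_all only: lim emp dos)
qed

end
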